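(* Let $X=G/\Gamma$ be a nilmanifold with $G$ a 2-step nilpotent group (i.e. $[G,[G,G]]=\{1\}$), fix $u\in G$, let $T(g\Gamma)=ug\Gamma$, and suppose $(X,T)$ is transitive. Then for every Borel probability measure $\mu$ on $X$ that projects to Haar measure on the maximal torus factor $X_1$, and every $f\in C(X)$, $\lim_{n\to\infty}\int_X f\circ T^n\,d\mu=\int_X f\,dm$, i.e. $T^n_*\mu\to m$ in the weak$^*$ topology.
   Context: A nilmanifold is $X=G/\Gamma$ with $G$ a connected nilpotent Lie group and $\Gamma$ a discrete cocompact subgroup; $m$ is the unique $G$-invariant (Haar) probability measure on $X$. With lower central series $G_0=G$, $G_{n+1}=[G,G_n]$, the maximal torus factor is $X_1=G/G_1\Gamma$ with projection $\pi:X\to X_1$; "$\mu$ projects to Haar measure on $X_1$" means $\pi_*\mu$ is Haar measure on $X_1$. $T^n_*\mu$ denotes the push-forward, $\int f\,dT^n_*\mu=\int f\circ T^n\,d\mu$. *)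

theory Defs
  imports "HOL-Algebra.Coset" "HOL-Algebra.Generated_Groups" "HOL-Probability.Probability"
begin

fun lower_central :: "('g, 'b) monoid_scheme \<Rightarrow> nat \<Rightarrow> 'g set" where
  "lower_central G 0 = carrier G"
| "lower_central G (Suc n) =
     generate G {x \<otimes>\<^bsub>G\<^esub> y \<otimes>\<^bsub>G\<^esub> inv\<^bsub>G\<^esub> x \<otimes>\<^bsub>G\<^esub> inv\<^bsub>G\<^esub> y
                  | x y. x \<in> carrier G \<and> y \<in> lower_central G n}"

definition topological_group :: "('g::t2_space, 'b) monoid_scheme \<Rightarrow> bool" where
  "topological_group G \<longleftrightarrow> group G \<and> carrier G = UNIV \<and>
     continuous_on UNIV (\<lambda>p::'g \<times> 'g. fst p \<otimes>\<^bsub>G\<^esub> snd p) \<and>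
     continuous_on UNIV (\<lambda>x. inv\<^bsub>G\<^esub> x)"

text \<open>Lie group, rendered as a topological group that is a topological manifold
  (locally homeomorphic to open subsets of the Euclidean space 'e); by the solution of
  Hilbert's fifth problem (Gleason--Montgomery--Zippin) this is equivalent.\<close>
definition lie_group :: "('g::t2_space, 'b) monoid_scheme \<Rightarrow> 'e::euclidean_space itself \<Rightarrow> bool" where
  "lie_group G E \<longleftrightarrow> topological_group G \<and>
     (\<forall>x::'g. \<exists>U (V::'e set). open U \<and> x \<in> U \<and> open V \<and> U homeomorphic V)"

definition coset_quotient_map ::
    "('g::topological_space, 'b) monoid_scheme \<Rightarrow> 'g set \<Rightarrow> ('g \<Rightarrow> 'y::topological_space) \<Rightarrow> bool" where
  "coset_quotient_map G H q \<longleftrightarrow> surj q \<and>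
     (\<forall>S. open S \<longleftrightarrow> open (q -` S)) \<and>
     (\<forall>g h. q g = q h \<longleftrightarrow> inv\<^bsub>G\<^esub> g \<otimes>\<^bsub>G\<^esub> h \<in> H)"

text \<open>Left translation by a on G/H (well defined when q is the quotient map).\<close>
definition left_transl :: "('g, 'b) monoid_scheme \<Rightarrow> ('g \<Rightarrow> 'y) \<Rightarrow> 'g \<Rightarrow> 'y \<Rightarrow> 'y" where
  "left_transl G q a x = q (a \<otimes>\<^bsub>G\<^esub> (SOME g. q g = x))"

text \<open>Haar measure on G/H: a G-invariant Borel probability measure (it is unique).\<close>
definition haar_on_quotient ::
    "('g, 'b) monoid_scheme \<Rightarrow> ('g \<Rightarrow> 'y::topological_space) \<Rightarrow> 'y measure \<Rightarrow> bool" where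
  "haar_on_quotient G q m \<longleftrightarrow> sets m = sets borel \<and> prob_space m \<and>
     (\<forall>a \<in> carrier G. distr m borel (left_transl G q a) = m)"

definition top_transitive :: "('x::topological_space \<Rightarrow> 'x) \<Rightarrow> bool" where
  "top_transitive T \<longleftrightarrow> (\<exists>x. closure {(T ^^ n) x | n. True} = UNIV)"

end

theory Submission
  imports Defs "HOL-Complex_Analysis.Great_Picard"
begin

text \<open>The commutator subgroup \<open>G\<^sub>1\<close> is central, so it acts on \<open>X\<close> by an equicontinuous commuting group of
  maps preserving \<open>m\<close>.  The continuous functions \<open>e\<close> with \<open>e (z x) = \<chi> z * e x\<close> for \<open>z \<in> G\<^sub>1\<close> therefore
  span a uniformly dense subspace; this is a Peter--Weyl theorem, obtained from the spectral theory of the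
  compact operator with the \<open>G\<^sub>1\<close>-invariant kernel \<open>sup\<^sub>z |f (z x) - f (z y)|\<close>, and it needs neither
  a Haar measure on the fibres nor the closedness of \<open>G\<^sub>1 \<Gamma>\<close>.

  If \<open>e\<close> is \<open>G\<^sub>1\<close>-invariant, it factors through \<open>X\<^sub>1\<close> and its integral along \<open>T\<^sup>n\<close> is constant.
  Otherwise \<open>g \<mapsto> \<integral> g d\<mu>\<close> is bounded in \<open>L\<^sup>2(m)\<close> on the functions with character \<open>\<chi>\<close>, since
  \<open>|g|\<close> factors through \<open>X\<^sub>1\<close>, so it suffices that the correlations \<open>\<integral> e (T\<^sup>n x) cnj (e x) dm\<close> tend to 0.
  Replacing \<open>x\<close> by \<open>h x\<close> multiplies them by \<open>\<chi> [u, h]\<^sup>n\<close>, up to a small error when \<open>h\<close> is close to \<open>1\<close>.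
  Transitivity makes \<open>h \<mapsto> \<chi> [u, h]\<close> nontrivial, and by connectedness a given neighbourhood of \<open>1\<close> contains,
  for all large \<open>n\<close>, some \<open>h\<close> with \<open>\<chi> [u, h]\<^sup>n = -1\<close>.\<close>

subsection \<open>Integration on compact spaces\<close>

text \<open>The obstacle is that \<mu> may be singular to \<open>m\<close>: spectral theory in
  \<open>L^2(m)\<close> says nothing about it directly, and the link has to pass through what the
  two measures share, the integrals of functions on the torus. Taking absolute values erases the
  character of a function and lands there. The resulting \<open>L^2(m)\<close> bound is played
  against decaying correlations by a Bessel-type count: a phased sum of K widely spaced translates
  of \<open>e\<close> has norm at most of order sqrt K plus c K / 2, whereas its \<mu>-integral
  would be at least c K if the integrals along T^n did not tend to 0.

  The space is compact Hausdorff with no countable base assumed. Sequences therefore come from the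
  dense orbit, and both the exchange of integrals and the Arzela-Ascoli argument run through finite
  covers. All analysis stays within continuous functions: the kernel operator turns
  \<open>L^2\<close> bounds into uniform ones, so limits of its images are continuous and no
  completion is formed.\<close>

lemma continuous_on_UNIV_bounded:
  fixes f :: "'x::topological_space \<Rightarrow> 'b::real_normed_vector"
  assumes "compact (UNIV :: 'x set)" "continuous_on UNIV f"
  obtains B where "B > 0" "\<And>x. norm (f x) \<le> B"
proof -
  have "bounded (range f)"
    using compact_continuous_image[OF assms(2,1)] compact_imp_bounded by blast
  then show thesis
    using that by (auto simp: bounded_pos)
qed

locale compact_prob_space =
  fixes m :: "'x::topological_space measure"
  assumes cpt: "compact (UNIV :: 'x set)"
    and sets_m: "sets m = sets borel"
    and prob_m: "prob_space m"
begin

lemma space_m [simp]: "space m = UNIV"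
  using sets_eq_imp_space_eq[OF sets_m] by simp

lemma measure_UNIV [simp]: "measure m UNIV = 1"
  using prob_space.prob_space[OF prob_m] by simp

lemma finite_m: "finite_measure m"
  using prob_m by (simp add: prob_space_def)

lemma measurable_continuous:
  fixes f :: "'x \<Rightarrow> 'b::topological_space"
  shows "continuous_on UNIV f \<Longrightarrow> f \<in> borel_measurable m"
  using borel_measurable_continuous_onI measurable_cong_sets[OF sets_m refl] by blast

lemma integrable_continuous:
  fixes f :: "'x \<Rightarrow> 'b::{banach,second_countable_topology}"
  assumes "continuous_on UNIV f"
  shows "integrable m f"
proof -
  obtain B where "\<And>x. norm (f x) \<le> B"
    using continuous_on_UNIV_bounded[OF cpt assms] by blast
  then show ?thesis
    by (intro finite_measure.integrable_const_bound[OF finite_m, of _ B] measurable_continuous assms)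
      auto
qed

lemma integral_const [simp]: "(\<integral>x. c \<partial>m) = (c :: 'b::{banach,second_countable_topology})"
  using integrable_continuous[of "\<lambda>_. c"] by simp

lemma integral_norm_le:
  fixes f :: "'x \<Rightarrow> 'b::{banach,second_countable_topology}"
  assumes "integrable m f" "\<And>x. norm (f x) \<le> B"
  shows "norm (\<integral>x. f x \<partial>m) \<le> B"
proof -
  have "norm (\<integral>x. f x \<partial>m) \<le> (\<integral>x. norm (f x) \<partial>m)"
    by (rule integral_norm_bound)
  also have "\<dots> \<le> (\<integral>x. B \<partial>m)"
    using assms integrable_continuous[of "\<lambda>_. B"] by (intro integral_mono) auto
  finally show ?thesis by simp
qed

lemma integral_diff_norm_le:
  fixes f :: "'x \<Rightarrow> 'b::{banach,second_countable_topology}"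
  assumes "integrable m f" "integrable m g" "\<And>x. norm (f x - g x) \<le> B"
  shows "norm ((\<integral>x. f x \<partial>m) - (\<integral>x. g x \<partial>m)) \<le> B"
  using integral_norm_le[of "\<lambda>x. f x - g x" B] assms by simp

text \<open>The variance of \<open>f\<close> is nonnegative; this is Cauchy-Schwarz against the
  constant 1.\<close>

lemma integral_square_le:
  fixes f :: "'x \<Rightarrow> real"
  assumes "continuous_on UNIV f"
  shows "(\<integral>x. f x \<partial>m)\<^sup>2 \<le> (\<integral>x. (f x)\<^sup>2 \<partial>m)"
proof -
  define a where "a = (\<integral>x. f x \<partial>m)"
  have i: "integrable m f" "integrable m (\<lambda>x. (f x)\<^sup>2)"
    using assms by (auto intro!: integrable_continuous continuous_intros)
  have "0 \<le> (\<integral>x. (f x - a)\<^sup>2 \<partial>m)"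
    by (intro integral_nonneg_AE) auto
  also have "(\<lambda>x. (f x - a)\<^sup>2) = (\<lambda>x. (f x)\<^sup>2 - 2 * a * f x + a\<^sup>2)"
    by (simp add: power2_diff algebra_simps)
  also have "(\<integral>x. (f x)\<^sup>2 - 2 * a * f x + a\<^sup>2 \<partial>m) = (\<integral>x. (f x)\<^sup>2 \<partial>m) - 2 * a * a + a\<^sup>2"
    using i integrable_continuous[of "\<lambda>_. a\<^sup>2"] by (simp add: a_def)
  finally show ?thesis by (simp add: a_def power2_eq_square)
qed

end

text \<open>The product of two Borel algebras need not contain the open sets of the product space, so
  Tonelli--Fubini does not apply; instead the kernel is approximated uniformly by kernels that
  depend on \<open>x\<close> only through a finite Borel partition.\<close>

lemma equicontinuous_finite_partition:
  fixes K :: "'x::topological_space \<Rightarrow> 'y \<Rightarrow> 'b::real_normed_vector"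
  assumes cpt: "compact (UNIV :: 'x set)" and e: "e > 0"
    and equi: "\<And>x. \<exists>U. open U \<and> x \<in> U \<and> (\<forall>x'\<in>U. \<forall>y. norm (K x' y - K x y) \<le> e)"
  obtains I :: "'x set" and A :: "'x \<Rightarrow> 'x set" where
    "finite I" "\<And>i. A i \<in> sets borel" "disjoint_family_on A I" "(\<Union>i\<in>I. A i) = UNIV"
    "\<And>i x y. i \<in> I \<Longrightarrow> x \<in> A i \<Longrightarrow> norm (K x y - K i y) \<le> e"
proof -
  obtain U where U: "\<And>x. open (U x)" "\<And>x. x \<in> U x"
    "\<And>x x' y. x' \<in> U x \<Longrightarrow> norm (K x' y - K x y) \<le> e"
    using equi by metis
  obtain I where I: "finite I" "(UNIV :: 'x set) \<subseteq> (\<Union>i\<in>I. U i)"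
  proof (rule compactE_image[OF cpt, of UNIV U])
    show "UNIV \<subseteq> (\<Union>x. U x)" using U(2) by blast
  qed (use U(1) that in auto)
  obtain xs where xs: "set xs = I" "distinct xs"
    using finite_distinct_list[OF I(1)] by blast
  define n where "n = length xs"
  define pos where "pos i = (THE k. k < n \<and> xs ! k = i)" for i
  have pos: "pos (xs ! k) = k" if "k < n" for k
    unfolding pos_def using that xs(2) by (intro the_equality) (auto simp: n_def nth_eq_iff_index_eq)
  \<comment> \<open>Each member of the cover gives up the points covered by members listed before
    it, so a point falls into the piece of the first member containing it. The index
    \<open>i\<close> itself serves as the sample point of its piece.\<close>
  define A where "A i = U i - (\<Union>k<pos i. U (xs ! k))" for i
  show thesis
  proof (rule that[of I A])
    show "finite I" by fact
    show "A i \<in> sets borel" for i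
      using U(1) unfolding A_def by (intro sets.Diff sets.finite_UN borel_open) auto
    show "disjoint_family_on A I"
    proof (unfold disjoint_family_on_def, safe, goal_cases)
      case (1 i j x)
      then obtain k l where kl: "i = xs ! k" "j = xs ! l" "k < n" "l < n"
        using xs by (metis in_set_conv_nth n_def)
      with 1 pos show ?case by (cases k l rule: linorder_cases) (auto simp: A_def)
    qed
    show "(\<Union>i\<in>I. A i) = UNIV"
    proof (safe; simp)
      fix x :: 'x
      obtain i where "i \<in> I" "x \<in> U i" using I(2) by blast
      moreover have "\<exists>k<n. xs ! k = i" if "i \<in> I" for i
        using that xs(1) by (simp add: n_def flip: in_set_conv_nth)
      ultimately have "\<exists>k<n. x \<in> U (xs ! k)" by blast
      then obtain k where "k < n \<and> x \<in> U (xs ! k)" "\<And>l. l < k \<Longrightarrow> \<not> (l < n \<and> x \<in> U (xs ! l))"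
        using exists_least_iff[of "\<lambda>k. k < n \<and> x \<in> U (xs ! k)"] by blast
      then show "\<exists>i\<in>I. x \<in> A i"
        using xs by (intro bexI[of _ "xs ! k"]) (auto simp: A_def pos n_def)
    qed
    show "norm (K x y - K i y) \<le> e" if "i \<in> I" "x \<in> A i" for i x y
      using that U(3) by (auto simp: A_def)
  qed
qed

text \<open>Freezing \<open>x\<close> at the sample point of its piece turns \<open>K\<close> into a
  finite sum of products, for which both orders of integration give the same number
  \<open>c\<close>; each iterated integral of \<open>K\<close> is within \<open>e\<close> of it.
  Integrability of the partial integrals is a hypothesis because in the applications they are
  explicit continuous functions.\<close>

lemma equicontinuous_Fubini:
  fixes K :: "'x::topological_space \<Rightarrow> 'y::topological_space \<Rightarrow> complex"
  assumes m: "compact_prob_space m" and n: "compact_prob_space n"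
    and equi: "\<And>x e. e > 0 \<Longrightarrow> \<exists>U. open U \<and> x \<in> U \<and> (\<forall>x'\<in>U. \<forall>y. norm (K x' y - K x y) \<le> e)"
    and cx: "\<And>y. continuous_on UNIV (\<lambda>x. K x y)" and cy: "\<And>x. continuous_on UNIV (K x)"
    and ix: "integrable m (\<lambda>x. \<integral>y. K x y \<partial>n)"
    and iy: "integrable n (\<lambda>y. \<integral>x. K x y \<partial>m)"
  shows "(\<integral>x. \<integral>y. K x y \<partial>n \<partial>m) = (\<integral>y. \<integral>x. K x y \<partial>m \<partial>n)"
proof -
  interpret m: compact_prob_space m by fact
  interpret n: compact_prob_space n by fact
  have *: "norm ((\<integral>x. \<integral>y. K x y \<partial>n \<partial>m) - (\<integral>y. \<integral>x. K x y \<partial>m \<partial>n)) \<le> 2 * e" if e: "e > 0" for e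
  proof -
    obtain I A where A: "finite I" "\<And>i. A i \<in> sets borel" "disjoint_family_on A I"
      "(\<Union>i\<in>I. A i) = (UNIV :: 'x set)"
      "\<And>i x y. i \<in> I \<Longrightarrow> x \<in> A i \<Longrightarrow> norm (K x y - K i y) \<le> e"
      by (rule equicontinuous_finite_partition[OF m.cpt e equi[OF e]]) (rule that)
    have Am: "A i \<in> sets m" for i using A(2) m.sets_m by simp
    define S where "S x y = (\<Sum>i\<in>I. of_real (indicator (A i) x) * K i y)" for x y
    have S: "S x y = K i y" if "i \<in> I" "x \<in> A i" for i x y
    proof -
      have "indicator (A j) x = (0::real)" if "j \<in> I - {i}" for j
        using A(3) \<open>i \<in> I\<close> \<open>x \<in> A i\<close> that by (auto simp: disjoint_family_on_def indicator_def)
      then have "(\<Sum>j\<in>I - {i}. of_real (indicator (A j) x) * K j y) = 0"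
        by (intro sum.neutral) auto
      then show ?thesis
        unfolding S_def using that A(1) by (simp add: sum.remove[of I i])
    qed
    have KS: "norm (K x y - S x y) \<le> e" for x y
    proof -
      obtain i where "i \<in> I" "x \<in> A i" using A(4) by blast
      then show ?thesis using A(5) S by simp
    qed
    have ind: "integrable m (\<lambda>x. complex_of_real (indicator (A i) x))" for i
      using Am finite_measure.emeasure_finite[OF m.finite_m]
      by (intro integrable_of_real integrable_real_indicator) (auto simp: less_top)
    have indv: "(\<integral>x. complex_of_real (indicator (A i) x) \<partial>m) = of_real (measure m (A i))" for i
      using Am by simp
    have KI: "integrable n (K i)" for i
      using cy by (rule n.integrable_continuous)
    have KI': "integrable m (\<lambda>x. K x y)" for y
      using cx by (rule m.integrable_continuous)
    have Sx: "(\<integral>x. S x y \<partial>m) = (\<Sum>i\<in>I. of_real (measure m (A i)) * K i y)"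
      and Sxi: "integrable m (\<lambda>x. S x y)" for y
      unfolding S_def using ind indv by (simp_all add: Bochner_Integration.integral_sum)
    have Sy: "(\<integral>y. S x y \<partial>n) = (\<Sum>i\<in>I. of_real (indicator (A i) x) * (\<integral>y. K i y \<partial>n))"
      and Syi: "integrable n (S x)" for x
      unfolding S_def using KI by (simp_all add: Bochner_Integration.integral_sum)
    define c where "c = (\<Sum>i\<in>I. of_real (measure m (A i)) * (\<integral>y. K i y \<partial>n))"
    have c1: "(\<integral>x. \<integral>y. S x y \<partial>n \<partial>m) = c" "integrable m (\<lambda>x. \<integral>y. S x y \<partial>n)"
      unfolding Sy c_def using ind indv by (simp_all add: Bochner_Integration.integral_sum)
    have c2: "(\<integral>y. \<integral>x. S x y \<partial>m \<partial>n) = c" "integrable n (\<lambda>y. \<integral>x. S x y \<partial>m)"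
      unfolding Sx c_def using KI by (simp_all add: Bochner_Integration.integral_sum)
    have "norm ((\<integral>x. \<integral>y. K x y \<partial>n \<partial>m) - c) \<le> e"
      unfolding c1(1)[symmetric]
      by (intro m.integral_diff_norm_le n.integral_diff_norm_le ix c1(2) KI Syi KS)
    moreover have "norm ((\<integral>y. \<integral>x. K x y \<partial>m \<partial>n) - c) \<le> e"
      unfolding c2(1)[symmetric]
      by (intro m.integral_diff_norm_le n.integral_diff_norm_le iy c2(2) KI' Sxi KS)
    ultimately show ?thesis
      using norm_triangle_ineq4[of "(\<integral>x. \<integral>y. K x y \<partial>n \<partial>m) - c" "(\<integral>y. \<integral>x. K x y \<partial>m \<partial>n) - c"] by simp
  qed
  have "norm ((\<integral>x. \<integral>y. K x y \<partial>n \<partial>m) - (\<integral>y. \<integral>x. K x y \<partial>m \<partial>n)) \<le> 0"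
    by (rule field_le_epsilon) (use *[of "e/2" for e] in simp)
  then show ?thesis by simp
qed

subsection \<open>Compact symmetric operators on continuous functions\<close>

abbreviation ccont :: "('x::topological_space \<Rightarrow> complex) \<Rightarrow> bool" where
  "ccont g \<equiv> continuous_on UNIV g"

text \<open>Full support makes the \<open>L^2\<close> seminorm definite on continuous functions,
  which allows Hilbert space arguments without passing to classes modulo null sets.\<close>

locale full_support_space = compact_prob_space m for m :: "'x::t2_space measure" +
  assumes full_support: "open S \<Longrightarrow> S \<noteq> {} \<Longrightarrow> measure m S > 0"
begin

section \<open>The \<open>L^2\<close> inner product on continuous functions\<close>

definition ip :: "('x \<Rightarrow> complex) \<Rightarrow> ('x \<Rightarrow> complex) \<Rightarrow> complex" where
  "ip f g = (\<integral>x. f x * cnj (g x) \<partial>m)"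

definition nsq :: "('x \<Rightarrow> complex) \<Rightarrow> real" where
  "nsq f = (\<integral>x. (cmod (f x))\<^sup>2 \<partial>m)"

lemma ip_integrable: "ccont f \<Longrightarrow> ccont g \<Longrightarrow> integrable m (\<lambda>x. f x * cnj (g x))"
  by (intro integrable_continuous continuous_intros) auto

lemma nsq_integrable: "ccont f \<Longrightarrow> integrable m (\<lambda>x. (cmod (f x))\<^sup>2)"
  by (intro integrable_continuous continuous_intros) auto

lemma ip_add: "ccont f \<Longrightarrow> ccont g \<Longrightarrow> ccont h \<Longrightarrow> ip (\<lambda>x. f x + g x) h = ip f h + ip g h"
  by (simp add: ip_def distrib_right ip_integrable)

lemma ip_scale: "ip (\<lambda>x. c * f x) h = c * ip f h"
  by (simp add: ip_def mult.assoc)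

lemma ip_cnj: "ip g f = cnj (ip f g)"
proof -
  have "ip g f = (\<integral>x. cnj (f x * cnj (g x)) \<partial>m)"
    by (simp add: ip_def mult.commute)
  also have "\<dots> = cnj (ip f g)"
    unfolding ip_def by (rule integral_bounded_linear'[OF bounded_linear_cnj bounded_linear_cnj]) simp
  finally show ?thesis .
qed

lemma ip_self: "ip f f = of_real (nsq f)"
proof -
  have "(\<lambda>x. f x * cnj (f x)) = (\<lambda>x. complex_of_real ((cmod (f x))\<^sup>2))"
    by (simp add: complex_norm_square del: of_real_power)
  then show ?thesis
    unfolding ip_def nsq_def by (simp only: integral_complex_of_real)
qed

lemma ip_add_right: "ccont f \<Longrightarrow> ccont g \<Longrightarrow> ccont h \<Longrightarrow> ip h (\<lambda>x. f x + g x) = ip h f + ip h g"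
  by (simp add: ip_cnj[of h] ip_add)

lemma ip_scale_right: "ip h (\<lambda>x. c * f x) = cnj c * ip h f"
  by (simp add: ip_cnj[of h] ip_scale)

lemma ip_zero [simp]: "ip (\<lambda>_. 0) h = 0" "ip h (\<lambda>_. 0) = 0"
  by (simp_all add: ip_def)

lemma ip_sum:
  assumes "finite B" "\<And>e. e \<in> B \<Longrightarrow> ccont (c e)" "ccont h"
  shows "ip (\<lambda>x. \<Sum>e\<in>B. c e x) h = (\<Sum>e\<in>B. ip (c e) h)"
  using assms(1,2)
proof (induction B rule: finite_induct)
  case (insert b B)
  then show ?case
    using assms(3) by (simp add: ip_add continuous_on_sum)
qed simp

lemma ip_diff: "ccont f \<Longrightarrow> ccont g \<Longrightarrow> ccont h \<Longrightarrow> ip (\<lambda>x. f x - g x) h = ip f h - ip g h"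
  by (simp add: ip_def left_diff_distrib ip_integrable)

lemma nsq_nonneg [simp]: "nsq f \<ge> 0"
  unfolding nsq_def by (intro integral_nonneg_AE) auto

lemma nsq_zero [simp]: "nsq (\<lambda>_. 0) = 0"
  by (simp add: nsq_def)

lemma nsq_scale: "nsq (\<lambda>x. c * f x) = (cmod c)\<^sup>2 * nsq f"
  by (simp add: nsq_def norm_mult power_mult_distrib)

lemma nsq_le:
  assumes "ccont f" "\<And>x. cmod (f x) \<le> B"
  shows "nsq f \<le> B\<^sup>2"
proof -
  have "nsq f \<le> (\<integral>x. B\<^sup>2 \<partial>m)"
    unfolding nsq_def using assms nsq_integrable[of f] integrable_continuous[of "\<lambda>_. B\<^sup>2"]
    by (intro integral_mono) (auto intro: power_mono)
  then show ?thesis by simp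
qed

lemma nsq_add_le:
  assumes "ccont f" "ccont g"
  shows "nsq (\<lambda>x. f x + g x) \<le> 2 * nsq f + 2 * nsq g"
proof -
  have "(cmod (a + b))\<^sup>2 \<le> 2 * (cmod a)\<^sup>2 + 2 * (cmod b)\<^sup>2" for a b
  proof -
    have "(cmod (a + b))\<^sup>2 \<le> (cmod a + cmod b)\<^sup>2"
      by (intro power_mono norm_triangle_ineq) auto
    also have "\<dots> \<le> 2 * (cmod a)\<^sup>2 + 2 * (cmod b)\<^sup>2"
      using sum_squares_bound[of "cmod a" "cmod b"] by (simp add: power2_sum)
    finally show ?thesis .
  qed
  then have "nsq (\<lambda>x. f x + g x) \<le> (\<integral>x. 2 * (cmod (f x))\<^sup>2 + 2 * (cmod (g x))\<^sup>2 \<partial>m)"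
    unfolding nsq_def using assms nsq_integrable
    by (intro integral_mono integrable_continuous continuous_intros) auto
  also have "\<dots> = 2 * nsq f + 2 * nsq g"
    using assms nsq_integrable by (simp add: nsq_def)
  finally show ?thesis .
qed

lemma nsq_diff_le: "ccont f \<Longrightarrow> ccont g \<Longrightarrow> nsq (\<lambda>x. f x - g x) \<le> 2 * nsq f + 2 * nsq g"
proof -
  assume fg: "ccont f" "ccont g"
  have "ccont (\<lambda>x. (-1) * g x)" using fg by (intro continuous_intros)
  from nsq_add_le[OF fg(1) this] nsq_scale[of "-1" g] show ?thesis by simp
qed

lemma nsq_expand:
  assumes "ccont f" "ccont g"
  shows "nsq (\<lambda>x. f x - of_real s * g x) = nsq f - 2 * s * Re (ip f g) + s\<^sup>2 * nsq g"
proof -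
  have c: "ccont (\<lambda>x. of_real s * g x)"
    using assms by (intro continuous_intros)
  have R: "ip h (\<lambda>x. f x - of_real s * g x) = ip h f - of_real s * ip h g" if "ccont h" for h
    using ip_diff[OF assms(1) c that]
    by (metis ip_cnj ip_scale complex_cnj_diff complex_cnj_mult complex_cnj_complex_of_real)
  have "ip (\<lambda>x. f x - of_real s * g x) (\<lambda>x. f x - of_real s * g x)
      = ip f (\<lambda>x. f x - of_real s * g x) - of_real s * ip g (\<lambda>x. f x - of_real s * g x)"
    using assms c by (simp add: ip_diff ip_scale continuous_intros)
  then have "Re (ip (\<lambda>x. f x - of_real s * g x) (\<lambda>x. f x - of_real s * g x))
    = nsq f - s * Re (ip f g) - s * (Re (ip g f) - s * nsq g)"
    using assms by (simp add: R ip_self)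
  then show ?thesis
    unfolding ip_self by (simp add: ip_cnj[of g f] power2_eq_square algebra_simps)
qed

text \<open>On the open set where |f| exceeds half of a nonzero value the integrand is bounded
  below, and this set has positive measure.\<close>

lemma nsq_eq_0:
  assumes "ccont f" "nsq f = 0"
  shows "f = (\<lambda>_. 0)"
proof (rule ccontr)
  assume "f \<noteq> (\<lambda>_. 0)"
  then obtain x0 where x0: "f x0 \<noteq> 0" by auto
  define r where "r = cmod (f x0) / 2"
  define S where "S = (\<lambda>x. cmod (f x)) -` {r<..}"
  have S: "open S" "x0 \<in> S" "r > 0"
    using assms(1) x0 by (auto simp: S_def r_def intro!: open_vimage continuous_intros)
  have Sm: "S \<in> sets m" using S(1) sets_m by simp
  have "r\<^sup>2 * measure m S = (\<integral>x. r\<^sup>2 * indicator S x \<partial>m)"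
    using Sm by simp
  also have "\<dots> \<le> nsq f"
    unfolding nsq_def
  proof (rule integral_mono)
    show "integrable m (\<lambda>x. r\<^sup>2 * indicator S x)"
      using Sm finite_measure.emeasure_finite[OF finite_m]
      by (intro integrable_mult_right integrable_real_indicator) (auto simp: less_top)
    show "integrable m (\<lambda>x. (cmod (f x))\<^sup>2)" by (rule nsq_integrable[OF assms(1)])
    show "r\<^sup>2 * indicator S x \<le> (cmod (f x))\<^sup>2" for x
      using S(3) by (auto simp: S_def indicator_def intro!: power_mono)
  qed
  finally show False
    using full_support[OF S(1)] S(2,3) assms(2) by (auto simp: mult_le_0_iff)
qed

lemma nsq_pos: "ccont f \<Longrightarrow> f \<noteq> (\<lambda>_. 0) \<Longrightarrow> nsq f > 0"
  using nsq_eq_0[of f] nsq_nonneg[of f] unfolding less_le by auto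

lemma normalize:
  assumes "ccont f" "f \<noteq> (\<lambda>_. 0)"
  obtains c where "c > 0" "nsq (\<lambda>x. of_real c * f x) = 1" "c\<^sup>2 = 1 / nsq f"
proof (rule that[of "1 / sqrt (nsq f)"])
  show "nsq (\<lambda>x. complex_of_real (1 / sqrt (nsq f)) * f x) = 1"
    unfolding nsq_scale using nsq_pos[OF assms] by (simp add: norm_divide power_divide)
qed (use nsq_pos[OF assms] in \<open>auto simp: power_divide\<close>)

text \<open>This is the passage from \<open>L^2\<close> control of \<open>g\<close> to uniform
  control of its image under an integral operator with bounded kernel \<open>k\<close>.\<close>

lemma integral_mult_le:
  assumes "continuous_on UNIV k" "ccont g" "\<And>y. \<bar>k y\<bar> \<le> c"
  shows "cmod (\<integral>y. of_real (k y) * g y \<partial>m) \<le> c * sqrt (nsq g)"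
proof -
  have c: "c \<ge> 0" using assms(3) abs_ge_zero order_trans by blast
  have "cmod (\<integral>y. of_real (k y) * g y \<partial>m) \<le> (\<integral>y. cmod (of_real (k y) * g y) \<partial>m)"
    by (rule integral_norm_bound)
  also have "\<dots> \<le> (\<integral>y. c * cmod (g y) \<partial>m)"
    using assms by (intro integral_mono integrable_continuous continuous_intros)
      (auto simp: norm_mult intro: mult_right_mono)
  also have "\<dots> = c * (\<integral>y. cmod (g y) \<partial>m)" by simp
  also have "\<dots> \<le> c * sqrt (nsq g)"
    using c integral_square_le[of "\<lambda>y. cmod (g y)"] assms(2)
    by (intro mult_left_mono real_le_rsqrt) (auto simp: nsq_def intro!: continuous_intros)
  finally show ?thesis .
qed

lemma nsq_uniform_limit:
  assumes "uniform_limit UNIV h p sequentially" "\<And>n. ccont (h n)" "ccont p" "e > 0"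
  shows "eventually (\<lambda>n. nsq (\<lambda>x. p x - h n x) \<le> e) sequentially"
proof -
  have "sqrt e > 0" using assms(4) by simp
  then have "eventually (\<lambda>n. \<forall>x. dist (h n x) (p x) < sqrt e) sequentially"
    using assms(1) by (auto simp: uniform_limit_iff)
  then show ?thesis
  proof eventually_elim
    case (elim n)
    then have "nsq (\<lambda>x. p x - h n x) \<le> (sqrt e)\<^sup>2"
      using assms(2,3) by (intro nsq_le continuous_intros) (auto simp: dist_norm norm_minus_commute less_imp_le)
    then show ?case using assms(4) by simp
  qed
qed

definition closed_subspace :: "('x \<Rightarrow> complex) set \<Rightarrow> bool" where
  "closed_subspace V \<longleftrightarrow> (\<forall>g\<in>V. ccont g) \<and> (\<forall>f\<in>V. \<forall>g\<in>V. (\<lambda>x. f x + g x) \<in> V) \<and>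
     (\<forall>c. \<forall>g\<in>V. (\<lambda>x. c * g x) \<in> V) \<and>
     (\<forall>h p. (\<forall>n. h n \<in> V) \<longrightarrow> uniform_limit UNIV h p sequentially \<longrightarrow> p \<in> V)"

lemma closed_subspaceD:
  assumes "closed_subspace V"
  shows "g \<in> V \<Longrightarrow> ccont g" "f \<in> V \<Longrightarrow> g \<in> V \<Longrightarrow> (\<lambda>x. f x + g x) \<in> V"
    "g \<in> V \<Longrightarrow> (\<lambda>x. c * g x) \<in> V"
    "(\<And>n. h n \<in> V) \<Longrightarrow> uniform_limit UNIV h p sequentially \<Longrightarrow> p \<in> V"
    "f \<in> V \<Longrightarrow> g \<in> V \<Longrightarrow> (\<lambda>x. f x - g x) \<in> V"
proof -
  note V = assms[unfolded closed_subspace_def]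
  show c: "ccont g" if "g \<in> V" for g using V that by simp
  show add: "(\<lambda>x. f x + g x) \<in> V" if "f \<in> V" "g \<in> V" for f g using V that by simp
  show scale: "(\<lambda>x. c * g x) \<in> V" if "g \<in> V" for g c using V that by simp
  show "p \<in> V" if "\<And>n. h n \<in> V" "uniform_limit UNIV h p sequentially"
    using V that by blast
  show "(\<lambda>x. f x - g x) \<in> V" if "f \<in> V" "g \<in> V"
    using add[OF that(1) scale[OF that(2), of "-1"]] by simp
qed

text \<open>A maximizing sequence for the norm of \<open>S\<close> on the unit ball becomes, after applying the compact
  operator \<open>S\<close>, a sequence with an eigenvector of \<open>S \<circ> S\<close> as limit point.\<close>

lemma compact_symmetric_eigenvector:
  fixes S :: "('x \<Rightarrow> complex) \<Rightarrow> ('x \<Rightarrow> complex)"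
  assumes V: "closed_subspace V"
    and S_V: "\<And>g. g \<in> V \<Longrightarrow> S g \<in> V"
    and S_add: "\<And>f g. f \<in> V \<Longrightarrow> g \<in> V \<Longrightarrow> S (\<lambda>x. f x + g x) = (\<lambda>x. S f x + S g x)"
    and S_scale: "\<And>c g. g \<in> V \<Longrightarrow> S (\<lambda>x. c * g x) = (\<lambda>x. c * S g x)"
    and S_sym: "\<And>f g. f \<in> V \<Longrightarrow> g \<in> V \<Longrightarrow> ip (S f) g = ip f (S g)"
    and S_bdd: "\<And>g. g \<in> V \<Longrightarrow> nsq (S g) \<le> C * nsq g"
    and S_cpt: "\<And>g. (\<And>n::nat. g n \<in> V) \<Longrightarrow> (\<And>n. nsq (g n) \<le> 1) \<Longrightarrow>
      \<exists>r p. strict_mono r \<and> uniform_limit UNIV (\<lambda>n. S (g (r n))) p sequentially"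
    and g0: "g0 \<in> V" "S g0 \<noteq> (\<lambda>_. 0)"
  shows "\<exists>a::real. \<exists>v\<in>V. a \<noteq> 0 \<and> v \<noteq> (\<lambda>_. 0) \<and> S v = (\<lambda>x. of_real a * v x)"
proof -
  note VD = closed_subspaceD[OF V]
  have S_diff: "S (\<lambda>x. f x - g x) = (\<lambda>x. S f x - S g x)" if "f \<in> V" "g \<in> V" for f g
    using S_add[OF that(1) VD(3)[OF that(2), of "-1"]] S_scale[OF that(2), of "-1"] by simp
  have S0: "S (\<lambda>_. 0) = (\<lambda>_. 0)"
    using S_scale[OF g0(1), of 0] by simp
  \<comment> \<open>\<open>s\<close> is the square of the operator norm of \<open>S\<close> on
    \<open>V\<close>.\<close>
  define Q where "Q = {nsq (S g) | g. g \<in> V \<and> nsq g \<le> 1}"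
  define s where "s = Sup Q"
  have Q_le: "t \<le> \<bar>C\<bar>" if t: "t \<in> Q" for t
  proof -
    obtain g where g: "t = nsq (S g)" "g \<in> V" "nsq g \<le> 1" using t by (auto simp: Q_def)
    have "t \<le> C * nsq g" using S_bdd g by simp
    also have "\<dots> \<le> \<bar>C\<bar> * nsq g" by (intro mult_right_mono) auto
    also have "\<dots> \<le> \<bar>C\<bar> * 1" using g by (intro mult_left_mono) auto
    finally show ?thesis by simp
  qed
  then have bdd: "bdd_above Q" by (auto simp: bdd_above_def)
  have le1: "nsq (S g) \<le> s" if "g \<in> V" "nsq g \<le> 1" for g
    unfolding s_def using that bdd by (intro cSup_upper) (auto simp: Q_def)
  have scaled: "nsq (S (\<lambda>x. c * g x)) = (cmod c)\<^sup>2 * nsq (S g)" if "g \<in> V" for c g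
    using S_scale[OF that] nsq_scale by simp
  have le: "nsq (S g) \<le> s * nsq g" if g: "g \<in> V" for g
  proof (cases "g = (\<lambda>_. 0)")
    case True
    then show ?thesis by (simp add: S0)
  next
    case False
    obtain c where c: "c > 0" "nsq (\<lambda>x. of_real c * g x) = 1" "c\<^sup>2 = 1 / nsq g"
      using normalize[OF VD(1)[OF g] False] by blast
    have "c\<^sup>2 * nsq (S g) \<le> s"
      using le1[OF VD(3)[OF g], of "of_real c"] c(2) by (simp add: scaled g)
    then show ?thesis
      using c(3) nsq_pos[OF VD(1)[OF g] False] by (simp add: field_simps)
  qed
  have s_pos: "s > 0"
  proof -
    have "nsq (S g0) > 0" using nsq_pos VD(1)[OF S_V[OF g0(1)]] g0(2) by blast
    with le[OF g0(1)] show ?thesis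
      by (metis mult_nonpos_nonneg nsq_nonneg not_less order_trans)
  qed
  have "\<exists>g\<in>V. nsq g \<le> 1 \<and> s - 1 / real (Suc n) < nsq (S g)" for n
  proof -
    have "Q \<noteq> {}" using VD(3)[OF g0(1), of 0] by (auto simp: Q_def intro: exI[of _ "\<lambda>_. 0"])
    moreover have "s - 1 / real (Suc n) < Sup Q" by (simp add: s_def)
    ultimately have "\<exists>t\<in>Q. s - 1 / real (Suc n) < t" using less_cSup_iff[OF _ bdd] by blast
    then show ?thesis by (auto simp: Q_def)
  qed
  then obtain g where g: "\<And>n. g n \<in> V" "\<And>n. nsq (g n) \<le> 1"
    "\<And>n. s - 1 / real (Suc n) < nsq (S (g n))" by metis
  obtain r p where r: "strict_mono r" and p: "uniform_limit UNIV (\<lambda>n. S (g (r n))) p sequentially"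
    using S_cpt[of g] g by blast
  have pV: "p \<in> V" using VD(4)[OF _ p] S_V g(1) by blast
  define h where "h n = S (g (r n))" for n
  \<comment> \<open>For a nearly maximizing unit vector \<open>g\<close>, the vector
    \<open>S (S g)\<close> is nearly \<open>s\<close> times \<open>g\<close>; \<open>d n\<close> is
    the defect.\<close>
  define d where "d n = (\<lambda>x. S (h n) x - of_real s * g (r n) x)" for n
  have hV: "h n \<in> V" and dV: "d n \<in> V" for n
    unfolding h_def d_def using S_V g(1) VD by auto
  have h_ge: "s - 1 / real (Suc n) < nsq (h n)" for n
  proof -
    have "1 / real (Suc (r n)) \<le> 1 / real (Suc n)"
      using seq_suble[OF r, of n] by (simp add: field_simps)
    then show ?thesis using g(3)[of "r n"] unfolding h_def by linarith
  qed
  \<comment> \<open>After expanding the square, symmetry turns the cross term into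
    \<open>nsq (h n)\<close>, and what remains is at most \<open>s\<close> times the shortfall
    \<open>s - nsq (h n)\<close>.\<close>
  have d_le: "nsq (d n) \<le> s / real (Suc n)" for n
  proof -
    have "nsq (d n) = nsq (S (h n)) - 2 * s * Re (ip (S (h n)) (g (r n))) + s\<^sup>2 * nsq (g (r n))"
      unfolding d_def using nsq_expand VD(1) hV S_V g(1) by blast
    also have "ip (S (h n)) (g (r n)) = of_real (nsq (h n))"
      using S_sym[OF hV g(1)] by (simp add: h_def ip_self)
    also have "nsq (S (h n)) - 2 * s * Re (of_real (nsq (h n))) + s\<^sup>2 * nsq (g (r n))
       \<le> s * nsq (h n) - 2 * s * nsq (h n) + s\<^sup>2 * 1"
      using le[OF hV] g(2) s_pos by (intro add_mono diff_mono mult_left_mono) auto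
    also have "\<dots> = s * (s - nsq (h n))" by (simp add: power2_eq_square algebra_simps)
    also have "\<dots> \<le> s * (1 / real (Suc n))" using s_pos h_ge[of n] by (intro mult_left_mono) auto
    finally show ?thesis by simp
  qed
  have pc: "ccont p" using VD(1) pV by blast
  define t where "t = (\<lambda>x. S (S p) x - of_real s * p x)"
  have tV: "t \<in> V" unfolding t_def using S_V pV VD by auto
  \<comment> \<open>The vector \<open>t\<close> is split into the same expression at
    \<open>q = p - h n\<close>, which is small by convergence, and \<open>S (d n)\<close>. The
    factor 8 is 2 * (2 + 2), from two uses of the inequality for the square of a sum.\<close>
  have t_le: "nsq t \<le> 8 * s\<^sup>2 * nsq (\<lambda>x. p x - h n x) + 2 * s * nsq (d n)" for n
  proof -
    define q where "q = (\<lambda>x. p x - h n x)"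
    have qV: "q \<in> V" unfolding q_def using pV hV VD(5) by blast
    define t1 where "t1 = (\<lambda>x. S (S q) x - of_real s * q x)"
    have t1V: "t1 \<in> V" unfolding t1_def using S_V qV VD by auto
    have "S (d n) = (\<lambda>x. S (S (h n)) x - of_real s * h n x)"
      unfolding d_def using S_diff[OF S_V[OF hV] VD(3)[OF g(1)]] S_scale[OF g(1)] by (simp add: h_def)
    moreover have "S (S q) = (\<lambda>x. S (S p) x - S (S (h n)) x)"
      unfolding q_def using S_diff pV hV S_V by simp
    ultimately have "t = (\<lambda>x. t1 x + S (d n) x)"
      by (auto simp: t_def t1_def q_def algebra_simps)
    then have "nsq t \<le> 2 * nsq t1 + 2 * nsq (S (d n))"
      using nsq_add_le VD(1) t1V S_V dV by simp
    also have "nsq t1 \<le> 2 * nsq (S (S q)) + 2 * nsq (\<lambda>x. of_real s * q x)"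
      unfolding t1_def by (intro nsq_diff_le VD(1) S_V qV VD(3))
    also have "nsq (S (S q)) \<le> s * (s * nsq q)"
      using le[OF S_V[OF qV]] le[OF qV] s_pos by (meson less_imp_le mult_left_mono order_trans)
    also have "nsq (\<lambda>x. of_real s * q x) = s\<^sup>2 * nsq q" by (simp add: nsq_scale)
    also have "nsq (S (d n)) \<le> s * nsq (d n)" by (rule le[OF dV])
    finally show ?thesis by (simp add: q_def power2_eq_square algebra_simps)
  qed
  have hc: "ccont (h n)" for n using VD(1) hV by blast
  have small: "eventually (\<lambda>n. nsq (\<lambda>x. p x - h n x) \<le> e) sequentially" if "e > 0" for e
    by (rule nsq_uniform_limit[OF _ hc pc that]) (use p in \<open>simp add: h_def\<close>)
  have inv: "eventually (\<lambda>n. 1 / real (Suc n) < e) sequentially" if "e > 0" for e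
    using order_tendstoD(2)[OF LIMSEQ_inverse_real_of_nat that] by (simp add: inverse_eq_divide)
  have "nsq t \<le> 0"
  proof (rule field_le_epsilon)
    fix e :: real assume e: "e > 0"
    have e16: "e / (16 * s\<^sup>2) > 0" and e4: "e / (4 * s\<^sup>2) > 0" using e s_pos by auto
    have "eventually (\<lambda>n. nsq t \<le> e) sequentially"
      using small[OF e16] inv[OF e4]
    proof eventually_elim
      case (elim n)
      have "8 * s\<^sup>2 * nsq (\<lambda>x. p x - h n x) \<le> e / 2"
        using elim(1) s_pos by (simp add: field_simps)
      moreover have "2 * s * nsq (d n) \<le> 2 * s * (s * (1 / real (Suc n)))"
        using d_le[of n] s_pos by (intro mult_left_mono) auto
      moreover have "2 * s * (s * (1 / real (Suc n))) \<le> 2 * s * (s * (e / (4 * s\<^sup>2)))"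
        using elim(2) s_pos by (intro mult_left_mono) auto
      moreover have "2 * s * (s * (e / (4 * s\<^sup>2))) = e / 2"
        using s_pos by (simp add: power2_eq_square)
      ultimately show ?case using t_le[of n] by linarith
    qed
    then show "nsq t \<le> 0 + e" by (auto simp: eventually_sequentially)
  qed
  then have "t = (\<lambda>_. 0)"
    using nsq_eq_0[OF VD(1)[OF tV]] nsq_nonneg[of t] by linarith
  then have SSp: "S (S p) = (\<lambda>x. of_real s * p x)"
    unfolding t_def by (metis eq_iff_diff_eq_0)
  \<comment> \<open>The numbers \<open>nsq (h n)\<close> approach \<open>s > 0\<close>, so the limit
    cannot vanish.\<close>
  have p0: "p \<noteq> (\<lambda>_. 0)"
  proof
    assume "p = (\<lambda>_. 0)"
    then have *: "nsq (\<lambda>x. p x - h n x) = nsq (h n)" for n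
      using nsq_scale[of "-1" "h n"] by simp
    have "eventually (\<lambda>n. False) sequentially"
      using small[OF half_gt_zero[OF s_pos]] inv[OF half_gt_zero[OF s_pos]]
    proof eventually_elim
      case (elim n)
      then show ?case using h_ge[of n] * by simp
    qed
    then show False by simp
  qed
  define a where "a = sqrt s"
  have a: "a > 0" "a * a = s" using s_pos by (auto simp: a_def)
  \<comment> \<open>Since (S - a)(S + a) p = 0, either \<open>v = 0\<close> and \<open>p\<close> is
    an eigenvector for -a, or \<open>v\<close> is an eigenvector for a.\<close>
  define v where "v = (\<lambda>x. S p x + of_real a * p x)"
  have vV: "v \<in> V" unfolding v_def using VD(2)[OF S_V[OF pV] VD(3)[OF pV]] .
  show ?thesis
  proof (cases "v = (\<lambda>_. 0)")
    case True
    then have "S p = (\<lambda>x. of_real (-a) * p x)"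
      unfolding v_def by (metis (no_types, lifting) eq_neg_iff_add_eq_0 mult_minus_left of_real_minus)
    then show ?thesis using a pV p0 by (intro exI[of _ "-a"] bexI[of _ p]) auto
  next
    case False
    have "S v = (\<lambda>x. S (S p) x + of_real a * S p x)"
      unfolding v_def using S_add[OF S_V[OF pV] VD(3)[OF pV]] S_scale[OF pV] by simp
    also have "\<dots> = (\<lambda>x. of_real a * v x)"
      unfolding SSp v_def a(2)[symmetric] by (simp add: algebra_simps)
    finally show ?thesis using a vV False by (intro exI[of _ a] bexI[of _ v]) auto
  qed
qed

lemma ip_bound:
  assumes "ccont f" "ccont g" "\<And>x. cmod (f x) \<le> d" "\<And>x. cmod (g x) \<le> B"
  shows "cmod (ip f g) \<le> d * B"
proof -
  have "d \<ge> 0" using assms(3) norm_ge_zero order_trans by blast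
  then show ?thesis
    unfolding ip_def using assms
    by (intro integral_norm_le ip_integrable) (auto simp: norm_mult intro!: mult_mono)
qed

lemma ip_uniform_limit_zero:
  assumes h: "uniform_limit UNIV h p sequentially" and c: "\<And>n. ccont (h n)" "ccont p" "ccont g"
    and z: "\<And>n. ip (h n) g = 0"
  shows "ip p g = 0"
proof -
  obtain B where B: "B > 0" "\<And>x. cmod (g x) \<le> B"
    using continuous_on_UNIV_bounded[OF cpt c(3)] by blast
  have "cmod (ip p g) \<le> 0"
  proof (rule field_le_epsilon)
    fix e :: real assume "e > 0"
    then have "e / B > 0" using B(1) by simp
    with h have "eventually (\<lambda>n. \<forall>x. dist (h n x) (p x) < e / B) sequentially"
      by (auto simp: uniform_limit_iff)
    then obtain n where n: "\<And>x. dist (h n x) (p x) < e / B"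
      by (auto simp: eventually_sequentially)
    have "cmod (ip (\<lambda>x. p x - h n x) g) \<le> e / B * B"
    proof (rule ip_bound)
      show "cmod (p x - h n x) \<le> e / B" for x
        using n[of x] by (simp add: dist_norm norm_minus_commute)
    qed (use c B in \<open>auto intro!: continuous_intros\<close>)
    then show "cmod (ip p g) \<le> 0 + e"
      using B(1) z[of n] ip_diff[OF c(2) c(1) c(3)] by simp
  qed
  then show ?thesis by simp
qed

section \<open>Orthonormal sets and Bessel's inequality\<close>

definition orthonormal :: "('x \<Rightarrow> complex) set \<Rightarrow> bool" where
  "orthonormal B \<longleftrightarrow> finite B \<and> (\<forall>e\<in>B. ccont e \<and> nsq e = 1) \<and> (\<forall>e\<in>B. \<forall>e'\<in>B. e \<noteq> e' \<longrightarrow> ip e e' = 0)"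

text \<open>The residual is orthogonal to its projection, so Pythagoras applies. With
  \<open>nsq g' \<ge> 0\<close> the last claim becomes Bessel's inequality, which later limits the
  size of orthonormal sets in an eigenspace.\<close>

lemma orthonormal_residual:
  assumes B: "orthonormal B" and g: "ccont g"
  defines "g' \<equiv> (\<lambda>x. g x - (\<Sum>e\<in>B. ip g e * e x))"
  shows "ccont g'" "e \<in> B \<Longrightarrow> ip g' e = 0" "nsq g' = nsq g - (\<Sum>e\<in>B. (cmod (ip g e))\<^sup>2)"
proof -
  have fin: "finite B" and Bc: "\<And>e. e \<in> B \<Longrightarrow> ccont e" and n: "\<And>e. e \<in> B \<Longrightarrow> nsq e = 1"
    and o: "\<And>e e'. e \<in> B \<Longrightarrow> e' \<in> B \<Longrightarrow> e \<noteq> e' \<Longrightarrow> ip e e' = 0"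
    using B by (auto simp: orthonormal_def)
  have sc: "ccont (\<lambda>x. \<Sum>e\<in>B. ip g e * e x)"
    using Bc by (auto intro!: continuous_intros)
  show c: "ccont g'" unfolding g'_def by (rule continuous_on_diff[OF g sc])
  have ip_sum': "ip (\<lambda>x. \<Sum>e\<in>B. ip g e * e x) h = (\<Sum>e\<in>B. ip g e * ip e h)" if "ccont h" for h
    using ip_sum[OF fin _ that, of "\<lambda>e x. ip g e * e x"] Bc
    by (simp add: ip_scale continuous_intros)
  show orth: "ip g' e = 0" if "e \<in> B" for e
  proof -
    have "(\<Sum>e'\<in>B. ip g e' * ip e' e) = (\<Sum>e'\<in>B. if e' = e then ip g e else 0)"
      using that n o by (intro sum.cong) (auto simp: ip_self)
    then show ?thesis
      unfolding g'_def using ip_diff[OF g sc Bc[OF that]] ip_sum'[OF Bc[OF that]] fin that by simp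
  qed
  have "ip (\<lambda>x. \<Sum>e\<in>B. ip g e * e x) g' = 0"
    unfolding ip_sum'[OF c] using orth by (intro sum.neutral) (simp add: ip_cnj[of _ g'])
  then have "ip g' g' = ip g g'"
    using ip_diff[OF g sc c] by (simp add: g'_def[symmetric])
  also have "\<dots> = cnj (ip g' g)" by (rule ip_cnj)
  also have "ip g' g = ip g g - (\<Sum>e\<in>B. ip g e * ip e g)"
    unfolding g'_def using ip_diff[OF g sc g] ip_sum'[OF g] by simp
  also have "(\<Sum>e\<in>B. ip g e * ip e g) = (\<Sum>e\<in>B. of_real ((cmod (ip g e))\<^sup>2))"
    unfolding complex_norm_square by (intro sum.cong) (auto simp: ip_cnj[of _ g])
  finally have "complex_of_real (nsq g') = of_real (nsq g - (\<Sum>e\<in>B. (cmod (ip g e))\<^sup>2))"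
    by (simp add: ip_self)
  then show "nsq g' = nsq g - (\<Sum>e\<in>B. (cmod (ip g e))\<^sup>2)"
    unfolding of_real_eq_iff .
qed

text \<open>The member \<open>g0\<close> supplies the zero function when \<open>B\<close> is
  empty.\<close>

lemma closed_subspace_sum:
  assumes "closed_subspace V" "g0 \<in> V" "finite B" "\<And>e. e \<in> B \<Longrightarrow> e \<in> V"
  shows "(\<lambda>x. \<Sum>e\<in>B. c e * e x) \<in> V"
  using assms(3,4)
proof (induction B rule: finite_induct)
  case empty
  show ?case using closed_subspaceD(3)[OF assms(1,2), of 0] by simp
next
  case (insert b B)
  then have "(\<lambda>x. c b * b x) \<in> V" "(\<lambda>x. \<Sum>e\<in>B. c e * e x) \<in> V"
    using closed_subspaceD(3)[OF assms(1)] by auto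
  from closed_subspaceD(2)[OF assms(1) this] insert show ?case by simp
qed

end

subsection \<open>Eigenfunctions of equicontinuous group actions\<close>

text \<open>The group is a set of maps of the space, so that no topology or measure on it enters.
  Equicontinuity is tested on real functions, uniformly in \<open>z\<close>, which avoids choosing a
  uniform structure. The dense sequence replaces a countable base in a diagonal argument.\<close>

locale equicontinuous_group = full_support_space m for m :: "'x::t2_space measure" +
  fixes Z :: "('x \<Rightarrow> 'x) set"
  assumes Z_cont: "z \<in> Z \<Longrightarrow> continuous_on UNIV z"
    and Z_id: "(\<lambda>x. x) \<in> Z"
    and Z_comp: "z \<in> Z \<Longrightarrow> w \<in> Z \<Longrightarrow> (\<lambda>x. z (w x)) \<in> Z"
    and Z_inv: "z \<in> Z \<Longrightarrow> \<exists>w\<in>Z. (\<forall>x. z (w x) = x) \<and> (\<forall>x. w (z x) = x)"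
    and Z_comm: "z \<in> Z \<Longrightarrow> w \<in> Z \<Longrightarrow> z (w x) = w (z x)"
    and Z_meas: "\<And>g :: 'x \<Rightarrow> complex. z \<in> Z \<Longrightarrow> ccont g \<Longrightarrow> (\<integral>x. g (z x) \<partial>m) = (\<integral>x. g x \<partial>m)"
    and Z_equi: "\<And>f :: 'x \<Rightarrow> real. continuous_on UNIV f \<Longrightarrow> e > 0 \<Longrightarrow>
      \<exists>U. open U \<and> x \<in> U \<and> (\<forall>x'\<in>U. \<forall>z\<in>Z. \<bar>f (z x') - f (z x)\<bar> \<le> e)"
    and dense_sequence: "\<exists>d :: nat \<Rightarrow> 'x. closure (range d) = UNIV"
begin

definition eigenfunction :: "('x \<Rightarrow> complex) \<Rightarrow> bool" where
  "eigenfunction e \<longleftrightarrow> ccont e \<and> (\<forall>z\<in>Z. \<exists>c. \<forall>x. e (z x) = c * e x)"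

lemma ccont_Z: "z \<in> Z \<Longrightarrow> ccont g \<Longrightarrow> ccont (\<lambda>x. g (z x))"
  by (rule continuous_on_compose2[of UNIV g UNIV z]) (auto intro: Z_cont)

lemma ip_Z:
  assumes "z \<in> Z" "\<And>x. w (z x) = x" "\<And>x. z (w x) = x" "w \<in> Z" "ccont f" "ccont g"
  shows "ip (\<lambda>x. f (z x)) g = ip f (\<lambda>x. g (w x))"
proof -
  have "ccont (\<lambda>x. f x * cnj (g (w x)))"
    using assms(5) ccont_Z[OF assms(4,6)] by (rule continuous_on_mult[OF _ continuous_on_cnj])
  then have "ip f (\<lambda>x. g (w x)) = (\<integral>x. f (z x) * cnj (g (w (z x))) \<partial>m)"
    unfolding ip_def by (rule Z_meas[OF assms(1), symmetric])
  then show ?thesis using assms(2) by (simp add: ip_def)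
qed

lemma nsq_Z: "z \<in> Z \<Longrightarrow> ccont f \<Longrightarrow> nsq (\<lambda>x. f (z x)) = nsq f"
proof -
  assume z: "z \<in> Z" and f: "ccont f"
  have "complex_of_real (nsq (\<lambda>x. f (z x))) = of_real (nsq f)"
    unfolding ip_self[symmetric] ip_def
    using Z_meas[OF z, of "\<lambda>x. f x * cnj (f x)"] f by (simp add: continuous_intros)
  then show ?thesis unfolding of_real_eq_iff .
qed

section \<open>The invariant pseudometric of a continuous function and its kernel operator\<close>

context
  fixes f :: "'x \<Rightarrow> real"
  assumes f: "continuous_on UNIV f"
begin

text \<open>This is a \<open>Z\<close>-invariant pseudometric dominating |f x - f y|. Equicontinuity
  of \<open>Z\<close> makes it continuous, and invariance makes its kernel operator commute with
  \<open>Z\<close>.\<close>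

definition rho :: "'x \<Rightarrow> 'x \<Rightarrow> real" where
  "rho x y = (SUP z\<in>Z. \<bar>f (z x) - f (z y)\<bar>)"

lemma rho_bdd: "bdd_above ((\<lambda>z. \<bar>f (z x) - f (z y)\<bar>) ` Z)"
proof -
  obtain B where "\<And>x. norm (f x) \<le> B"
    using continuous_on_UNIV_bounded[OF cpt f] by blast
  then have "\<bar>f (z x) - f (z y)\<bar> \<le> B + B" for z
    using abs_triangle_ineq4[of "f (z x)" "f (z y)"] by (metis add_mono order_trans real_norm_def)
  then show ?thesis by (auto simp: bdd_above_def)
qed

lemma rho_upper: "z \<in> Z \<Longrightarrow> \<bar>f (z x) - f (z y)\<bar> \<le> rho x y"
  unfolding rho_def by (rule cSUP_upper[OF _ rho_bdd])

lemma rho_least: "(\<And>z. z \<in> Z \<Longrightarrow> \<bar>f (z x) - f (z y)\<bar> \<le> c) \<Longrightarrow> rho x y \<le> c"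
  unfolding rho_def using Z_id by (intro cSUP_least) auto

lemma rho_ge: "\<bar>f x - f y\<bar> \<le> rho x y"
  using rho_upper[OF Z_id] .

lemma rho_nonneg: "0 \<le> rho x y"
  using rho_ge[of x y] by linarith

lemma rho_refl [simp]: "rho x x = 0"
  using rho_least[of x x 0] rho_nonneg[of x x] by simp

lemma rho_sym: "rho x y = rho y x"
  by (simp add: rho_def abs_minus_commute)

lemma rho_triangle: "rho x y \<le> rho x z + rho z y"
proof (rule rho_least)
  fix w assume "w \<in> Z"
  then show "\<bar>f (w x) - f (w y)\<bar> \<le> rho x z + rho z y"
    using rho_upper[of w x z] rho_upper[of w z y] by linarith
qed

lemma rho_diff: "\<bar>rho x y - rho x' y\<bar> \<le> rho x x'"
  using rho_triangle[of x y x'] rho_triangle[of x' y x] rho_sym[of x x'] by linarith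

lemma rho_Z:
  assumes w: "w \<in> Z"
  shows "rho (w x) (w y) = rho x y"
proof -
  have le: "rho (w x) (w y) \<le> rho x y" if "w \<in> Z" for w x y
    using rho_upper[OF Z_comp[OF _ that]] by (intro rho_least) auto
  obtain w' where "w' \<in> Z" "\<And>x. w' (w x) = x" using Z_inv[OF w] by blast
  with le[OF w, of x y] le[of w' "w x" "w y"] show ?thesis by simp
qed

lemma rho_nbhd: "e > 0 \<Longrightarrow> \<exists>U. open U \<and> x \<in> U \<and> (\<forall>x'\<in>U. rho x' x \<le> e)"
proof -
  assume "e > 0"
  from Z_equi[OF f this, of x] obtain U where
    "open U" "x \<in> U" "\<forall>x'\<in>U. \<forall>z\<in>Z. \<bar>f (z x') - f (z x)\<bar> \<le> e" by blast
  then show ?thesis using rho_least by (intro exI[of _ U]) auto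
qed

lemma rho_bounded: obtains R where "R > 0" "\<And>x y. rho x y \<le> R"
proof -
  obtain B where B: "B > 0" "\<And>x. norm (f x) \<le> B"
    using continuous_on_UNIV_bounded[OF cpt f] by blast
  then have "\<bar>f (z x) - f (z y)\<bar> \<le> B + B" for z x y
    using abs_triangle_ineq4[of "f (z x)" "f (z y)"] by (metis add_mono order_trans real_norm_def)
  then have "rho x y \<le> B + B" for x y by (rule rho_least)
  with that[of "B + B"] B(1) show thesis by simp
qed

lemma continuous_on_rho_modulus:
  fixes g :: "'x \<Rightarrow> 'b::real_normed_vector"
  assumes "C \<ge> 0" "\<And>x x'. norm (g x - g x') \<le> rho x x' * C"
  shows "continuous_on UNIV g"
  unfolding continuous_on_topological
proof (safe)
  fix x B assume B: "open B" "g x \<in> B"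
  then obtain e where e: "e > 0" "ball (g x) e \<subseteq> B" using open_contains_ball by blast
  \<comment> \<open>Dividing by \<open>C + 1\<close> instead of \<open>C\<close> covers the case
    \<open>C = 0\<close>.\<close>
  have "e / (C + 1) > 0" using e assms(1) by simp
  then obtain U where U: "open U" "x \<in> U" "\<And>x'. x' \<in> U \<Longrightarrow> rho x' x \<le> e / (C + 1)"
    using rho_nbhd by meson
  have "g x' \<in> B" if "x' \<in> U" for x'
  proof -
    have "norm (g x' - g x) \<le> e / (C + 1) * C"
      using assms(2)[of x' x] mult_right_mono[OF U(3)[OF that] assms(1)] by linarith
    also have "\<dots> < e" using e(1) assms(1) by (simp add: field_simps)
    finally show ?thesis using e(2) by (auto simp: dist_norm norm_minus_commute subset_iff)
  qed
  with U show "\<exists>A. open A \<and> x \<in> A \<and> (\<forall>y\<in>UNIV. y \<in> A \<longrightarrow> g y \<in> B)" by blast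
qed

lemma rho_cont: "continuous_on UNIV (\<lambda>x. rho x y)"
  using rho_diff by (intro continuous_on_rho_modulus[of 1]) auto

lemma rho_cont2: "continuous_on UNIV (rho x)"
proof -
  have "rho x = (\<lambda>y. rho y x)" using rho_sym by blast
  then show ?thesis using rho_cont[of x] by simp
qed

definition kop :: "('x \<Rightarrow> complex) \<Rightarrow> 'x \<Rightarrow> complex" where
  "kop g x = (\<integral>y. of_real (rho x y) * g y \<partial>m)"

lemma kop_integrable: "ccont g \<Longrightarrow> integrable m (\<lambda>y. of_real (rho x y) * g y)"
  by (intro integrable_continuous continuous_intros rho_cont2)

lemma kop_eq_ip: "kop g x = ip g (\<lambda>y. of_real (rho x y))"
  by (simp add: kop_def ip_def mult.commute)

text \<open>An \<open>L^2\<close>-bounded family is thus sent to functions with a common modulus of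
  continuity with respect to \<open>rho\<close>, the equicontinuity half of compactness.\<close>

lemma kop_diff_le:
  assumes "ccont g" shows "cmod (kop g x - kop g x') \<le> rho x x' * sqrt (nsq g)"
proof -
  have "kop g x - kop g x' = (\<integral>y. of_real (rho x y - rho x' y) * g y \<partial>m)"
    using kop_integrable[OF assms] by (simp add: kop_def left_diff_distrib)
  then show ?thesis
    using assms rho_diff by (simp only:) (intro integral_mult_le continuous_intros rho_cont2)
qed

lemma kop_cont: "ccont g \<Longrightarrow> ccont (kop g)"
  by (rule continuous_on_rho_modulus[OF _ kop_diff_le]) auto

lemma kop_le:
  assumes "ccont g" "\<And>x y. rho x y \<le> R"
  shows "cmod (kop g x) \<le> R * sqrt (nsq g)"
  unfolding kop_def using assms rho_nonneg
  by (intro integral_mult_le rho_cont2) auto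

lemma kop_add: "ccont g \<Longrightarrow> ccont h \<Longrightarrow> kop (\<lambda>x. g x + h x) = (\<lambda>x. kop g x + kop h x)"
  using kop_integrable by (auto simp: fun_eq_iff kop_def distrib_left)

lemma kop_scale: "kop (\<lambda>x. c * g x) = (\<lambda>x. c * kop g x)"
  by (simp add: fun_eq_iff kop_def mult.left_commute[of _ c])

text \<open>The substitution of \<open>z y\<close> for \<open>y\<close> preserves \<open>m\<close>,
  and the kernel is unchanged when both arguments are moved by \<open>z\<close>.\<close>

lemma kop_Z:
  assumes "z \<in> Z" "ccont g"
  shows "kop (\<lambda>x. g (z x)) = (\<lambda>x. kop g (z x))"
proof
  fix x
  have "kop g (z x) = (\<integral>y. of_real (rho (z x) (z y)) * g (z y) \<partial>m)"
    unfolding kop_def using assms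
    by (intro Z_meas[symmetric, of z "\<lambda>y. of_real (rho (z x) y) * g y"] continuous_intros rho_cont2)
  then show "kop (\<lambda>x. g (z x)) x = kop g (z x)"
    using rho_Z[OF assms(1)] by (simp add: kop_def)
qed

text \<open>The kernel is real and symmetric, so this is an exchange of integrals. Its
  equicontinuity hypothesis is checked by varying \<open>h x\<close> and \<open>rho x y\<close> one
  after the other.\<close>

lemma kop_sym:
  assumes g: "ccont g" and h: "ccont h"
  shows "ip (kop g) h = ip g (kop h)"
proof -
  define K where "K x y = cnj (h x) * (of_real (rho x y) * g y)" for x y
  have mp: "compact_prob_space m" by unfold_locales
  obtain R where R: "R > 0" "\<And>x y. rho x y \<le> R" using rho_bounded by blast
  obtain B where B: "B > 0" "\<And>x. cmod (g x) \<le> B" using continuous_on_UNIV_bounded[OF cpt g] by blast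
  obtain C where C: "C > 0" "\<And>x. cmod (h x) \<le> C" using continuous_on_UNIV_bounded[OF cpt h] by blast
  have cx: "ccont (\<lambda>x. K x y)" and cy: "ccont (K x)" for x y
    unfolding K_def using g h by (auto intro!: continuous_intros rho_cont rho_cont2)
  have ix: "(\<integral>y. K x y \<partial>m) = cnj (h x) * kop g x" for x
    by (simp add: K_def kop_def)
  have iy: "(\<integral>x. K x y \<partial>m) = g y * cnj (kop h y)" for y
  proof -
    have "(\<integral>x. K x y \<partial>m) = (\<integral>x. g y * cnj (of_real (rho y x) * h x) \<partial>m)"
      by (simp add: K_def rho_sym[of y] mult_ac)
    also have "\<dots> = g y * (\<integral>x. cnj (of_real (rho y x) * h x) \<partial>m)" by simp
    also have "(\<integral>x. cnj (of_real (rho y x) * h x) \<partial>m) = cnj (kop h y)"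
      unfolding kop_def by (rule integral_bounded_linear'[OF bounded_linear_cnj bounded_linear_cnj]) simp
    finally show ?thesis .
  qed
  have "(\<integral>x. \<integral>y. K x y \<partial>m \<partial>m) = (\<integral>y. \<integral>x. K x y \<partial>m \<partial>m)"
  proof (rule equicontinuous_Fubini[OF mp mp _ cx cy])
    show "integrable m (\<lambda>x. \<integral>y. K x y \<partial>m)" "integrable m (\<lambda>y. \<integral>x. K x y \<partial>m)"
      unfolding ix iy using g h kop_cont by (auto intro!: integrable_continuous continuous_intros)
    fix x and e :: real assume e: "e > 0"
    \<comment> \<open>The two variations contribute d * R * B and C * d' * B, each equal to e /
      2.\<close>
    define d where "d = e / (2 * B * R)"
    define d' where "d' = e / (2 * B * C)"
    have dd: "d > 0" "d' > 0" using e R B C by (auto simp: d_def d'_def)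
    obtain U where U: "open U" "x \<in> U" "\<And>x'. x' \<in> U \<Longrightarrow> rho x' x \<le> d'"
      using rho_nbhd[OF dd(2)] by meson
    define U' where "U' = h -` ball (h x) d"
    have U': "open U'" "x \<in> U'" using h dd by (auto simp: U'_def intro!: open_vimage)
    have "norm (K x' y - K x y) \<le> e" if x': "x' \<in> U \<inter> U'" for x' y
    proof -
      have "K x' y - K x y = cnj (h x' - h x) * of_real (rho x' y) * g y
          + cnj (h x) * of_real (rho x' y - rho x y) * g y"
        by (simp add: K_def algebra_simps)
      then have "norm (K x' y - K x y) \<le> cmod (h x' - h x) * rho x' y * cmod (g y)
          + cmod (h x) * \<bar>rho x' y - rho x y\<bar> * cmod (g y)"
        using norm_triangle_ineq[of "cnj (h x' - h x) * of_real (rho x' y) * g y"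
            "cnj (h x) * of_real (rho x' y - rho x y) * g y"] rho_nonneg[of x' y]
        by (simp add: norm_mult del: complex_cnj_diff of_real_diff)
      also have "\<dots> \<le> d * R * B + C * d' * B"
      proof (intro add_mono mult_mono)
        show "cmod (h x' - h x) \<le> d"
          using x' by (auto simp: U'_def dist_norm norm_minus_commute)
        show "\<bar>rho x' y - rho x y\<bar> \<le> d'"
          using rho_diff[of x' y x] U(3)[of x'] x' by force
      qed (use R B C dd rho_nonneg in \<open>auto intro!: mult_nonneg_nonneg less_imp_le\<close>)
      also have "\<dots> = e" using R B C by (simp add: d_def d'_def field_simps)
      finally show ?thesis .
    qed
    then show "\<exists>U. open U \<and> x \<in> U \<and> (\<forall>x'\<in>U. \<forall>y. norm (K x' y - K x y) \<le> e)"
      using U U' by (intro exI[of _ "U \<inter> U'"]) auto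
  qed
  then show ?thesis
    unfolding ix iy by (simp add: ip_def mult.commute)
qed

text \<open>Arzela-Ascoli by hand: a diagonal subsequence converges on the dense sequence, and the
  common \<open>rho\<close>-modulus spreads this to all points through a finite cover by
  \<open>rho\<close>-small open sets.\<close>

lemma kop_compact:
  assumes g: "\<And>n::nat. ccont (g n)" "\<And>n. nsq (g n) \<le> C"
  shows "\<exists>r p. strict_mono r \<and> uniform_limit UNIV (\<lambda>n. kop (g (r n))) p sequentially"
proof -
  obtain R where R: "R > 0" "\<And>x y. rho x y \<le> R" using rho_bounded by blast
  obtain d :: "nat \<Rightarrow> 'x" where d: "closure (range d) = UNIV" using dense_sequence by blast
  \<comment> \<open>The added 1 keeps \<open>L\<close> positive when \<open>C = 0\<close>, since
    \<open>t\<close> below divides by it.\<close>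
  define L where "L = sqrt C + 1"
  have C0: "C \<ge> 0" using g(2)[of 0] nsq_nonneg[of "g 0"] by linarith
  have L: "L > 0" "sqrt (nsq (g n)) \<le> L" for n
    using real_sqrt_ge_zero[OF C0] real_sqrt_le_mono[OF g(2)[of n]] unfolding L_def by linarith+
  have lip: "cmod (kop (g n) x - kop (g n) x') \<le> rho x x' * L" for n x x'
    using kop_diff_le[OF g(1)[of n], of x x'] mult_left_mono[OF L(2)[of n] rho_nonneg[of x x']]
    by linarith
  have bd: "cmod (kop (g n) x) \<le> R * L" for n x
    using kop_le[OF g(1)[of n] R(2), of x] mult_left_mono[OF L(2)[of n], of R] R(1) by linarith
  obtain r where r: "strict_mono r" "\<And>x. x \<in> range d \<Longrightarrow> \<exists>l. (\<lambda>n. kop (g (r n)) x) \<longlonglongrightarrow> l"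
    using function_convergent_subsequence[of "range d" "\<lambda>n. kop (g n)" "R * L"] bd by auto
  have "uniformly_Cauchy_on UNIV (\<lambda>n. kop (g (r n)))"
  proof (rule uniformly_Cauchy_onI)
    fix e :: real assume e: "e > 0"
    \<comment> \<open>Two points of one set \<open>U i\<close> have \<open>rho\<close>-distance at
      most 2 * t, hence images differing by at most e / 4. Two such moves and one comparison at a
      dense point stay below e.\<close>
    define t where "t = e / (8 * L)"
    have t: "t > 0" "t * L = e / 8" using e L by (auto simp: t_def)
    obtain U where U: "\<And>x. open (U x)" "\<And>x. x \<in> U x" "\<And>x x'. x' \<in> U x \<Longrightarrow> rho x' x \<le> t"
      using rho_nbhd[OF t(1)] by metis
    obtain I where I: "finite I" "(UNIV :: 'x set) \<subseteq> (\<Union>i\<in>I. U i)"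
    proof (rule compactE_image[OF cpt, of UNIV U])
      show "UNIV \<subseteq> (\<Union>x. U x)" using U(2) by blast
    qed (use U(1) that in auto)
    have "\<exists>y. y \<in> range d \<inter> U i" for i
    proof -
      have "U i \<inter> closure (range d) \<noteq> {}" using d U(2) by auto
      then show ?thesis using open_Int_closure_eq_empty[OF U(1), of i "range d"] by blast
    qed
    then obtain y where y: "\<And>i. y i \<in> range d" "\<And>i. y i \<in> U i" by (metis IntE)
    have "\<exists>M. \<forall>a\<ge>M. \<forall>b\<ge>M. dist (kop (g (r a)) (y i)) (kop (g (r b)) (y i)) < e / 4" for i
    proof -
      have "Cauchy (\<lambda>n. kop (g (r n)) (y i))"
        using r(2)[OF y(1)[of i]] LIMSEQ_imp_Cauchy by blast
      moreover have "e / 4 > 0" using e by simp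
      ultimately show ?thesis by (rule metric_CauchyD)
    qed
    then obtain M where M: "\<And>i a b. a \<ge> M i \<Longrightarrow> b \<ge> M i \<Longrightarrow>
        dist (kop (g (r a)) (y i)) (kop (g (r b)) (y i)) < e / 4" by metis
    define M0 where "M0 = Max (insert 0 (M ` I))"
    have M0: "M i \<le> M0" if "i \<in> I" for i
      unfolding M0_def using I(1) that by (intro Max_ge) auto
    have "dist (kop (g (r a)) x) (kop (g (r b)) x) < e" if ab: "a \<ge> M0" "b \<ge> M0" for x a b
    proof -
      obtain i where i: "i \<in> I" "x \<in> U i" using I(2) by blast
      have "rho x (y i) \<le> 2 * t"
        using rho_triangle[of x "y i" i] U(3)[OF i(2)] U(3)[OF y(2)[of i]] rho_sym[of i "y i"] by linarith
      then have "rho x (y i) * L \<le> 2 * t * L" using L by (intro mult_right_mono) auto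
      then have near: "cmod (kop (g n) x - kop (g n) (y i)) \<le> e / 4" for n
        using lip[of n x "y i"] t(2) by linarith
      have "dist (kop (g (r a)) (y i)) (kop (g (r b)) (y i)) < e / 4"
        using M[of i a b] M0[OF i(1)] ab by linarith
      then show ?thesis
        using near[of "r a"] near[of "r b"] e
          norm_triangle_ineq[of "kop (g (r a)) x - kop (g (r a)) (y i)" "kop (g (r a)) (y i) - kop (g (r b)) (y i)"]
          norm_triangle_ineq4[of "kop (g (r a)) x - kop (g (r b)) (y i)" "kop (g (r b)) x - kop (g (r b)) (y i)"]
        by (simp add: dist_norm)
    qed
    then show "\<exists>M. \<forall>x\<in>UNIV. \<forall>a\<ge>M. \<forall>b\<ge>M. dist (kop (g (r a)) x) (kop (g (r b)) x) < e" by blast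
  qed
  then have "uniformly_convergent_on UNIV (\<lambda>n. kop (g (r n)))" by (rule Cauchy_uniformly_convergent)
  with r(1) show ?thesis by (auto simp: uniformly_convergent_on_def)
qed

lemma kop_uniform_limit:
  assumes h: "uniform_limit UNIV h p sequentially" and c: "\<And>n. ccont (h n)" "ccont p"
  shows "(\<lambda>n. kop (h n) x) \<longlonglongrightarrow> kop p x"
proof -
  obtain R where R: "R > 0" "\<And>x y. rho x y \<le> R" using rho_bounded by blast
  show ?thesis
  proof (rule LIMSEQ_I)
    fix e :: real assume e: "e > 0"
    define t where "t = (e / (2 * R))\<^sup>2"
    have t: "t > 0" "sqrt t = e / (2 * R)" using e R by (auto simp: t_def)
    obtain N where N: "\<And>n. n \<ge> N \<Longrightarrow> nsq (\<lambda>x. p x - h n x) \<le> t"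
      using nsq_uniform_limit[OF h c t(1)] by (auto simp: eventually_sequentially)
    have "norm (kop (h n) x - kop p x) < e" if "n \<ge> N" for n
    proof -
      have c': "ccont (\<lambda>x. p x - h n x)" using c by (intro continuous_intros)
      have "kop (\<lambda>x. p x - h n x) x = kop p x - kop (h n) x"
        using kop_integrable c by (simp add: kop_def right_diff_distrib)
      then have "norm (kop (h n) x - kop p x) \<le> R * sqrt (nsq (\<lambda>x. p x - h n x))"
        using kop_le[OF c' R(2), of x] by (simp add: norm_minus_commute)
      also have "\<dots> \<le> R * sqrt t" using N[OF that] R by (intro mult_left_mono) auto
      also have "\<dots> < e" using e R by (simp add: t(2))
      finally show ?thesis .
    qed
    then show "\<exists>N. \<forall>n\<ge>N. norm (kop (h n) x - kop p x) < e" by blast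
  qed
qed

lemma kop_bdd:
  obtains C where "\<And>g. ccont g \<Longrightarrow> nsq (kop g) \<le> C * nsq g"
proof -
  obtain R where R: "R > 0" "\<And>x y. rho x y \<le> R" using rho_bounded by blast
  have "nsq (kop g) \<le> R\<^sup>2 * nsq g" if "ccont g" for g
  proof -
    have "nsq (kop g) \<le> (R * sqrt (nsq g))\<^sup>2"
      using kop_le[OF that R(2)] kop_cont[OF that] by (intro nsq_le) auto
    then show ?thesis by (simp add: power_mult_distrib)
  qed
  then show thesis by (rule that)
qed

lemma eigenfunction_kop: "eigenfunction e \<Longrightarrow> eigenfunction (kop e)"
  unfolding eigenfunction_def
proof (safe)
  fix z assume e: "ccont e" and z: "z \<in> Z" and "\<forall>z\<in>Z. \<exists>c. \<forall>x. e (z x) = c * e x"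
  then obtain c where c: "(\<lambda>x. e (z x)) = (\<lambda>x. c * e x)" by blast
  have "(\<lambda>x. kop e (z x)) = (\<lambda>x. c * kop e x)"
    using kop_Z[OF z e] unfolding c kop_scale by simp
  then show "\<exists>c. \<forall>x. kop e (z x) = c * kop e x" by metis
qed (rule kop_cont)

end

section \<open>Eigenfunctions inside invariant eigenspaces\<close>

definition Z_invariant :: "('x \<Rightarrow> complex) set \<Rightarrow> bool" where
  "Z_invariant F \<longleftrightarrow> (\<forall>z\<in>Z. \<forall>g\<in>F. (\<lambda>x. g (z x)) \<in> F)"

text \<open>The real and imaginary parts of a translation, up to a factor: for \<open>c = 1\<close> and \<open>c = \<i>\<close>
  these symmetric operators determine the translation by \<open>z\<close>.\<close>

definition herm :: "complex \<Rightarrow> ('x \<Rightarrow> 'x) \<Rightarrow> ('x \<Rightarrow> 'x) \<Rightarrow> ('x \<Rightarrow> complex) \<Rightarrow> 'x \<Rightarrow> complex" where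
  "herm c z w g = (\<lambda>x. c * g (z x) + cnj c * g (w x))"

text \<open>Translation by \<open>z\<close> is unitary and its adjoint is translation by the inverse
  \<open>w\<close>, so \<open>herm\<close> is an operator plus its adjoint.\<close>

lemma herm_sym:
  assumes zw: "z \<in> Z" "w \<in> Z" "\<And>x. w (z x) = x" "\<And>x. z (w x) = x" and c: "ccont f" "ccont g"
  shows "ip (herm a z w f) g = ip f (herm a z w g)"
proof -
  have s: "ccont (\<lambda>x. b * h (y x))" if "y \<in> Z" "ccont h" for b y h
    using that by (rule continuous_on_mult_left[OF ccont_Z])
  have "ip (herm a z w f) g = a * ip (\<lambda>x. f (z x)) g + cnj a * ip (\<lambda>x. f (w x)) g"
    unfolding herm_def using ip_add[OF s[OF zw(1) c(1)] s[OF zw(2) c(1)] c(2)] by (simp add: ip_scale)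
  also have "\<dots> = cnj a * ip f (\<lambda>x. g (z x)) + a * ip f (\<lambda>x. g (w x))"
    using ip_Z[OF zw(1) zw(3,4,2) c] ip_Z[OF zw(2) zw(4,3,1) c] by simp
  also have "\<dots> = ip f (herm a z w g)"
    unfolding herm_def using ip_add_right[OF s[OF zw(1) c(2)] s[OF zw(2) c(2)] c(1)] by (simp add: ip_scale_right)
  finally show ?thesis .
qed

lemma herm_bdd:
  assumes "z \<in> Z" "w \<in> Z" "ccont g"
  shows "nsq (herm c z w g) \<le> 4 * (cmod c)\<^sup>2 * nsq g"
proof -
  have "nsq (herm c z w g) \<le> 2 * nsq (\<lambda>x. c * g (z x)) + 2 * nsq (\<lambda>x. cnj c * g (w x))"
    unfolding herm_def
    by (rule nsq_add_le[OF continuous_on_mult_left[OF ccont_Z] continuous_on_mult_left[OF ccont_Z]])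
      (use assms in auto)
  also have "\<dots> = 4 * (cmod c)\<^sup>2 * nsq g"
    using assms by (simp add: nsq_scale nsq_Z)
  finally show ?thesis .
qed

text \<open>Finite dimensionality of the eigenspaces of a compact operator is expressed through the bounded
  size of orthonormal sets.  An invariant closed subspace on which this size is minimal
  must consist of eigenfunctions: each symmetric operator commuting with \<open>Z\<close> acts on it as a scalar,
  since its eigenspaces are again invariant.\<close>

lemma eigenfunction_in_eigenspace:
  fixes a :: real
  assumes f: "continuous_on UNIV f" and a: "a \<noteq> 0"
    and E: "closed_subspace E" "Z_invariant E" "\<And>g. g \<in> E \<Longrightarrow> kop f g = (\<lambda>x. of_real a * g x)"
    and g0: "g0 \<in> E" "g0 \<noteq> (\<lambda>_. 0)"
  shows "\<exists>e\<in>E. e \<noteq> (\<lambda>_. 0) \<and> eigenfunction e"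
proof -
  obtain R where R: "R > 0" "\<And>x y. rho f x y \<le> R" using rho_bounded[OF f] by blast
  \<comment> \<open>The coefficient of the kernel function at \<open>x\<close> against
    \<open>e\<close> has modulus |a| |e x|, because \<open>e\<close> is an eigenvector. Bessel
    bounds the sum of their squares by the square of \<open>R\<close>, and integration over
    \<open>x\<close> turns the sum into a count.\<close>
  have card_le: "real (card B) * a\<^sup>2 \<le> R\<^sup>2" if B: "orthonormal B" "B \<subseteq> E" for B
  proof -
    have fin: "finite B" and Bc: "\<And>e. e \<in> B \<Longrightarrow> ccont e" and n: "\<And>e. e \<in> B \<Longrightarrow> nsq e = 1"
      using B by (auto simp: orthonormal_def)
    have pt: "(\<Sum>e\<in>B. a\<^sup>2 * (cmod (e x))\<^sup>2) \<le> R\<^sup>2" for x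
    proof -
      define k where "k = (\<lambda>y. complex_of_real (rho f x y))"
      have kc: "ccont k" unfolding k_def by (intro continuous_intros rho_cont2 f)
      have "nsq k \<le> R\<^sup>2"
        using R(2)[of x] rho_nonneg[OF f, of x] by (intro nsq_le kc) (auto simp: k_def)
      moreover have "(\<Sum>e\<in>B. (cmod (ip k e))\<^sup>2) \<le> nsq k"
        using orthonormal_residual(3)[OF B(1) kc] nsq_nonneg[of "\<lambda>x. k x - (\<Sum>e\<in>B. ip k e * e x)"] by simp
      moreover have "(cmod (ip k e))\<^sup>2 = a\<^sup>2 * (cmod (e x))\<^sup>2" if "e \<in> B" for e
      proof -
        have "cmod (ip k e) = cmod (kop f e x)"
          using kop_eq_ip[OF f, of e x] ip_cnj[of k e] by (simp add: k_def)
        also have "\<dots> = \<bar>a\<bar> * cmod (e x)" using E(3)[of e] that B(2) by (auto simp: norm_mult)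
        finally show ?thesis by (simp add: power_mult_distrib)
      qed
      ultimately show ?thesis by simp
    qed
    have int: "integrable m (\<lambda>x. \<Sum>e\<in>B. a\<^sup>2 * (cmod (e x))\<^sup>2)"
      using Bc by (auto intro!: integrable_continuous continuous_intros)
    have "real (card B) * a\<^sup>2 = (\<Sum>e\<in>B. a\<^sup>2 * nsq e)"
      using n by simp
    also have "\<dots> = (\<integral>x. (\<Sum>e\<in>B. a\<^sup>2 * (cmod (e x))\<^sup>2) \<partial>m)"
      using nsq_integrable Bc by (simp add: nsq_def Bochner_Integration.integral_sum)
    also have "\<dots> \<le> (\<integral>x. R\<^sup>2 \<partial>m)"
      using pt int integrable_continuous[of "\<lambda>_. R\<^sup>2"] by (intro integral_mono) auto
    finally show ?thesis by simp
  qed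
  define good where "good F \<longleftrightarrow> closed_subspace F \<and> F \<subseteq> E \<and> Z_invariant F \<and> (\<exists>g\<in>F. g \<noteq> (\<lambda>_. 0))" for F
  \<comment> \<open>The bound is strict, so the least \<open>k\<close> is one more than the largest
    size of an orthonormal set in a smallest good subspace.\<close>
  define P where "P n \<longleftrightarrow> (\<exists>F. good F \<and> (\<forall>B. orthonormal B \<longrightarrow> B \<subseteq> F \<longrightarrow> card B < n))" for n
  have "P (Suc (nat \<lceil>R\<^sup>2 / a\<^sup>2\<rceil>))"
  proof -
    have "card B < Suc (nat \<lceil>R\<^sup>2 / a\<^sup>2\<rceil>)" if "orthonormal B" "B \<subseteq> E" for B
    proof -
      have "real (card B) \<le> R\<^sup>2 / a\<^sup>2" using card_le[OF that] a by (simp add: field_simps)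
      then show ?thesis by linarith
    qed
    moreover have "good E" using E g0 by (auto simp: good_def)
    ultimately show ?thesis unfolding P_def by blast
  qed
  then obtain k where k: "P k" "\<And>j. j < k \<Longrightarrow> \<not> P j"
    using exists_least_iff[of P] by blast
  then obtain F where F: "good F" "\<And>B. orthonormal B \<Longrightarrow> B \<subseteq> F \<Longrightarrow> card B < k"
    unfolding P_def by blast
  have Fs: "closed_subspace F" and FE: "F \<subseteq> E" and Finv: "Z_invariant F"
    using F(1) by (auto simp: good_def)
  obtain g1 where g1: "g1 \<in> F" "g1 \<noteq> (\<lambda>_. 0)" using F(1) by (auto simp: good_def)
  note FD = closed_subspaceD[OF Fs]
  \<comment> \<open>Minimality of \<open>k\<close> gives an orthonormal set of at least k - 1
    elements already inside \<open>F'\<close>. If the residual of \<open>g\<close> were nonzero, its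
    normalization would enlarge this set to \<open>k\<close> elements of \<open>F\<close>.\<close>
  have minimal: "g \<in> F'" if F': "good F'" "F' \<subseteq> F" and g: "g \<in> F" for F' g
  proof -
    have "k > 0" using F(2)[of "{}"] by (simp add: orthonormal_def)
    then have "\<not> P (k - 1)" using k(2) by simp
    then obtain B where B: "orthonormal B" "B \<subseteq> F'" "card B \<ge> k - 1"
      using F'(1) unfolding P_def by (meson not_less)
    have F's: "closed_subspace F'" using F'(1) by (simp add: good_def)
    obtain g2 where g2: "g2 \<in> F'" using F'(1) by (auto simp: good_def)
    define s where "s = (\<lambda>x. \<Sum>e\<in>B. ip g e * e x)"
    have fin: "finite B" using B(1) by (simp add: orthonormal_def)
    have s: "s \<in> F'" unfolding s_def
      using closed_subspace_sum[OF F's g2 fin] B(2) by blast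
    define r where "r = (\<lambda>x. g x - s x)"
    have rF: "r \<in> F" unfolding r_def using FD(5)[OF g] s F'(2) by blast
    have orth: "ip r e = 0" if "e \<in> B" for e
      using orthonormal_residual(2)[OF B(1) FD(1)[OF g] that] by (simp add: r_def s_def)
    have "r = (\<lambda>_. 0)"
    proof (rule ccontr)
      assume "r \<noteq> (\<lambda>_. 0)"
      then obtain c where c: "c > 0" "nsq (\<lambda>x. complex_of_real c * r x) = 1"
        using normalize[OF FD(1)[OF rF]] by blast
      define e' where "e' = (\<lambda>x. complex_of_real c * r x)"
      have e'F: "e' \<in> F" unfolding e'_def using FD(3)[OF rF] .
      have e': "ip e' e = 0" if "e \<in> B" for e
        unfolding e'_def ip_scale using orth[OF that] by simp
      have "ip e' e' = 1" using c(2) by (simp add: ip_self e'_def)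
      then have "e' \<notin> B" using e' by auto
      moreover have "ip e e' = 0" if "e \<in> B" for e
        using e'[OF that] ip_cnj[of e e'] by simp
      then have "orthonormal (insert e' B)"
        using B(1) c(2) e' FD(1)[OF e'F] unfolding orthonormal_def e'_def[symmetric] by auto
      ultimately show False
        using F(2)[of "insert e' B"] fin subset_trans[OF B(2) F'(2)] B(3) e'F by auto
    qed
    then have "g = s" unfolding r_def by (metis eq_iff_diff_eq_0 ext)
    with s show ?thesis by simp
  qed
  have scalar: "\<exists>l::real. \<forall>g\<in>F. herm c z w g = (\<lambda>x. of_real l * g x)"
    if zw: "z \<in> Z" "w \<in> Z" "\<And>x. w (z x) = x" "\<And>x. z (w x) = x" for c z w
  proof -
    let ?A = "herm c z w"
    have AF: "?A g \<in> F" if "g \<in> F" for g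
      unfolding herm_def using that Finv zw(1,2) FD(2)[OF FD(3) FD(3)] unfolding Z_invariant_def by blast
    have S: "kop f (?A g) = (\<lambda>x. of_real a * ?A g x)" if "g \<in> F" for g
      using E(3) AF[OF that] FE by blast
    show ?thesis
    proof (cases "\<forall>g\<in>F. kop f (?A g) = (\<lambda>_. 0)")
      case True
      then have "\<forall>g\<in>F. ?A g = (\<lambda>x. of_real 0 * g x)"
        using S a by (auto simp: fun_eq_iff)
      then show ?thesis by blast
    next
      case False
      then obtain h0 where h0: "h0 \<in> F" "kop f (?A h0) \<noteq> (\<lambda>_. 0)" by blast
      \<comment> \<open>On \<open>F\<close> the operator \<open>kop f\<close> is the scalar
        \<open>a\<close>, so composing with it changes \<open>?A\<close> by a nonzero factor and
        makes it compact as well as symmetric. An eigenspace of \<open>?A\<close> is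
        \<open>Z\<close>-invariant because \<open>Z\<close> is commutative, and by minimality it is
        all of \<open>F\<close>.\<close>
      have "\<exists>b::real. \<exists>v\<in>F. b \<noteq> 0 \<and> v \<noteq> (\<lambda>_. 0) \<and> kop f (?A v) = (\<lambda>x. of_real b * v x)"
      proof (rule compact_symmetric_eigenvector[where S = "\<lambda>g. kop f (?A g)" and ?g0.0 = h0
            and C = "a\<^sup>2 * (4 * (cmod c)\<^sup>2)", OF Fs _ _ _ _ _ _ h0])
        show "kop f (?A g) \<in> F" if "g \<in> F" for g
          using S[OF that] FD(3)[OF AF[OF that]] by simp
        show "kop f (?A (\<lambda>x. g x + h x)) = (\<lambda>x. kop f (?A g) x + kop f (?A h) x)"
          if "g \<in> F" "h \<in> F" for g h
          using S[OF FD(2)[OF that]] S[OF that(1)] S[OF that(2)]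
          by (simp add: herm_def algebra_simps)
        show "kop f (?A (\<lambda>x. b * g x)) = (\<lambda>x. b * kop f (?A g) x)" if "g \<in> F" for b g
          using S[OF FD(3)[OF that]] S[OF that] by (simp add: herm_def algebra_simps)
        show "ip (kop f (?A g)) h = ip g (kop f (?A h))" if "g \<in> F" "h \<in> F" for g h
          unfolding S[OF that(1)] S[OF that(2)] ip_scale ip_scale_right
          using herm_sym[OF zw FD(1)[OF that(1)] FD(1)[OF that(2)]] by simp
        show "nsq (kop f (?A g)) \<le> a\<^sup>2 * (4 * (cmod c)\<^sup>2) * nsq g" if "g \<in> F" for g
          unfolding S[OF that] nsq_scale
          using mult_left_mono[OF herm_bdd[OF zw(1,2) FD(1)[OF that], of c], of "a\<^sup>2"] by (simp add: mult_ac)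
        show "\<exists>r p. strict_mono r \<and> uniform_limit UNIV (\<lambda>n. kop f (?A (g (r n)))) p sequentially"
          if "\<And>n::nat. g n \<in> F" "\<And>n. nsq (g n) \<le> 1" for g
        proof (rule kop_compact[OF f, of "\<lambda>n. ?A (g n)" "4 * (cmod c)\<^sup>2"])
          show "ccont (?A (g n))" for n using FD(1) AF that by blast
          show "nsq (?A (g n)) \<le> 4 * (cmod c)\<^sup>2" for n
            using herm_bdd[OF zw(1,2) FD(1)[OF that(1)], of c n] that(2)[of n]
              mult_left_mono[of "nsq (g n)" 1 "4 * (cmod c)\<^sup>2"] by simp
        qed
      qed
      then obtain b :: real and v where v: "v \<in> F" "v \<noteq> (\<lambda>_. 0)" "kop f (?A v) = (\<lambda>x. of_real b * v x)"
        by blast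
      define l where "l = b / a"
      have Av: "?A v = (\<lambda>x. of_real l * v x)"
      proof
        fix x
        have "of_real a * ?A v x = of_real b * v x" using S[OF v(1)] v(3) by metis
        then show "?A v x = of_real l * v x" using a by (simp add: l_def field_simps)
      qed
      define F' where "F' = {g \<in> F. ?A g = (\<lambda>x. of_real l * g x)}"
      have "closed_subspace F'"
        unfolding closed_subspace_def
      proof (safe)
        show "ccont g" if "g \<in> F'" for g using that FD(1) by (auto simp: F'_def)
        show "(\<lambda>x. g x + h x) \<in> F'" if "g \<in> F'" "h \<in> F'" for g h
          using that FD(2) by (auto simp: F'_def herm_def fun_eq_iff algebra_simps)
        show "(\<lambda>x. b * g x) \<in> F'" if "g \<in> F'" for b g
          using that FD(3) by (auto simp: F'_def herm_def fun_eq_iff) (metis distrib_left mult.left_commute)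
        fix h p assume h: "\<forall>n. h n \<in> F'" and p: "uniform_limit UNIV h p sequentially"
        have "(\<lambda>n. h n x) \<longlonglongrightarrow> p x" for x
          using tendsto_uniform_limitI[OF p] by simp
        then have "(\<lambda>n. ?A (h n) x) \<longlonglongrightarrow> ?A p x" "(\<lambda>n. of_real l * h n x) \<longlonglongrightarrow> of_real l * p x" for x
          unfolding herm_def by (auto intro!: tendsto_intros)
        moreover have "?A (h n) x = of_real l * h n x" for n x
          using h by (auto simp: F'_def fun_eq_iff)
        ultimately have "?A p x = of_real l * p x" for x
          by (intro LIMSEQ_unique[of "\<lambda>n. of_real l * h n x"]) simp_all
        moreover have "p \<in> F" using FD(4)[OF _ p] h by (auto simp: F'_def)
        ultimately show "p \<in> F'" by (auto simp: F'_def)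
      qed
      moreover have "Z_invariant F'"
        unfolding Z_invariant_def
      proof (safe)
        fix y g assume y: "y \<in> Z" and g: "g \<in> F'"
        have "?A (\<lambda>x. g (y x)) = (\<lambda>x. ?A g (y x))"
          using Z_comm[OF y zw(1)] Z_comm[OF y zw(2)] by (simp add: herm_def)
        then show "(\<lambda>x. g (y x)) \<in> F'"
          using g y Finv by (auto simp: F'_def Z_invariant_def)
      qed
      ultimately have "good F'"
        using v Av FE by (auto simp: good_def F'_def)
      then have "\<forall>g\<in>F. ?A g = (\<lambda>x. of_real l * g x)"
        using minimal[of F'] by (auto simp: F'_def)
      then show ?thesis by blast
    qed
  qed
  have "eigenfunction g1"
    unfolding eigenfunction_def
  proof (safe)
    show "ccont g1" using FD(1) g1(1) by blast
    fix z assume z: "z \<in> Z"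
    obtain w where w: "w \<in> Z" "\<And>x. w (z x) = x" "\<And>x. z (w x) = x" using Z_inv[OF z] by blast
    obtain l1 l2 :: real where l: "herm 1 z w g1 = (\<lambda>x. of_real l1 * g1 x)" "herm \<i> z w g1 = (\<lambda>x. of_real l2 * g1 x)"
      using scalar[OF z w, of 1] scalar[OF z w, of \<i>] g1(1) by blast
    \<comment> \<open>With U the translation by \<open>z\<close>, on \<open>g1\<close> the sum of U
      and its inverse is l1 and \<i> times their difference is l2; solving for U gives the
      factor.\<close>
    have "g1 (z x) = (of_real l1 - \<i> * of_real l2) / 2 * g1 x" for x
    proof -
      have "g1 (z x) + g1 (w x) = of_real l1 * g1 x" "\<i> * g1 (z x) - \<i> * g1 (w x) = of_real l2 * g1 x"
        using fun_cong[OF l(1), of x] fun_cong[OF l(2), of x] by (simp_all add: herm_def)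
      then have "\<i> * (2 * g1 (z x) - of_real l1 * g1 x) = of_real l2 * g1 x"
        by (simp add: algebra_simps flip: \<open>g1 (z x) + g1 (w x) = of_real l1 * g1 x\<close>)
      then have "-\<i> * (\<i> * (2 * g1 (z x) - of_real l1 * g1 x)) = -\<i> * (of_real l2 * g1 x)"
        by simp
      then have "2 * g1 (z x) = of_real l1 * g1 x - \<i> * (of_real l2 * g1 x)"
        by (simp add: algebra_simps)
      then show ?thesis by (simp add: field_simps)
    qed
    then show "\<exists>c. \<forall>x. g1 (z x) = c * g1 x" by blast
  qed
  with g1 FE show ?thesis by blast
qed

lemma eigenfunction_cnj: "eigenfunction e \<Longrightarrow> eigenfunction (\<lambda>x. cnj (e x))"
  unfolding eigenfunction_def
  by (metis complex_cnj_mult continuous_on_cnj)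

lemma eigenfunction_mult: "eigenfunction e \<Longrightarrow> eigenfunction e' \<Longrightarrow> eigenfunction (\<lambda>x. e x * e' x)"
  unfolding eigenfunction_def
proof (safe)
  fix z assume *: "\<forall>z\<in>Z. \<exists>c. \<forall>x. e (z x) = c * e x" "\<forall>z\<in>Z. \<exists>c. \<forall>x. e' (z x) = c * e' x" "z \<in> Z"
  then obtain c c' where "\<And>x. e (z x) = c * e x" "\<And>x. e' (z x) = c' * e' x" by blast
  then show "\<exists>c. \<forall>x. e (z x) * e' (z x) = c * (e x * e' x)" by (intro exI[of _ "c * c'"]) simp
qed (rule continuous_on_mult)

lemma eigenfunction_const: "eigenfunction (\<lambda>_. c)"
  unfolding eigenfunction_def by (auto intro: exI[of _ 1])

text \<open>If all eigenfunctions agreed at the two points, their orthogonal complement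
  \<open>N\<close> would contain a function not killed by the kernel operator. The operator would
  then have a nonzero eigenspace inside \<open>N\<close>, hence an eigenfunction there, orthogonal
  to itself.\<close>

theorem eigenfunctions_separate_points:
  assumes "x0 \<noteq> y0"
  shows "\<exists>e. eigenfunction e \<and> e x0 \<noteq> e y0"
proof (rule ccontr)
  assume "\<not> ?thesis"
  then have same: "e x0 = e y0" if "eigenfunction e" for e using that by blast
  obtain f :: "'x \<Rightarrow> real" where f: "continuous_on UNIV f" "f x0 \<noteq> f y0"
  proof -
    have "compact_space (euclidean :: 'x topology)"
      using cpt by (simp add: compact_space_def)
    moreover have "Hausdorff_space (euclidean :: 'x topology)"
      unfolding Hausdorff_space_def using separation_t2 by (auto simp: disjnt_def)
    ultimately have "normal_space (euclidean :: 'x topology)"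
      by (intro compact_Hausdorff_or_regular_imp_normal_space) auto
    then obtain f where "continuous_map euclidean euclideanreal f" "f ` {x0} \<subseteq> {0}" "f ` {y0} \<subseteq> {1}"
      using Urysohn_lemma_alt[of "euclidean :: 'x topology" "{x0}" "{y0}" 0 1] assms by auto
    then show thesis using that[of f] by simp
  qed
  let ?K = "kop f" and ?\<rho> = "rho f"
  define N where "N = {g. ccont g \<and> (\<forall>e. eigenfunction e \<longrightarrow> ip g e = 0)}"
  have eig_c: "ccont e" if "eigenfunction e" for e using that by (simp add: eigenfunction_def)
  have Ns: "closed_subspace N"
    unfolding closed_subspace_def
  proof (safe)
    show "ccont g" if "g \<in> N" for g using that by (simp add: N_def)
    show "(\<lambda>x. g x + h x) \<in> N" if "g \<in> N" "h \<in> N" for g h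
      using that eig_c by (auto simp: N_def ip_add intro: continuous_on_add)
    show "(\<lambda>x. c * g x) \<in> N" if "g \<in> N" for c g
      using that by (auto simp: N_def ip_scale intro: continuous_on_mult_left)
    fix h p assume h: "\<forall>n. h n \<in> N" and p: "uniform_limit UNIV h p sequentially"
    have hc: "ccont (h n)" for n using h by (simp add: N_def)
    then have pc: "ccont p" using uniform_limit_theorem[OF _ p] by simp
    show "p \<in> N"
      unfolding N_def using ip_uniform_limit_zero[OF p hc pc eig_c] h pc by (auto simp: N_def)
  qed
  note ND = closed_subspaceD[OF Ns]
  have Ninv: "Z_invariant N"
    unfolding Z_invariant_def
  proof (safe)
    fix z g assume z: "z \<in> Z" and g: "g \<in> N"
    obtain w where w: "w \<in> Z" "\<And>x. w (z x) = x" "\<And>x. z (w x) = x" using Z_inv[OF z] by blast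
    have "ip (\<lambda>x. g (z x)) e = 0" if e: "eigenfunction e" for e
    proof -
      obtain c where c: "\<And>x. e (w x) = c * e x" using e w(1) unfolding eigenfunction_def by blast
      have "ip (\<lambda>x. g (z x)) e = ip g (\<lambda>x. e (w x))"
        using ip_Z[OF z w(2,3,1) ND(1)[OF g] eig_c[OF e]] .
      also have "\<dots> = 0" unfolding c ip_scale_right using g e by (simp add: N_def)
      finally show ?thesis .
    qed
    then show "(\<lambda>x. g (z x)) \<in> N" using ccont_Z[OF z ND(1)[OF g]] by (simp add: N_def)
  qed
  have KN: "?K g \<in> N" if "g \<in> N" for g
    unfolding N_def
    using that kop_cont[OF f(1) ND(1)[OF that]] kop_sym[OF f(1) ND(1)[OF that] eig_c] eigenfunction_kop[OF f(1)]
    by (auto simp: N_def)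
  \<comment> \<open>Pairing with \<open>b\<close> evaluates the difference of \<open>?K g\<close> at
    the two points. It vanishes for an eigenfunction \<open>g\<close>, as \<open>?K g\<close> is one
    too.\<close>
  define b where "b = (\<lambda>y. complex_of_real (?\<rho> x0 y - ?\<rho> y0 y))"
  have bc: "ccont b" unfolding b_def by (intro continuous_intros rho_cont2 f)
  have ipb: "ip g b = ?K g x0 - ?K g y0" if "ccont g" for g
  proof -
    have "ip g b = (\<integral>y. of_real (?\<rho> x0 y) * g y - of_real (?\<rho> y0 y) * g y \<partial>m)"
      by (simp add: ip_def b_def algebra_simps)
    then show ?thesis using kop_integrable[OF f(1) that] by (simp add: kop_def[OF f(1)])
  qed
  have bN: "b \<in> N"
  proof -
    have "ip b e = 0" if e: "eigenfunction e" for e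
      using ipb[OF eig_c[OF e]] same[OF eigenfunction_kop[OF f(1) e]] ip_cnj[of b e] by simp
    then show ?thesis using bc by (simp add: N_def)
  qed
  \<comment> \<open>Otherwise \<open>b\<close> would be orthogonal to itself, hence zero, and its
    value at \<open>x0\<close> would give \<open>rho\<close> distance 0 between points separated by
    \<open>f\<close>.\<close>
  have Kb: "?K b \<noteq> (\<lambda>_. 0)"
  proof
    assume "?K b = (\<lambda>_. 0)"
    then have "ip b b = 0" using ipb[OF bc] by simp
    then have "b = (\<lambda>_. 0)" using nsq_eq_0[OF bc] by (simp add: ip_self)
    then have "b x0 = 0" by simp
    then have "?\<rho> y0 x0 = 0" using rho_refl[OF f(1), of x0] by (simp add: b_def)
    then show False using rho_ge[OF f(1), of y0 x0] f(2) by simp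
  qed
  obtain C where C: "\<And>g. ccont g \<Longrightarrow> nsq (?K g) \<le> C * nsq g" using kop_bdd[OF f(1)] by blast
  have "\<exists>a::real. \<exists>v\<in>N. a \<noteq> 0 \<and> v \<noteq> (\<lambda>_. 0) \<and> ?K v = (\<lambda>x. of_real a * v x)"
    by (rule compact_symmetric_eigenvector[where S = ?K and C = C and ?g0.0 = b, OF Ns KN _ _ _ _ _ bN Kb])
      (use kop_add[OF f(1)] kop_scale[OF f(1)] kop_sym[OF f(1)] C kop_compact[OF f(1), of _ 1] ND(1) in auto)
  then obtain a :: real and v where v: "a \<noteq> 0" "v \<in> N" "v \<noteq> (\<lambda>_. 0)" "?K v = (\<lambda>x. of_real a * v x)" by blast
  define E where "E = {g \<in> N. ?K g = (\<lambda>x. of_real a * g x)}"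
  have Es: "closed_subspace E"
    unfolding closed_subspace_def
  proof (safe)
    show "ccont g" if "g \<in> E" for g using that ND(1) by (simp add: E_def)
    show "(\<lambda>x. g x + h x) \<in> E" if "g \<in> E" "h \<in> E" for g h
      using that ND(1,2) kop_add[OF f(1)] by (auto simp: E_def algebra_simps)
    show "(\<lambda>x. c * g x) \<in> E" if "g \<in> E" for c g
      using that ND(3) kop_scale[OF f(1)] by (auto simp: E_def algebra_simps)
    fix h p assume h: "\<forall>n. h n \<in> E" and p: "uniform_limit UNIV h p sequentially"
    have hN: "h n \<in> N" for n using h by (simp add: E_def)
    have pN: "p \<in> N" using ND(4)[OF hN p] .
    have "?K p x = of_real a * p x" for x
    proof (rule LIMSEQ_unique)
      show "(\<lambda>n. ?K (h n) x) \<longlonglongrightarrow> ?K p x"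
        using kop_uniform_limit[OF f(1) p ND(1)[OF hN] ND(1)[OF pN]] .
      have "(\<lambda>n. of_real a * h n x) \<longlonglongrightarrow> of_real a * p x"
        using tendsto_uniform_limitI[OF p] by (auto intro!: tendsto_intros)
      then show "(\<lambda>n. ?K (h n) x) \<longlonglongrightarrow> of_real a * p x" using h by (simp add: E_def)
    qed
    with pN show "p \<in> E" by (auto simp: E_def)
  qed
  have Einv: "Z_invariant E"
    using Ninv kop_Z[OF f(1)] ND(1) by (auto simp: Z_invariant_def E_def)
  obtain e where e: "e \<in> E" "e \<noteq> (\<lambda>_. 0)" "eigenfunction e"
    using eigenfunction_in_eigenspace[OF f(1) v(1) Es Einv, of v] v by (auto simp: E_def)
  then have "ip e e = 0" by (auto simp: E_def N_def)
  then show False using nsq_eq_0[OF eig_c[OF e(3)]] e(2) by (simp add: ip_self)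
qed

text \<open>The summands may have different characters. Scalars enter through products with constant
  eigenfunctions.\<close>

inductive_set eigenspan :: "('x \<Rightarrow> complex) set" where
  base: "eigenfunction e \<Longrightarrow> e \<in> eigenspan"
| add: "s \<in> eigenspan \<Longrightarrow> t \<in> eigenspan \<Longrightarrow> (\<lambda>x. s x + t x) \<in> eigenspan"

lemma eigenspan_cont: "s \<in> eigenspan \<Longrightarrow> ccont s"
  by (induction rule: eigenspan.induct) (auto simp: eigenfunction_def intro: continuous_on_add)

lemma eigenspan_cnj: "s \<in> eigenspan \<Longrightarrow> (\<lambda>x. cnj (s x)) \<in> eigenspan"
proof (induction rule: eigenspan.induct)
  case (base e)
  then show ?case by (intro eigenspan.base eigenfunction_cnj)
next
  case (add s t)
  then show ?case using eigenspan.add[OF add.IH] by simp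
qed

lemma eigenspan_mult_eigenfunction:
  "s \<in> eigenspan \<Longrightarrow> eigenfunction e \<Longrightarrow> (\<lambda>x. s x * e x) \<in> eigenspan"
proof (induction rule: eigenspan.induct)
  case (base e')
  then show ?case by (intro eigenspan.base eigenfunction_mult)
next
  case (add s t)
  then show ?case using eigenspan.add[OF add.IH] by (simp add: distrib_right)
qed

lemma eigenspan_mult: "t \<in> eigenspan \<Longrightarrow> s \<in> eigenspan \<Longrightarrow> (\<lambda>x. s x * t x) \<in> eigenspan"
proof (induction rule: eigenspan.induct)
  case (base e)
  then show ?case by (intro eigenspan_mult_eigenfunction)
next
  case (add t t')
  then show ?case using eigenspan.add[OF add.IH] by (simp add: distrib_left)
qed

theorem eigenspan_dense:
  fixes f :: "'x \<Rightarrow> real"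
  assumes f: "continuous_on UNIV f" and e: "e > 0"
  shows "\<exists>s\<in>eigenspan. \<forall>x. \<bar>f x - Re (s x)\<bar> < e"
proof -
  define A where "A = {\<lambda>x. Re (s x) | s. s \<in> eigenspan}"
  have AI: "(\<lambda>x. Re (s x)) \<in> A" if "s \<in> eigenspan" for s using that by (auto simp: A_def)
  have smult: "(\<lambda>x. c * s x) \<in> eigenspan" if "s \<in> eigenspan" for c s
    using eigenspan_mult[OF that eigenspan.base[OF eigenfunction_const[of c]]] .
  interpret function_ring_on A "UNIV :: 'x set"
  proof
    show "compact (UNIV :: 'x set)" by (rule cpt)
    show "continuous_on UNIV g" if "g \<in> A" for g
      using that eigenspan_cont by (auto simp: A_def intro: continuous_on_Re)
    show "(\<lambda>x. g x + h x) \<in> A" if gh: "g \<in> A" "h \<in> A" for g h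
    proof -
      obtain s t where st: "g = (\<lambda>x. Re (s x))" "h = (\<lambda>x. Re (t x))" "s \<in> eigenspan" "t \<in> eigenspan"
        using gh unfolding A_def by blast
      show ?thesis using AI[OF eigenspan.add[OF st(3,4)]] by (simp add: st)
    qed
    show "(\<lambda>x. g x * h x) \<in> A" if gh: "g \<in> A" "h \<in> A" for g h
    proof -
      obtain s t where st: "g = (\<lambda>x. Re (s x))" "h = (\<lambda>x. Re (t x))" "s \<in> eigenspan" "t \<in> eigenspan"
        using gh unfolding A_def by blast
      \<comment> \<open>The real part of this function is Re s * Re t, since t + cnj t = 2 * Re
        t.\<close>
      have "(\<lambda>x. (1/2) * (s x * t x + s x * cnj (t x))) \<in> eigenspan"
        using st by (intro smult eigenspan.add eigenspan_mult eigenspan_cnj)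
      from AI[OF this] show ?thesis by (simp add: st)
    qed
    show "(\<lambda>_. c) \<in> A" for c
      using AI[OF eigenspan.base[OF eigenfunction_const[of "of_real c"]]] by simp
    show "\<exists>g\<in>A. g x \<noteq> g y" if xy: "x \<noteq> y" for x y
    proof -
      obtain e where e: "eigenfunction e" "e x \<noteq> e y"
        using eigenfunctions_separate_points[OF xy] by blast
      show ?thesis
      proof (cases "Re (e x) = Re (e y)")
        case False
        then show ?thesis by (rule bexI[OF _ AI[OF eigenspan.base[OF e(1)]]])
      next
        case True
        \<comment> \<open>Multiplication by -\<i> turns the imaginary part, which must differ here,
          into the real part.\<close>
        then have "Re (-\<i> * e x) \<noteq> Re (-\<i> * e y)" using e(2) by (simp add: complex_eq_iff)
        then show ?thesis by (rule bexI[OF _ AI[OF smult[OF eigenspan.base[OF e(1)]]]])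
      qed
    qed
  qed
  obtain g where "g \<in> A" "\<forall>x\<in>UNIV. \<bar>f x - g x\<bar> < e"
    using Stone_Weierstrass_basic[OF f e] by blast
  then show ?thesis by (auto simp: A_def)
qed

end

subsection \<open>Two-step nilmanifolds\<close>

locale nilmanifold = group G for G :: "'g::t2_space monoid" (structure) +
  fixes \<Gamma> :: "'g set" and q :: "'g \<Rightarrow> 'x::t2_space" and m :: "'x measure"
  assumes carrier_UNIV [simp]: "carrier G = UNIV"
    and mult_cont: "continuous_on UNIV (\<lambda>p::'g \<times> 'g. fst p \<otimes> snd p)"
    and inv_cont: "continuous_on UNIV (\<lambda>x. inv x)"
    and two_step: "lower_central G 2 = {\<one>}"
    and sub: "subgroup \<Gamma> G"
    and quot: "coset_quotient_map G \<Gamma> q"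
    and compact_X: "compact (UNIV :: 'x set)"
    and haar: "haar_on_quotient G q m"
begin

abbreviation act :: "'g \<Rightarrow> 'x \<Rightarrow> 'x" where "act \<equiv> left_transl G q"

section \<open>Central commutators and the action on the quotient\<close>

definition comm :: "'g \<Rightarrow> 'g \<Rightarrow> 'g" where "comm a b = a \<otimes> b \<otimes> inv a \<otimes> inv b"

abbreviation G1 :: "'g set" where "G1 \<equiv> lower_central G 1"

lemma q_eq_iff: "q g = q h \<longleftrightarrow> inv g \<otimes> h \<in> \<Gamma>"
  using quot by (simp add: coset_quotient_map_def)

lemma q_surj: obtains g where "x = q g"
  using quot by (metis coset_quotient_map_def surjD)

lemma q_rep: "q (SOME g. q g = x) = x"
  by (rule someI_ex) (metis q_surj)

lemma inv_cancel [simp]: "inv a \<otimes> (a \<otimes> h) = h" "a \<otimes> (inv a \<otimes> h) = h"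
  by (simp_all flip: m_assoc)

lemma cancel_left: "inv (a \<otimes> g) \<otimes> (a \<otimes> h) = inv g \<otimes> h"
  by (simp add: inv_mult_group m_assoc)

lemma act_q [simp]: "act a (q g) = q (a \<otimes> g)"
proof -
  have "inv (SOME h. q h = q g) \<otimes> g \<in> \<Gamma>" using q_rep[of "q g"] q_eq_iff by blast
  then show ?thesis unfolding left_transl_def q_eq_iff cancel_left .
qed

lemma act_act: "act a (act b x) = act (a \<otimes> b) x"
  by (rule q_surj[of x]) (simp add: m_assoc)

lemma act_one [simp]: "act \<one> x = x"
  by (rule q_surj[of x]) simp

lemma act_inv [simp]: "act a (act (inv a) x) = x" "act (inv a) (act a x) = x"
  by (simp_all add: act_act)

lemma quotient_open: "open S \<longleftrightarrow> open (q -` S)"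
  using quot by (simp add: coset_quotient_map_def)

lemma continuous_mult:
  assumes "continuous_on S a" "continuous_on S b"
  shows "continuous_on S (\<lambda>x. a x \<otimes> b x)"
  using continuous_on_compose2[OF mult_cont continuous_on_Pair[OF assms]] by simp

lemma continuous_inv: "continuous_on S a \<Longrightarrow> continuous_on S (\<lambda>x. inv (a x))"
  by (rule continuous_on_compose2[OF inv_cont]) auto

lemma q_cont: "continuous_on UNIV q"
  by (simp add: continuous_on_open_vimage quotient_open[symmetric])

lemma continuous_q: "continuous_on S a \<Longrightarrow> continuous_on S (\<lambda>x. q (a x))"
  by (rule continuous_on_compose2[OF q_cont]) auto

lemma continuous_quotient_lift:
  fixes F :: "'x \<Rightarrow> 'b::topological_space"
  assumes "continuous_on UNIV (\<lambda>g. F (q g))"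
  shows "continuous_on UNIV F"
proof -
  have "open (F -` B)" if "open B" for B
    using open_vimage[OF that assms] by (simp add: quotient_open[of "F -` B"] vimage_comp o_def)
  then show ?thesis by (simp add: continuous_on_open_vimage)
qed

lemma act_cont: "continuous_on UNIV (act a)"
  by (rule continuous_quotient_lift) (auto intro!: continuous_q continuous_mult continuous_intros)

lemma continuous_act: "continuous_on UNIV f \<Longrightarrow> continuous_on UNIV (\<lambda>x. f (act a x))"
  by (rule continuous_on_compose2[OF _ act_cont]) auto

text \<open>The preimage of the image is the union of the right translates of \<open>S\<close> by
  \<Gamma>.\<close>

lemma q_open:
  assumes "open S"
  shows "open (q ` S)"
proof -
  have "q -` (q ` S) = (\<Union>\<gamma>\<in>\<Gamma>. (\<lambda>g. g \<otimes> \<gamma>) -` S)"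
  proof (intro equalityI subsetI)
    fix g assume "g \<in> q -` (q ` S)"
    then obtain s where "q g = q s" "s \<in> S" by auto
    then have "inv g \<otimes> s \<in> \<Gamma>" "g \<otimes> (inv g \<otimes> s) \<in> S"
      using q_eq_iff by (simp_all add: m_assoc[symmetric])
    then show "g \<in> (\<Union>\<gamma>\<in>\<Gamma>. (\<lambda>g. g \<otimes> \<gamma>) -` S)" by blast
  next
    fix g assume "g \<in> (\<Union>\<gamma>\<in>\<Gamma>. (\<lambda>g. g \<otimes> \<gamma>) -` S)"
    then obtain \<gamma> where "\<gamma> \<in> \<Gamma>" "g \<otimes> \<gamma> \<in> S" by auto
    moreover from this have "q g = q (g \<otimes> \<gamma>)" by (simp add: q_eq_iff m_assoc[symmetric])
    ultimately show "g \<in> q -` (q ` S)" by (metis image_eqI vimageI)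
  qed
  moreover have "open \<dots>"
    using assms by (intro open_UN ballI open_vimage continuous_mult continuous_intros)
  ultimately show ?thesis by (simp add: quotient_open)
qed

lemma G1_central:
  assumes "z \<in> G1"
  shows "z \<otimes> g = g \<otimes> z"
proof -
  have "g \<otimes> z \<otimes> inv g \<otimes> inv z \<in> lower_central G 2"
    using assms by (auto simp: numeral_2_eq_2 intro!: generate.incl)
  then have "g \<otimes> z \<otimes> inv g \<otimes> inv z = \<one>" using two_step by simp
  then have "g \<otimes> z \<otimes> inv g = z" by (metis UNIV_I carrier_UNIV inv_closed inv_equality inv_inv m_closed)
  then show ?thesis by (metis UNIV_I carrier_UNIV inv_solve_right m_closed)
qed

lemma comm_G1: "comm a b \<in> G1"
  by (auto simp: comm_def intro!: generate.incl)

lemma comm_swap: "a \<otimes> b = comm a b \<otimes> (b \<otimes> a)"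
  by (simp add: comm_def m_assoc)

lemma G1_subgroup: "subgroup G1 G"
  by (auto intro!: generate_is_subgroup)

lemma G1_mult: "z \<in> G1 \<Longrightarrow> w \<in> G1 \<Longrightarrow> z \<otimes> w \<in> G1"
  by (rule subgroup.m_closed[OF G1_subgroup])

lemma G1_inv: "z \<in> G1 \<Longrightarrow> inv z \<in> G1"
  by (rule subgroup.m_inv_closed[OF G1_subgroup])

lemma G1_one: "\<one> \<in> G1"
  by (rule subgroup.one_closed[OF G1_subgroup])

lemma act_G1_commute: "z \<in> G1 \<Longrightarrow> act z (act a x) = act a (act z x)"
  by (metis act_act G1_central)

lemma act_swap: "act a (act b x) = act (comm a b) (act b (act a x))"
  unfolding act_act using comm_swap[of a b] by (simp add: m_assoc)

text \<open>The central factor \<open>comm a' b\<close> can be moved past \<open>a\<close>. This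
  makes characters of commutators into homomorphisms of the whole group.\<close>

lemma comm_mult_left: "comm (a \<otimes> a') b = comm a b \<otimes> comm a' b"
proof -
  have "comm (a \<otimes> a') b \<otimes> (b \<otimes> (a \<otimes> a')) = a \<otimes> (a' \<otimes> b)"
    using comm_swap[of "a \<otimes> a'" b] by (simp add: m_assoc)
  also have "\<dots> = a \<otimes> (comm a' b \<otimes> (b \<otimes> a'))" using comm_swap[of a' b] by simp
  also have "\<dots> = comm a' b \<otimes> ((a \<otimes> b) \<otimes> a')"
    using G1_central[OF comm_G1[of a' b], of a] by (simp add: m_assoc[symmetric])
  also have "a \<otimes> b = comm a b \<otimes> (b \<otimes> a)" by (rule comm_swap)
  also have "comm a' b \<otimes> ((comm a b \<otimes> (b \<otimes> a)) \<otimes> a') = (comm a b \<otimes> comm a' b) \<otimes> (b \<otimes> (a \<otimes> a'))"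
    using G1_central[OF comm_G1[of a' b], of "comm a b"] by (simp add: m_assoc[symmetric])
  finally show ?thesis by simp
qed

lemma comm_inv: "comm b a = inv (comm a b)"
  by (simp add: comm_def inv_mult_group m_assoc)

lemma comm_cont: "continuous_on S a \<Longrightarrow> continuous_on S b \<Longrightarrow> continuous_on S (\<lambda>x. comm (a x) (b x))"
  unfolding comm_def by (intro continuous_mult continuous_inv)

sublocale compact_prob_space m
proof (rule compact_prob_space.intro)
  show "compact (UNIV :: 'x set)" by (rule compact_X)
  show "sets m = sets borel" "prob_space m"
    using haar unfolding haar_on_quotient_def by blast+
qed

lemma integral_act:
  fixes f :: "'x \<Rightarrow> 'b::{banach,second_countable_topology}"
  assumes "continuous_on UNIV f"
  shows "(\<integral>x. f (act a x) \<partial>m) = (\<integral>x. f x \<partial>m)"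
proof -
  have "m = distr m borel (act a)" using haar by (simp add: haar_on_quotient_def)
  then have "(\<integral>x. f x \<partial>m) = (\<integral>x. f x \<partial>distr m borel (act a))" by simp
  also have "\<dots> = (\<integral>x. f (act a x) \<partial>m)"
    by (rule integral_distr[OF measurable_continuous[OF act_cont] borel_measurable_continuous_onI[OF assms]])
  finally show ?thesis by simp
qed

lemma measure_act_vimage:
  assumes "open S"
  shows "measure m (act a -` S) = measure m S"
proof -
  have "measure m S = measure (distr m borel (act a)) S"
    using haar by (simp add: haar_on_quotient_def)
  also have "\<dots> = measure m (act a -` S)"
    using assms by (subst measure_distr[OF measurable_continuous[OF act_cont]]) auto
  finally show ?thesis by simp
qed

text \<open>The group acts transitively, so finitely many translates of a nonempty open set cover
  the compact space. They all have the same measure, which therefore is not 0.\<close>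

sublocale full_support_space m
proof
  fix S :: "'x set" assume S: "open S" "S \<noteq> {}"
  obtain g0 where g0: "q g0 \<in> S" using S(2) q_surj by (metis equals0I)
  have o: "open (act a -` S)" for a using S(1) act_cont by (rule open_vimage)
  obtain A where A: "finite A" "(UNIV :: 'x set) \<subseteq> (\<Union>a\<in>A. act a -` S)"
  proof (rule compactE_image[OF compact_X, of UNIV "\<lambda>a. act a -` S"])
    show "UNIV \<subseteq> (\<Union>a. act a -` S)"
    proof
      fix x :: 'x
      obtain g where "x = q g" by (rule q_surj)
      then have "act (g0 \<otimes> inv g) x \<in> S" using g0 by (simp add: m_assoc)
      then show "x \<in> (\<Union>a. act a -` S)" by blast
    qed
  qed (use o that in auto)
  show "measure m S > 0"
  proof (rule ccontr)
    assume "\<not> measure m S > 0"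
    then have "measure m S = 0" using measure_nonneg[of m S] by linarith
    then have "measure m (act a -` S) = 0" for a using measure_act_vimage[OF S(1)] by simp
    moreover have "(\<lambda>a. act a -` S) ` A \<subseteq> sets m" using o sets_m by auto
    ultimately have "measure m (\<Union>a\<in>A. act a -` S) \<le> 0"
      using finite_measure.finite_measure_subadditive_finite[OF finite_m A(1), of "\<lambda>a. act a -` S"]
      by simp
    moreover have "(\<Union>a\<in>A. act a -` S) = UNIV" using A(2) by blast
    ultimately show False by simp
  qed
qed

text \<open>Compactness makes continuity of the action at \<one> uniform in \<open>y\<close>: one
  intersects the first factors of finitely many product neighbourhoods whose second factors project
  onto a cover. Moved and unmoved points are both compared with the centre, hence e / 2.\<close>

lemma small_translations:
  fixes f :: "'x \<Rightarrow> 'b::real_normed_vector"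
  assumes f: "continuous_on UNIV f" and e: "e > 0"
  obtains W where "open W" "\<one> \<in> W" "\<And>a y. a \<in> W \<Longrightarrow> norm (f (act a y) - f y) \<le> e"
proof -
  have "\<exists>A B. open A \<and> \<one> \<in> A \<and> open B \<and> g \<in> B \<and>
      (\<forall>a\<in>A. \<forall>b\<in>B. dist (f (q (a \<otimes> b))) (f (q g)) < e / 2)" for g
  proof -
    have c: "continuous_on UNIV (\<lambda>p. f (q (fst p \<otimes> snd p)))"
      using continuous_on_compose2[OF f continuous_q[OF mult_cont]] by simp
    define O' where "O' = (\<lambda>p. f (q (fst p \<otimes> snd p))) -` ball (f (q g)) (e / 2)"
    have "open O'" unfolding O'_def using c by (intro open_vimage) auto
    moreover have "(\<one>, g) \<in> O'" using e by (simp add: O'_def)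
    ultimately obtain A B where "open A" "open B" "(\<one>, g) \<in> A \<times> B" "A \<times> B \<subseteq> O'"
      by (rule open_prod_elim)
    moreover from this have "\<forall>a\<in>A. \<forall>b\<in>B. dist (f (q (a \<otimes> b))) (f (q g)) < e / 2"
      by (force simp: O'_def dist_commute)
    ultimately show ?thesis by blast
  qed
  then obtain A B where AB: "\<And>g. open (A g)" "\<And>g. \<one> \<in> A g" "\<And>g. open (B g)" "\<And>g. g \<in> B g"
    "\<And>g a b. a \<in> A g \<Longrightarrow> b \<in> B g \<Longrightarrow> dist (f (q (a \<otimes> b))) (f (q g)) < e / 2"
    by metis
  obtain I where I: "finite I" "(UNIV :: 'x set) \<subseteq> (\<Union>g\<in>I. q ` B g)"
  proof (rule compactE_image[OF compact_X, of UNIV "\<lambda>g. q ` B g"])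
    show "UNIV \<subseteq> (\<Union>g. q ` B g)"
    proof
      fix x :: 'x
      obtain g where "x = q g" by (rule q_surj)
      then show "x \<in> (\<Union>g. q ` B g)" using AB(4) by blast
    qed
  qed (use q_open AB(3) that in auto)
  show thesis
  proof (rule that[of "\<Inter>g\<in>I. A g"])
    show "open (\<Inter>g\<in>I. A g)" using I(1) AB(1) by (intro open_INT) auto
    show "\<one> \<in> (\<Inter>g\<in>I. A g)" using AB(2) by simp
    fix a y assume a: "a \<in> (\<Inter>g\<in>I. A g)"
    obtain g b where g: "g \<in> I" "b \<in> B g" "y = q b" using I(2) by blast
    have "dist (f (q (a \<otimes> b))) (f (q g)) < e / 2" "dist (f (q (\<one> \<otimes> b))) (f (q g)) < e / 2"
      using AB(2,5) a g by blast+
    then show "norm (f (act a y) - f y) \<le> e"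
      using dist_triangle2[of "f (q (a \<otimes> b))" "f (q b)" "f (q g)"] g(3) by (simp add: dist_norm)
  qed
qed

lemma translates_nbhd:
  assumes "open W" "\<one> \<in> W"
  obtains U where "open U" "x \<in> U" "\<And>x'. x' \<in> U \<Longrightarrow> \<exists>a\<in>W. x' = act a x"
proof -
  obtain g where g: "x = q g" by (rule q_surj)
  define V where "V = (\<lambda>h. h \<otimes> inv g) -` W"
  have V: "open V" "g \<in> V"
    using assms by (auto simp: V_def intro!: open_vimage continuous_mult continuous_intros)
  show thesis
  proof (rule that[OF q_open[OF V(1)]])
    show "x \<in> q ` V" using g V(2) by simp
    fix x' assume "x' \<in> q ` V"
    then obtain h where "x' = q h" "h \<otimes> inv g \<in> W" by (auto simp: V_def)
    moreover have "act (h \<otimes> inv g) x = q h" using g by (simp add: m_assoc)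
    ultimately show "\<exists>a\<in>W. x' = act a x" by metis
  qed
qed

text \<open>Nearness is expressed by one group element \<open>a\<close> that moves \<open>f\<close>
  little at every point \<open>y\<close>, not just at \<open>x\<close>. As \<open>a\<close> commutes
  with central elements, the estimate carries over to all translates by them at once.\<close>

lemma near_points_are_small_translates:
  fixes f :: "'x \<Rightarrow> 'b::real_normed_vector"
  assumes "continuous_on UNIV f" "e > 0"
  obtains U where "open U" "x \<in> U"
    "\<And>x'. x' \<in> U \<Longrightarrow> \<exists>a. x' = act a x \<and> (\<forall>y. norm (f (act a y) - f y) \<le> e)"
proof -
  obtain W where W: "open W" "\<one> \<in> W" "\<And>a y. a \<in> W \<Longrightarrow> norm (f (act a y) - f y) \<le> e"
    using small_translations[OF assms] by blast
  obtain U where U: "open U" "x \<in> U" "\<And>x'. x' \<in> U \<Longrightarrow> \<exists>a\<in>W. x' = act a x"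
    using translates_nbhd[OF W(1,2)] by blast
  show thesis using that[OF U(1,2)] U(3) W(3) by meson
qed

text \<open>Uniqueness of Haar measure on the torus factor, phrased for functions on the nilmanifold.\<close>

lemma G1_invariant_integral_eq:
  assumes n: "compact_prob_space n" and f: "ccont f"
    and inv: "\<And>z x. z \<in> G1 \<Longrightarrow> f (act z x) = f x"
    and n_inv: "\<And>a. (\<integral>x. f (act a x) \<partial>n) = (\<integral>x. f x \<partial>n)"
  shows "(\<integral>x. f x \<partial>n) = (\<integral>x. f x \<partial>m)"
proof -
  interpret n: compact_prob_space n by (rule n)
  \<comment> \<open>Since \<open>f\<close> does not see commutators, group elements may be exchanged
    under it. So \<open>K\<close> is a translate of \<open>f\<close> in either variable, both inner
    integrals are constant, and the exchange of integrals equates them.\<close>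
  define K where "K x y = f (act (SOME g. q g = x) y)" for x y
  have swap: "f (act a (act b x)) = f (act b (act a x))" for a b x
    by (subst act_swap) (simp add: inv[OF comm_G1])
  have K: "K x y = f (act (SOME h. q h = y) x)" for x y
  proof -
    have eq: "act h (q \<one>) = q h" for h by simp
    have "act a y = act a (act (SOME h. q h = y) (q \<one>))" for a
      by (simp only: eq q_rep)
    moreover have "act b x = act b (act (SOME g. q g = x) (q \<one>))" for b
      by (simp only: eq q_rep)
    ultimately show ?thesis unfolding K_def using swap by metis
  qed
  have mp: "compact_prob_space m" by unfold_locales
  have i1: "(\<integral>y. K x y \<partial>n) = (\<integral>x. f x \<partial>n)" for x unfolding K_def by (rule n_inv)
  have i2: "(\<integral>x. K x y \<partial>m) = (\<integral>x. f x \<partial>m)" for y unfolding K by (rule integral_act[OF f])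
  have "(\<integral>x. \<integral>y. K x y \<partial>n \<partial>m) = (\<integral>y. \<integral>x. K x y \<partial>m \<partial>n)"
  proof (rule equicontinuous_Fubini[OF mp n])
    show "ccont (\<lambda>x. K x y)" for y unfolding K by (rule continuous_act[OF f])
    show "ccont (K x)" for x unfolding K_def by (rule continuous_act[OF f])
    show "complex_integrable m (\<lambda>x. \<integral>y. K x y \<partial>n)" unfolding i1
      by (intro integrable_continuous continuous_intros)
    show "complex_integrable n (\<lambda>y. \<integral>x. K x y \<partial>m)" unfolding i2
      by (intro n.integrable_continuous continuous_intros)
    fix x and e :: real assume "e > 0"
    then obtain U where U: "open U" "x \<in> U"
      "\<And>x'. x' \<in> U \<Longrightarrow> \<exists>a. x' = act a x \<and> (\<forall>y. norm (f (act a y) - f y) \<le> e)"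
      using near_points_are_small_translates[OF f] by metis
    have "norm (K x' y - K x y) \<le> e" if x': "x' \<in> U" for x' y
    proof -
      obtain a where a: "x' = act a x" "\<And>y. norm (f (act a y) - f y) \<le> e" using U(3)[OF x'] by blast
      show ?thesis unfolding K a(1) using a(2) by (subst swap)
    qed
    with U show "\<exists>U. open U \<and> x \<in> U \<and> (\<forall>x'\<in>U. \<forall>y. norm (K x' y - K x y) \<le> e)" by blast
  qed
  then show ?thesis unfolding i1 i2 by simp
qed

end

subsection \<open>Vertical characters and mixing\<close>

locale nilsystem = nilmanifold G \<Gamma> q m
  for G :: "'g::t2_space monoid" (structure) and \<Gamma> and q :: "'g \<Rightarrow> 'x::t2_space" and m +
  fixes u :: 'g
  assumes connected_G: "connected (UNIV :: 'g set)"
    and locally_connected_G: "\<And>W. open W \<Longrightarrow> \<one> \<in> W \<Longrightarrow>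
      \<exists>V. open V \<and> connected V \<and> \<one> \<in> V \<and> V \<subseteq> W"
    and transitive: "top_transitive (act u)"
begin

sublocale equicontinuous_group m "act ` G1"
proof unfold_locales
  fix z assume "z \<in> act ` G1"
  then obtain a where a: "a \<in> G1" "z = act a" by blast
  show "continuous_on UNIV z" by (simp add: a act_cont)
  show "\<exists>w\<in>act ` G1. (\<forall>x. z (w x) = x) \<and> (\<forall>x. w (z x) = x)"
    using G1_inv[OF a(1)] by (intro bexI[of _ "act (inv a)"]) (auto simp: a)
  show "(\<integral>x. g (z x) \<partial>m) = (\<integral>x. g x \<partial>m)" if "ccont g" for g :: "'x \<Rightarrow> complex"
    unfolding a(2) by (rule integral_act[OF that])
  fix w assume "w \<in> act ` G1"
  then obtain b where b: "b \<in> G1" "w = act b" by blast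
  have "(\<lambda>x. z (w x)) = act (a \<otimes> b)" by (simp add: a b act_act)
  then show "(\<lambda>x. z (w x)) \<in> act ` G1" using G1_mult[OF a(1) b(1)] by simp
  show "z (w x) = w (z x)" for x unfolding a(2) b(2) by (rule act_G1_commute[OF a(1)])
next
  have "act \<one> = (\<lambda>x. x)" by (rule ext) simp
  then show "(\<lambda>x. x) \<in> act ` G1" using G1_one by (metis image_eqI)
next
  fix f :: "'x \<Rightarrow> real" and e :: real and x assume fe: "continuous_on UNIV f" "e > 0"
  obtain U where U: "open U" "x \<in> U"
    "\<And>x'. x' \<in> U \<Longrightarrow> \<exists>a. x' = act a x \<and> (\<forall>y. norm (f (act a y) - f y) \<le> e)"
    using near_points_are_small_translates[OF fe] by metis
  have "\<bar>f (act z x') - f (act z x)\<bar> \<le> e" if x': "x' \<in> U" and z: "z \<in> G1" for x' z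
  proof -
    obtain a where a: "x' = act a x" "\<And>y. norm (f (act a y) - f y) \<le> e" using U(3)[OF x'] by blast
    have "act z x' = act a (act z x)" unfolding a(1) by (rule act_G1_commute[OF z])
    then show ?thesis using a(2)[of "act z x"] by simp
  qed
  with U show "\<exists>U. open U \<and> x \<in> U \<and> (\<forall>x'\<in>U. \<forall>z\<in>act ` G1. \<bar>f (z x') - f (z x)\<bar> \<le> e)"
    by (intro exI[of _ U]) auto
next
  obtain x0 where "closure {(act u ^^ n) x0 | n. True} = UNIV"
    using transitive unfolding top_transitive_def by blast
  moreover have "{(act u ^^ n) x0 | n. True} = range (\<lambda>n. (act u ^^ n) x0)" by auto
  ultimately show "\<exists>d :: nat \<Rightarrow> 'x. closure (range d) = UNIV" by auto
qed

text \<open>Such a homomorphism descends to a continuous function on the quotient that is invariant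
  under translation by \<open>u\<close>, hence constant on a dense orbit and everywhere equal to its
  value at \<one>.\<close>

lemma homomorphism_trivial:
  fixes \<beta> :: "'g \<Rightarrow> complex"
  assumes cont: "continuous_on UNIV \<beta>" and mult: "\<And>a b. \<beta> (a \<otimes> b) = \<beta> a * \<beta> b"
    and one: "\<beta> \<one> = 1" and \<Gamma>: "\<And>\<gamma>. \<gamma> \<in> \<Gamma> \<Longrightarrow> \<beta> \<gamma> = 1" and u: "\<beta> u = 1"
  shows "\<beta> g = 1"
proof -
  define B where "B x = \<beta> (SOME g. q g = x)" for x
  have B: "B (q g) = \<beta> g" for g
  proof -
    let ?r = "SOME h. q h = q g"
    have "inv ?r \<otimes> g \<in> \<Gamma>" using q_rep[of "q g"] q_eq_iff by blast
    then have "\<beta> (inv ?r \<otimes> g) = 1" by (rule \<Gamma>)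
    then have "\<beta> (?r \<otimes> (inv ?r \<otimes> g)) = \<beta> ?r" by (simp only: mult[of ?r] mult_1_right)
    then show ?thesis by (simp add: B_def)
  qed
  have Bc: "continuous_on UNIV B"
    by (rule continuous_quotient_lift) (simp add: B cont)
  have BT: "B (act u x) = B x" for x
    by (rule q_surj[of x]) (simp add: B mult u)
  obtain x0 where x0: "closure {(act u ^^ n) x0 | n. True} = UNIV"
    using transitive unfolding top_transitive_def by blast
  have "B ((act u ^^ n) x0) = B x0" for n by (induction n) (simp_all add: BT)
  then have "{(act u ^^ n) x0 | n. True} \<subseteq> {x. B x = B x0}" by auto
  moreover have "closed {x. B x = B x0}"
    by (rule closed_Collect_eq[OF Bc continuous_on_const])
  ultimately have "closure {(act u ^^ n) x0 | n. True} \<subseteq> {x. B x = B x0}"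
    by (rule closure_minimal)
  then have "B x = B x0" for x using x0 by blast
  then have "\<beta> g = B x0" for g using B by metis
  then show ?thesis using one by metis
qed

text \<open>On a connected neighbourhood of \<one> the arguments of \<theta> fill an interval from 0
  to some \<open>a0 \<noteq> 0\<close>, which contains pi / n or its negative as soon as n is
  large.\<close>

lemma homomorphism_roots_of_minus_one:
  fixes \<theta> :: "'g \<Rightarrow> complex"
  assumes cont: "continuous_on UNIV \<theta>" and mult: "\<And>a b. \<theta> (a \<otimes> b) = \<theta> a * \<theta> b"
    and one: "\<theta> \<one> = 1" and norm: "\<And>a. cmod (\<theta> a) = 1" and nontriv: "\<theta> h1 \<noteq> 1"
    and W: "open W" "\<one> \<in> W"
  shows "\<exists>N. \<forall>n\<ge>N. \<exists>h\<in>W. \<theta> h ^ n = -1"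
proof -
  \<comment> \<open>The disc of radius 1 about 1 avoids the negative real axis and 0, so
    \<open>Arg\<close> is continuous along \<theta> here.\<close>
  define W' where "W' = W \<inter> \<theta> -` ball 1 1"
  have "open W'" "\<one> \<in> W'"
    using W one cont by (auto simp: W'_def intro!: open_Int open_vimage)
  then obtain V where V: "open V" "connected V" "\<one> \<in> V" "V \<subseteq> W'"
    using locally_connected_G by blast
  have "\<exists>h0\<in>V. \<theta> h0 \<noteq> 1"
  proof (rule ccontr)
    assume "\<not> ?thesis"
    then have V1: "\<And>h. h \<in> V \<Longrightarrow> \<theta> h = 1" by blast
    \<comment> \<open>If \<theta> were trivial on a neighbourhood of \<one>, its kernel would be
      open and closed, hence the whole connected group.\<close>
    define S where "S = {h. \<theta> h = 1}"
    have "closed S" unfolding S_def by (rule closed_Collect_eq[OF cont continuous_on_const])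
    moreover have "open S"
    proof (subst open_subopen, intro ballI)
      fix h assume h: "h \<in> S"
      have "open ((\<lambda>g. inv h \<otimes> g) -` V)"
        using V(1) by (intro open_vimage continuous_mult continuous_intros)
      moreover have "h \<in> (\<lambda>g. inv h \<otimes> g) -` V" using V(3) by simp
      moreover have "(\<lambda>g. inv h \<otimes> g) -` V \<subseteq> S"
      proof
        fix g assume "g \<in> (\<lambda>g. inv h \<otimes> g) -` V"
        then have "\<theta> (inv h \<otimes> g) = 1" "\<theta> h = 1" using V1 h by (auto simp: S_def)
        then have "\<theta> (h \<otimes> (inv h \<otimes> g)) = 1" by (simp only: mult[of h] mult_1_right)
        then show "g \<in> S" by (simp add: S_def)
      qed
      ultimately show "\<exists>T. open T \<and> h \<in> T \<and> T \<subseteq> S" by blast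
    qed
    ultimately have "S = {} \<or> S = UNIV" using connected_G connected_clopen[of "UNIV :: 'g set"] by auto
    moreover have "\<one> \<in> S" using one by (simp add: S_def)
    ultimately have "h1 \<in> S" by auto
    then show False using nontriv by (simp add: S_def)
  qed
  then obtain h0 where h0: "h0 \<in> V" "\<theta> h0 \<noteq> 1" by blast
  define \<alpha> where "\<alpha> h = Arg (\<theta> h)" for h
  have nonneg: "\<theta> h \<notin> \<real>\<^sub>\<le>\<^sub>0" if "h \<in> V" for h
  proof
    assume "\<theta> h \<in> \<real>\<^sub>\<le>\<^sub>0"
    then have "Re (\<theta> h) \<le> 0" by (auto elim: nonpos_Reals_cases)
    moreover have "cmod (1 - \<theta> h) < 1" using that V(4) by (auto simp: W'_def dist_norm)
    moreover have "Re (1 - \<theta> h) \<le> cmod (1 - \<theta> h)" by (rule complex_Re_le_cmod)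
    ultimately show False by simp
  qed
  have exp\<alpha>: "\<theta> h = exp (\<i> * of_real (\<alpha> h))" for h
  proof -
    have "\<theta> h \<noteq> 0" using norm[of h] by auto
    then show ?thesis using Arg_eq[of "\<theta> h"] norm[of h] by (simp add: \<alpha>_def)
  qed
  have "continuous_on V \<alpha>"
    unfolding \<alpha>_def
  proof (rule continuous_on_compose2[of "- \<real>\<^sub>\<le>\<^sub>0" Arg V \<theta>])
    show "continuous_on (- \<real>\<^sub>\<le>\<^sub>0) Arg"
      by (intro continuous_at_imp_continuous_on ballI continuous_at_Arg) simp
    show "continuous_on V \<theta>" using cont continuous_on_subset by blast
  qed (use nonneg in auto)
  then have conn: "connected (\<alpha> ` V)" using V(2) connected_continuous_image by blast
  have \<alpha>1: "0 \<in> \<alpha> ` V" using V(3) one by (intro image_eqI[of _ _ \<one>]) (auto simp: \<alpha>_def)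
  define a0 where "a0 = \<alpha> h0"
  have a0: "a0 \<in> \<alpha> ` V" "a0 \<noteq> 0"
    using h0 exp\<alpha>[of h0] by (auto simp: a0_def)
  define N where "N = Suc (nat \<lceil>pi / \<bar>a0\<bar>\<rceil>)"
  have "\<exists>h\<in>W. \<theta> h ^ n = -1" if n: "n \<ge> N" for n
  proof -
    have n0: "real n > 0" "pi / \<bar>a0\<bar> \<le> real n" using n by (auto simp: N_def) linarith
    then have small: "pi / real n \<le> \<bar>a0\<bar>" using a0(2) by (simp add: field_simps)
    define t where "t = sgn a0 * (pi / real n)"
    have "t \<in> \<alpha> ` V"
    proof (cases "a0 > 0")
      case True
      then have "0 \<le> t" "t \<le> a0" using small by (auto simp: t_def)
      then show ?thesis using connectedD_interval[OF conn \<alpha>1 a0(1)] by blast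
    next
      case False
      then have "a0 \<le> t" "t \<le> 0" using small a0(2) by (auto simp: t_def sgn_if)
      then show ?thesis using connectedD_interval[OF conn a0(1) \<alpha>1] by blast
    qed
    then obtain h where h: "h \<in> V" "\<alpha> h = t" by auto
    have "\<theta> h ^ n = exp (of_nat n * (\<i> * of_real t))"
      using exp\<alpha>[of h] h(2) by (simp add: exp_of_nat_mult)
    also have "of_nat n * (\<i> * of_real t) = \<i> * of_real (sgn a0 * pi)"
      using n0(1) by (simp add: t_def)
    also have "exp (\<i> * of_real (sgn a0 * pi)) = -1"
      using a0(2) by (auto simp: sgn_if exp_minus)
    finally show ?thesis using h(1) V(4) by (auto simp: W'_def)
  qed
  then show ?thesis by blast
qed

lemma act_u_cont: "continuous_on UNIV (act u ^^ n)"
proof (induction n)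
  case (Suc n)
  then show ?case using continuous_on_compose[OF Suc continuous_on_subset[OF act_cont]] by simp
qed (simp add: id_def)

lemma act_G1_funpow: "z \<in> G1 \<Longrightarrow> (act u ^^ n) (act z x) = act z ((act u ^^ n) x)"
  by (induction n) (simp_all add: act_G1_commute)

lemma integral_funpow:
  assumes "ccont f"
  shows "(\<integral>x. f ((act u ^^ n) x) \<partial>m) = (\<integral>x. f x \<partial>m)"
proof (induction n)
  case (Suc n)
  have c: "ccont (\<lambda>x. f ((act u ^^ n) x))"
    by (rule continuous_on_compose2[OF assms act_u_cont]) auto
  have "(\<integral>x. f ((act u ^^ Suc n) x) \<partial>m) = (\<integral>x. f ((act u ^^ n) (act u x)) \<partial>m)"
    by (simp add: funpow_swap1)
  also have "\<dots> = (\<integral>x. f ((act u ^^ n) x) \<partial>m)" by (rule integral_act[OF c])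
  finally show ?case using Suc by simp
qed simp

section \<open>The vertical character of an eigenfunction\<close>

context
  fixes e :: "'x \<Rightarrow> complex" and x1 :: 'x
  assumes eig: "eigenfunction e" and nz: "e x1 \<noteq> 0"
begin

text \<open>The character is read off at a point where \<open>e\<close> does not vanish. For
  \<open>z\<close> in \<open>G1\<close> the quotient is the same at every such point, by
  \<open>e_act\<close>.\<close>

definition chi :: "'g \<Rightarrow> complex" where "chi z = e (act z x1) / e x1"

lemma e_cont: "ccont e"
  using eig unfolding eigenfunction_def by blast

lemma e_act:
  assumes "z \<in> G1"
  shows "e (act z x) = chi z * e x"
proof -
  obtain c where c: "\<And>x. e (act z x) = c * e x"
    using eig assms unfolding eigenfunction_def by blast
  then have "chi z = c" using nz by (simp add: chi_def)
  with c show ?thesis by simp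
qed

lemma chi_mult:
  assumes "z \<in> G1" "w \<in> G1"
  shows "chi (z \<otimes> w) = chi z * chi w"
proof -
  have "chi (z \<otimes> w) * e x1 = chi z * chi w * e x1"
    using e_act[OF G1_mult[OF assms], of x1] e_act[OF assms(1), of "act w x1"] e_act[OF assms(2), of x1]
    by (simp add: act_act)
  then show ?thesis using nz by simp
qed

lemma chi_one: "chi \<one> = 1"
  using nz by (simp add: chi_def)

lemma chi_inv: "z \<in> G1 \<Longrightarrow> chi (inv z) * chi z = 1"
  using chi_mult[of "inv z" z] G1_inv chi_one by simp

lemma chi_norm:
  assumes z: "z \<in> G1"
  shows "cmod (chi z) = 1"
proof -
  have "nsq (\<lambda>x. e (act z x)) = nsq e" using nsq_Z[OF _ e_cont] z by blast
  then have "(cmod (chi z))\<^sup>2 * nsq e = nsq e" unfolding e_act[OF z] nsq_scale .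
  moreover have "nsq e > 0" using nsq_pos[OF e_cont] nz by auto
  ultimately have "(cmod (chi z))\<^sup>2 = 1" by simp
  then show ?thesis by (simp add: power2_eq_1_iff) (use norm_ge_zero[of "chi z"] in linarith)
qed

lemma chi_cont:
  assumes "continuous_on UNIV \<phi>"
  shows "continuous_on UNIV (\<lambda>a. chi (\<phi> a))"
proof -
  obtain g where g: "x1 = q g" by (rule q_surj)
  have "continuous_on UNIV (\<lambda>a. e (q (\<phi> a \<otimes> g)))"
    using assms by (intro continuous_on_compose2[OF e_cont continuous_q[OF continuous_mult]])
      (auto intro!: continuous_intros)
  moreover have "act a x1 = q (a \<otimes> g)" for a using g by simp
  ultimately show ?thesis
    unfolding chi_def using nz by (simp add: continuous_on_divide)
qed

text \<open>A central element of \<Gamma> can be moved to the right of any representative, so it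
  fixes every point.\<close>

lemma chi_\<Gamma>:
  assumes "z \<in> G1" "z \<in> \<Gamma>"
  shows "chi z = 1"
proof -
  obtain g where g: "x1 = q g" by (rule q_surj)
  have "q (z \<otimes> g) = q (g \<otimes> z)" using G1_central[OF assms(1)] by simp
  also have "\<dots> = q g" using assms(2) subgroup.m_inv_closed[OF sub]
    by (subst q_eq_iff) (simp add: inv_mult_group m_assoc)
  finally have "act z x1 = x1" using g by simp
  then show ?thesis using nz by (simp add: chi_def)
qed

lemma chi_comm_mult: "chi (comm (a \<otimes> b) h) = chi (comm a h) * chi (comm b h)"
  unfolding comm_mult_left by (rule chi_mult[OF comm_G1 comm_G1])

lemma chi_comm_swap: "chi (comm a b) * chi (comm b a) = 1"
  using chi_inv[OF comm_G1[of b a]] comm_inv[of a b] by simp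

lemma comm_one: "comm \<one> h = \<one>"
  by (simp add: comm_def)

text \<open>Transitivity is used twice, because the homomorphism in the first argument of
  \<open>comm\<close> is trivial on \<Gamma> for an arbitrary second argument only once this is
  known for second arguments in \<Gamma>, where the commutators lie in \<Gamma> themselves.\<close>

lemma chi_trivial:
  assumes u: "\<And>h. chi (comm u h) = 1" and z: "z \<in> G1"
  shows "chi z = 1"
proof -
  have 1: "chi (comm g \<gamma>') = 1" if \<gamma>': "\<gamma>' \<in> \<Gamma>" for g \<gamma>'
  proof (rule homomorphism_trivial[where \<beta> = "\<lambda>g. chi (comm g \<gamma>')"])
    show "continuous_on UNIV (\<lambda>g. chi (comm g \<gamma>'))"
      by (intro chi_cont comm_cont continuous_intros)
    show "chi (comm \<gamma> \<gamma>') = 1" if "\<gamma> \<in> \<Gamma>" for \<gamma>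
      using that \<gamma>' by (intro chi_\<Gamma> comm_G1)
        (auto simp: comm_def intro!: subgroup.m_closed[OF sub] subgroup.m_inv_closed[OF sub])
  qed (simp_all add: chi_comm_mult comm_one chi_one u)
  \<comment> \<open>Triviality on \<Gamma> follows from \<open>1\<close> by antisymmetry of the
    commutator.\<close>
  have 2: "chi (comm g h) = 1" for g h
  proof (rule homomorphism_trivial[where \<beta> = "\<lambda>g. chi (comm g h)"])
    show "continuous_on UNIV (\<lambda>g. chi (comm g h))"
      by (intro chi_cont comm_cont continuous_intros)
    show "chi (comm \<gamma> h) = 1" if "\<gamma> \<in> \<Gamma>" for \<gamma>
      using chi_comm_swap[of \<gamma> h] 1[OF that, of h] by simp
  qed (simp_all add: chi_comm_mult comm_one chi_one u)
  let ?H = "{x \<otimes> y \<otimes> inv x \<otimes> inv y | x y. x \<in> carrier G \<and> y \<in> lower_central G 0}"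
  have H: "G1 = generate G ?H" by simp
  have "z \<in> generate G ?H" using z H by simp
  then show ?thesis
  proof (induction rule: generate.induct)
    case one
    show ?case by (rule chi_one)
  next
    case (incl h)
    then obtain x y where "h = comm x y" by (auto simp: comm_def)
    then show ?case using 2 by simp
  next
    case (inv h)
    then obtain x y where "h = comm x y" by (auto simp: comm_def)
    then have "inv h = comm y x" using comm_inv[of y x] by simp
    then show ?case using 2 by simp
  next
    case (eng h1 h2)
    then have "h1 \<in> G1" "h2 \<in> G1" using H by simp_all
    then show ?case using eng by (simp add: chi_mult)
  qed
qed

text \<open>Moving \<open>h\<close> to the left past each of the \<open>n\<close> factors
  \<open>u\<close> costs one central factor \<open>comm u h\<close>.\<close>

lemma e_funpow_act:
  "e ((act u ^^ n) (act h x)) = chi (comm u h) ^ n * e (act h ((act u ^^ n) x))"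
proof (induction n arbitrary: x)
  case (Suc n)
  have "e ((act u ^^ Suc n) (act h x)) = e ((act u ^^ n) (act (comm u h) (act h (act u x))))"
    by (simp add: funpow_swap1 act_swap[of u h])
  also have "\<dots> = chi (comm u h) * e ((act u ^^ n) (act h (act u x)))"
    by (simp add: act_G1_funpow[OF comm_G1] e_act[OF comm_G1])
  also have "\<dots> = chi (comm u h) ^ Suc n * e (act h ((act u ^^ Suc n) x))"
    unfolding Suc by (simp add: funpow_swap1)
  finally show ?case .
qed simp

lemma e_funpow_cont: "ccont (\<lambda>x. e ((act u ^^ n) x))"
  by (rule continuous_on_compose2[OF e_cont act_u_cont]) auto

lemma correlations_tend_to_zero:
  assumes z: "z \<in> G1" "chi z \<noteq> 1"
  shows "(\<lambda>n. ip (\<lambda>x. e ((act u ^^ n) x)) e) \<longlonglongrightarrow> 0"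
proof (rule LIMSEQ_I)
  fix r :: real assume r: "r > 0"
  obtain B where B: "B > 0" "\<And>x. cmod (e x) \<le> B"
    using continuous_on_UNIV_bounded[OF compact_X e_cont] by blast
  \<comment> \<open>With h chosen so that the factor is -1, the substitution gives J = -J', where
    \<open>J'\<close> has both occurrences of \<open>e\<close> shifted by h. As J' and J differ by
    at most 2 * B * d = r, it follows that 2 * |J| is at most r.\<close>
  define d where "d = r / (2 * B)"
  have d: "d > 0" using r B by (simp add: d_def)
  obtain W where W: "open W" "\<one> \<in> W" "\<And>a y. a \<in> W \<Longrightarrow> norm (e (act a y) - e y) \<le> d"
    using small_translations[OF e_cont d] by blast
  obtain h1 where h1: "chi (comm u h1) \<noteq> 1" using chi_trivial[OF _ z(1)] z(2) by blast
  have "\<exists>N. \<forall>n\<ge>N. \<exists>h\<in>W. chi (comm u h) ^ n = -1"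
  proof (rule homomorphism_roots_of_minus_one[where \<theta> = "\<lambda>h. chi (comm u h)", OF _ _ _ _ h1 W(1,2)])
    show "continuous_on UNIV (\<lambda>h. chi (comm u h))" by (intro chi_cont comm_cont continuous_intros)
    show "chi (comm u (a \<otimes> b)) = chi (comm u a) * chi (comm u b)" for a b
    proof -
      have "chi (comm (a \<otimes> b) u) * chi (comm u (a \<otimes> b)) = 1" by (rule chi_comm_swap)
      moreover have "chi (comm (a \<otimes> b) u) * (chi (comm u a) * chi (comm u b)) = 1"
        unfolding chi_comm_mult using chi_comm_swap[of a u] chi_comm_swap[of b u]
        by (metis mult.assoc mult.left_commute mult.right_neutral)
      ultimately show ?thesis by (metis mult.left_neutral mult.assoc mult.commute)
    qed
    show "chi (comm u \<one>) = 1" using comm_inv[of u \<one>] by (simp add: comm_one chi_one)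
    show "cmod (chi (comm u a)) = 1" for a by (rule chi_norm[OF comm_G1])
  qed
  then obtain N where N: "\<And>n. n \<ge> N \<Longrightarrow> \<exists>h\<in>W. chi (comm u h) ^ n = -1" by blast
  have "norm (ip (\<lambda>x. e ((act u ^^ n) x)) e - 0) < r" if n: "n \<ge> N" for n
  proof -
    obtain h where h: "h \<in> W" "chi (comm u h) ^ n = -1" using N[OF n] by blast
    let ?E = "\<lambda>x. e ((act u ^^ n) x)"
    define J where "J = ip ?E e"
    define J' where "J' = (\<integral>x. e (act h ((act u ^^ n) x)) * cnj (e (act h x)) \<partial>m)"
    have Eh: "ccont (\<lambda>x. e (act h ((act u ^^ n) x)))"
      by (rule continuous_on_compose2[OF continuous_act[OF e_cont] act_u_cont]) auto
    have "J = (\<integral>x. ?E (act h x) * cnj (e (act h x)) \<partial>m)"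
      unfolding J_def ip_def
      by (rule integral_act[symmetric, of "\<lambda>x. ?E x * cnj (e x)"])
        (intro continuous_on_mult continuous_on_cnj e_funpow_cont e_cont)
    also have "\<dots> = (\<integral>x. - (e (act h ((act u ^^ n) x)) * cnj (e (act h x))) \<partial>m)"
      unfolding e_funpow_act h(2) by simp
    also have "\<dots> = - J'" unfolding J'_def by simp
    finally have JJ: "J = - J'" .
    have "cmod (J' - J) \<le> 2 * B * d"
      unfolding J'_def J_def ip_def
    proof (rule integral_diff_norm_le)
      show "complex_integrable m (\<lambda>x. e (act h ((act u ^^ n) x)) * cnj (e (act h x)))"
        by (intro integrable_continuous continuous_on_mult continuous_on_cnj Eh continuous_act e_cont)
      show "complex_integrable m (\<lambda>x. ?E x * cnj (e x))"
        by (rule ip_integrable[OF e_funpow_cont e_cont])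
      fix x
      define y where "y = (act u ^^ n) x"
      have "e (act h y) * cnj (e (act h x)) - e y * cnj (e x)
          = (e (act h y) - e y) * cnj (e (act h x)) + e y * cnj (e (act h x) - e x)"
        by (simp add: algebra_simps)
      then have "cmod (e (act h y) * cnj (e (act h x)) - e y * cnj (e x))
          \<le> cmod (e (act h y) - e y) * cmod (e (act h x)) + cmod (e y) * cmod (e (act h x) - e x)"
        using norm_triangle_ineq[of "(e (act h y) - e y) * cnj (e (act h x))" "e y * cnj (e (act h x) - e x)"]
        by (simp add: norm_mult del: complex_cnj_diff)
      also have "\<dots> \<le> d * B + B * d"
        using W(3)[OF h(1)] B d by (intro add_mono mult_mono) auto
      finally show "cmod (e (act h ((act u ^^ n) x)) * cnj (e (act h x)) - ?E x * cnj (e x)) \<le> 2 * B * d"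
        by (simp add: y_def mult_ac)
    qed
    then have "2 * cmod J \<le> r"
      using JJ B by (simp add: d_def norm_minus_commute)
    then show ?thesis using r by (simp add: J_def)
  qed
  then show "\<exists>N. \<forall>n\<ge>N. norm (ip (\<lambda>x. e ((act u ^^ n) x)) e - 0) < r" by blast
qed

lemma ip_funpow:
  assumes "i \<ge> j"
  shows "ip (\<lambda>x. e ((act u ^^ i) x)) (\<lambda>x. e ((act u ^^ j) x)) = ip (\<lambda>x. e ((act u ^^ (i - j)) x)) e"
proof -
  have "(act u ^^ i) x = (act u ^^ (i - j)) ((act u ^^ j) x)" for x
    using assms by (simp add: funpow_add[symmetric] flip: comp_apply[of "act u ^^ (i - j)" "act u ^^ j"])
  then have "ip (\<lambda>x. e ((act u ^^ i) x)) (\<lambda>x. e ((act u ^^ j) x))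
    = (\<integral>x. (\<lambda>y. e ((act u ^^ (i - j)) y) * cnj (e y)) ((act u ^^ j) x) \<partial>m)"
    by (simp add: ip_def)
  also have "\<dots> = (\<integral>y. e ((act u ^^ (i - j)) y) * cnj (e y) \<partial>m)"
    by (rule integral_funpow) (intro continuous_on_mult continuous_on_cnj e_funpow_cont e_cont)
  finally show ?thesis by (simp add: ip_def)
qed

end

end

subsection \<open>Convergence of push-forwards\<close>

context nilsystem
begin

context
  fixes \<mu> :: "'x measure"
  assumes mu: "compact_prob_space \<mu>"
    and mu_inv: "\<And>f a. ccont f \<Longrightarrow> (\<And>z x. z \<in> G1 \<Longrightarrow> f (act z x) = f x) \<Longrightarrow>
      (\<integral>x. f (act a x) \<partial>\<mu>) = (\<integral>x. f x \<partial>\<mu>)"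
begin

interpretation \<mu>: compact_prob_space \<mu> by (rule mu)

text \<open>The hypothesis on the projection of \<mu> enters as translation invariance of the
  integrals of functions that factor through the torus. Uniqueness of Haar measure then
  applies.\<close>

lemma mu_eq_haar:
  assumes "ccont f" "\<And>z x. z \<in> G1 \<Longrightarrow> f (act z x) = f x"
  shows "(\<integral>x. f x \<partial>\<mu>) = (\<integral>x. f x \<partial>m)"
  using G1_invariant_integral_eq[OF mu assms mu_inv[OF assms]] .

text \<open>On functions with a given vertical character \<open>\<mu>\<close> acts as a functional bounded in \<open>L\<^sup>2(m)\<close>,
  because the absolute value of such a function factors through the torus.\<close>

lemma functional_bound:
  assumes v: "ccont v" and c: "\<And>z. z \<in> G1 \<Longrightarrow> \<exists>c. cmod c = 1 \<and> (\<forall>x. v (act z x) = c * v x)"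
  shows "(cmod (\<integral>x. v x \<partial>\<mu>))\<^sup>2 \<le> nsq v"
proof -
  have "(\<integral>x. complex_of_real (cmod (v x)) \<partial>\<mu>) = (\<integral>x. complex_of_real (cmod (v x)) \<partial>m)"
  proof (rule mu_eq_haar)
    show "ccont (\<lambda>x. complex_of_real (cmod (v x)))" using v by (intro continuous_intros)
    show "complex_of_real (cmod (v (act z x))) = complex_of_real (cmod (v x))" if "z \<in> G1" for z x
      using c[OF that] by (auto simp: norm_mult)
  qed
  then have eq: "(\<integral>x. cmod (v x) \<partial>\<mu>) = (\<integral>x. cmod (v x) \<partial>m)"
    unfolding integral_complex_of_real of_real_eq_iff .
  have "cmod (\<integral>x. v x \<partial>\<mu>) \<le> (\<integral>x. cmod (v x) \<partial>\<mu>)" by (rule integral_norm_bound)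
  then have "(cmod (\<integral>x. v x \<partial>\<mu>))\<^sup>2 \<le> (\<integral>x. cmod (v x) \<partial>m)\<^sup>2"
    unfolding eq by (intro power_mono) auto
  also have "\<dots> \<le> nsq v"
    unfolding nsq_def using v by (intro integral_square_le continuous_intros)
  finally show ?thesis .
qed

text \<open>The translates of \<open>e\<close> are asymptotically orthogonal, so a bounded functional tends to zero
  along them.\<close>

lemma nontrivial_character_limit:
  assumes eig: "eigenfunction e" and nz: "e x1 \<noteq> 0" and z: "z \<in> G1" "chi e x1 z \<noteq> 1"
  shows "(\<lambda>n. \<integral>x. e ((act u ^^ n) x) \<partial>\<mu>) \<longlonglongrightarrow> 0"
proof (rule ccontr)
  define a where "a n = (\<integral>x. e ((act u ^^ n) x) \<partial>\<mu>)" for n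
  define E where "E n = (\<lambda>x. e ((act u ^^ n) x))" for n
  define J where "J n = ip (E n) e" for n
  have Ec: "ccont (E n)" for n unfolding E_def by (rule e_funpow_cont[OF eig nz])
  assume "\<not> (\<lambda>n. \<integral>x. e ((act u ^^ n) x) \<partial>\<mu>) \<longlonglongrightarrow> 0"
  then have "\<not> a \<longlonglongrightarrow> 0" by (simp add: a_def[abs_def])
  then obtain c where c: "c > 0" "\<And>N. \<exists>n\<ge>N. cmod (a n) \<ge> c"
    unfolding LIMSEQ_iff by (auto simp: not_less)
  have Jlim: "J \<longlonglongrightarrow> 0"
    unfolding J_def E_def by (rule correlations_tend_to_zero[OF eig nz z])
  \<comment> \<open>With this bound the off-diagonal terms contribute at most a quarter of the
    square of K * c, which the lower bound can absorb.\<close>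
  have c4: "c\<^sup>2 / 4 > 0" using c(1) by simp
  obtain M where M: "\<And>n. n \<ge> M \<Longrightarrow> cmod (J n) < c\<^sup>2 / 4"
    using LIMSEQ_D[OF Jlim c4] unfolding diff_0_right by blast
  \<comment> \<open>Consecutive gaps of at least \<open>M\<close> make all pairwise differences at
    least \<open>M\<close>.\<close>
  have "\<exists>s::nat \<Rightarrow> nat. \<forall>k. cmod (a (s k)) \<ge> c \<and> s k + M \<le> s (Suc k)"
    by (rule dependent_nat_choice) (use c(2) in blast)+
  then obtain s where s: "\<And>k. cmod (a (s k)) \<ge> c" "\<And>k. s k + M \<le> s (Suc k)" by blast
  have mono: "s k \<le> s (k + d)" for k d
  proof (induction d)
    case (Suc d)
    then show ?case using s(2)[of "k + d"] by simp
  qed simp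
  have gap: "s l + M \<le> s k" if "l < k" for l k
    using mono[of "Suc l" "k - Suc l"] s(2)[of l] that by simp
  \<comment> \<open>The comparison at the end gives (3/4) * K * c^2 \<le> nsq e, which this size of
    \<open>K\<close> rules out.\<close>
  obtain K :: nat where K: "real K > 2 * nsq e / c\<^sup>2" using reals_Archimedean2 by blast
  have K0: "real K > 0" using K nsq_nonneg[of e] c(1) by (smt (verit) divide_nonneg_nonneg zero_le_power2)
  \<comment> \<open>These phases make every term of the integral of \<open>v\<close> positive, so
    the terms cannot cancel.\<close>
  define \<omega> where "\<omega> k = cnj (sgn (a (s k)))" for k
  have a0: "a (s k) \<noteq> 0" for k using s(1)[of k] c(1) by auto
  have \<omega>: "cmod (\<omega> k) = 1" "\<omega> k * a (s k) = of_real (cmod (a (s k)))" for k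
  proof -
    show "cmod (\<omega> k) = 1" using a0[of k] by (simp add: \<omega>_def norm_sgn)
    have "\<omega> k * a (s k) = (a (s k) * cnj (a (s k))) / of_real (cmod (a (s k)))"
      by (simp add: \<omega>_def sgn_eq)
    also have "\<dots> = of_real (cmod (a (s k)))"
      using a0[of k] unfolding complex_norm_square[symmetric] by (simp add: power2_eq_square)
    finally show "\<omega> k * a (s k) = of_real (cmod (a (s k)))" .
  qed
  define v where "v = (\<lambda>x. \<Sum>k<K. \<omega> k * E (s k) x)"
  have vk: "ccont (\<lambda>x. \<omega> k * E (s k) x)" for k by (rule continuous_on_mult_left[OF Ec])
  have vc: "ccont v" unfolding v_def using vk by (intro continuous_on_sum) auto
  have "(\<integral>x. v x \<partial>\<mu>) = (\<Sum>k<K. \<omega> k * a (s k))"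
    unfolding v_def using \<mu>.integrable_continuous[OF Ec]
    by (simp add: Bochner_Integration.integral_sum) (simp add: a_def E_def)
  also have "\<dots> = of_real (\<Sum>k<K. cmod (a (s k)))" by (simp add: \<omega>)
  finally have iv: "cmod (\<integral>x. v x \<partial>\<mu>) = \<bar>\<Sum>k<K. cmod (a (s k))\<bar>"
    by (simp del: of_real_sum)
  have "real K * c \<le> (\<Sum>k<K. cmod (a (s k)))"
    using sum_mono[of "{..<K}" "\<lambda>_. c" "\<lambda>k. cmod (a (s k))"] s(1) by simp
  then have "(real K * c)\<^sup>2 \<le> (cmod (\<integral>x. v x \<partial>\<mu>))\<^sup>2"
    unfolding iv using c(1) by (intro power_mono) auto
  also have "\<dots> \<le> nsq v"
  proof (rule functional_bound[OF vc])
    fix w assume w: "w \<in> G1"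
    \<comment> \<open>All translates of \<open>e\<close> have the same character as
      \<open>e\<close>, since T commutes with the central action; so the functional bound applies to
      their combination \<open>v\<close>.\<close>
    have "v (act w x) = chi e x1 w * v x" for x
      unfolding v_def E_def
      by (simp add: act_G1_funpow[OF w] e_act[OF eig nz w] sum_distrib_left mult.left_commute)
    then show "\<exists>c. cmod c = 1 \<and> (\<forall>x. v (act w x) = c * v x)"
      using chi_norm[OF eig nz w] by blast
  qed
  also have "nsq v \<le> real K * nsq e + (real K)\<^sup>2 * (c\<^sup>2 / 4)"
  proof -
    have ipE: "cmod (ip (E (s k)) (E (s l))) \<le> (if k = l then nsq e else 0) + c\<^sup>2 / 4" for k l
    proof -
      have gt: "cmod (ip (E (s k)) (E (s l))) \<le> c\<^sup>2 / 4" if "l < k" for k l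
      proof -
        have "s l \<le> s k" "M \<le> s k - s l" using gap[OF that] by auto
        then have "cmod (J (s k - s l)) < c\<^sup>2 / 4" "ip (E (s k)) (E (s l)) = J (s k - s l)"
          using M ip_funpow[OF eig nz] unfolding E_def J_def by blast+
        then show ?thesis by (simp only: less_imp_le)
      qed
      consider "k = l" | "l < k" | "k < l" by linarith
      then show ?thesis
      proof cases
        case 1
        have "ip (E (s k)) (E (s k)) = of_real (nsq e)"
          using ip_funpow[OF eig nz, of "s k" "s k"] by (simp add: E_def ip_self)
        then show ?thesis using 1 by simp
      next
        case 2
        then show ?thesis using gt by simp
      next
        case 3
        then show ?thesis using gt[OF 3] ip_cnj[of "E (s k)" "E (s l)"] by simp
      qed
    qed
    have ipv: "ip v h = (\<Sum>k<K. \<omega> k * ip (E (s k)) h)" if "ccont h" for h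
      unfolding v_def using ip_sum[OF finite_lessThan vk that] by (simp add: ip_scale)
    have "cmod (ip (E (s k)) v) \<le> nsq e + real K * (c\<^sup>2 / 4)" if k: "k < K" for k
    proof -
      have "cmod (ip (E (s k)) v) = cmod (ip v (E (s k)))" using ip_cnj[of "E (s k)" v] by simp
      also have "\<dots> \<le> (\<Sum>l<K. cmod (\<omega> l * ip (E (s l)) (E (s k))))"
        unfolding ipv[OF Ec] by (rule norm_sum)
      also have "\<dots> \<le> (\<Sum>l<K. (if l = k then nsq e else 0) + c\<^sup>2 / 4)"
        using ipE by (intro sum_mono) (simp add: norm_mult \<omega>)
      also have "\<dots> = nsq e + real K * (c\<^sup>2 / 4)" using k by (simp add: sum.distrib)
      finally show ?thesis .
    qed
    then have "(\<Sum>k<K. cmod (\<omega> k * ip (E (s k)) v)) \<le> (\<Sum>k<K. nsq e + real K * (c\<^sup>2 / 4))"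
      by (intro sum_mono) (simp add: norm_mult \<omega>)
    moreover have "nsq v \<le> (\<Sum>k<K. cmod (\<omega> k * ip (E (s k)) v))"
      using norm_sum[of "\<lambda>k. \<omega> k * ip (E (s k)) v" "{..<K}"] ipv[OF vc] ip_self[of v]
      by (metis abs_of_nonneg norm_of_real nsq_nonneg)
    ultimately show ?thesis by (simp add: power2_eq_square algebra_simps)
  qed
  finally have "(real K)\<^sup>2 * c\<^sup>2 \<le> real K * nsq e + (real K)\<^sup>2 * (c\<^sup>2 / 4)"
    by (simp add: power_mult_distrib)
  then have "real K * (real K * c\<^sup>2 * (3 / 4)) \<le> real K * nsq e"
    by (simp add: power2_eq_square algebra_simps)
  then have "real K * c\<^sup>2 * (3 / 4) \<le> nsq e" using K0 by simp
  moreover have "2 * nsq e < real K * c\<^sup>2" using K c(1) by (simp add: field_simps)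
  ultimately show False using nsq_nonneg[of e] by linarith
qed

lemma eigenfunction_limit:
  assumes eig: "eigenfunction e"
  shows "(\<lambda>n. \<integral>x. e ((act u ^^ n) x) \<partial>\<mu>) \<longlonglongrightarrow> (\<integral>x. e x \<partial>m)"
proof (cases "\<forall>z\<in>G1. \<forall>x. e (act z x) = e x")
  case True
  have ec: "ccont e" using eig unfolding eigenfunction_def by blast
  have "(\<integral>x. e ((act u ^^ n) x) \<partial>\<mu>) = (\<integral>x. e x \<partial>m)" for n
  proof -
    have "ccont (\<lambda>x. e ((act u ^^ n) x))"
      by (rule continuous_on_compose2[OF ec act_u_cont]) auto
    then have "(\<integral>x. e ((act u ^^ n) x) \<partial>\<mu>) = (\<integral>x. e ((act u ^^ n) x) \<partial>m)"
      by (rule mu_eq_haar) (use True in \<open>simp only: act_G1_funpow\<close>)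
    then show ?thesis using integral_funpow[OF ec] by simp
  qed
  then show ?thesis by simp
next
  case False
  then obtain z x1 where zx: "z \<in> G1" "e (act z x1) \<noteq> e x1" by blast
  have nz: "e x1 \<noteq> 0"
  proof
    assume "e x1 = 0"
    moreover obtain c where "\<And>x. e (act z x) = c * e x"
      using eig zx(1) unfolding eigenfunction_def by blast
    ultimately show False using zx(2) by simp
  qed
  have ne: "chi e x1 z \<noteq> 1" using e_act[OF eig nz zx(1), of x1] zx(2) by auto
  \<comment> \<open>Invariance of \<open>m\<close> under \<open>z\<close> multiplies this integral
    by a factor different from 1, so it vanishes.\<close>
  have "(\<integral>x. e x \<partial>m) = (\<integral>x. e (act z x) \<partial>m)"
    by (rule integral_act[OF e_cont[OF eig nz], symmetric])
  also have "\<dots> = chi e x1 z * (\<integral>x. e x \<partial>m)"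
    unfolding e_act[OF eig nz zx(1)] by simp
  finally have "(\<integral>x. e x \<partial>m) = 0" using ne by simp
  then show ?thesis using nontrivial_character_limit[OF eig nz zx(1) ne] by simp
qed

text \<open>A uniform approximation of \<open>f\<close> stays as good after composition with any
  T^n, so one element of \<open>eigenspan\<close> serves for all n. The three errors are each at
  most r / 4.\<close>

theorem nilsystem_weak_limit:
  fixes f :: "'x \<Rightarrow> real"
  assumes f: "continuous_on UNIV f"
  shows "(\<lambda>n. \<integral>x. f ((act u ^^ n) x) \<partial>\<mu>) \<longlonglongrightarrow> (\<integral>x. f x \<partial>m)"
proof -
  have comp: "continuous_on UNIV (\<lambda>x. h ((act u ^^ n) x))" if "continuous_on UNIV h"
    for h :: "'x \<Rightarrow> 'b::topological_space" and n
    by (rule continuous_on_compose2[OF that act_u_cont]) auto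
  have lim: "(\<lambda>n. \<integral>x. s ((act u ^^ n) x) \<partial>\<mu>) \<longlonglongrightarrow> (\<integral>x. s x \<partial>m)" if "s \<in> eigenspan" for s
    using that
  proof (induction rule: eigenspan.induct)
    case (base e)
    then show ?case by (rule eigenfunction_limit)
  next
    case (add s t)
    then have c: "ccont s" "ccont t" using eigenspan_cont by auto
    have "(\<integral>x. s ((act u ^^ n) x) + t ((act u ^^ n) x) \<partial>\<mu>)
        = (\<integral>x. s ((act u ^^ n) x) \<partial>\<mu>) + (\<integral>x. t ((act u ^^ n) x) \<partial>\<mu>)" for n
      using \<mu>.integrable_continuous[OF comp[OF c(1)]] \<mu>.integrable_continuous[OF comp[OF c(2)]]
      by (rule Bochner_Integration.integral_add)
    moreover have "(\<integral>x. s x + t x \<partial>m) = (\<integral>x. s x \<partial>m) + (\<integral>x. t x \<partial>m)"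
      using integrable_continuous[OF c(1)] integrable_continuous[OF c(2)]
      by (rule Bochner_Integration.integral_add)
    ultimately show ?case using tendsto_add[OF add.IH] by simp
  qed
  show ?thesis
  proof (rule LIMSEQ_I)
    fix r :: real assume r: "r > 0"
    then have "r / 4 > 0" by simp
    then obtain s where s: "s \<in> eigenspan" "\<And>x. \<bar>f x - Re (s x)\<bar> < r / 4"
      using eigenspan_dense[OF f] by blast
    have sc: "ccont s" by (rule eigenspan_cont[OF s(1)])
    have Rc: "continuous_on UNIV (\<lambda>x. Re (s x))" using sc by (intro continuous_intros)
    have "(\<lambda>n. Re (\<integral>x. s ((act u ^^ n) x) \<partial>\<mu>)) \<longlonglongrightarrow> Re (\<integral>x. s x \<partial>m)"
      by (rule tendsto_Re[OF lim[OF s(1)]])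
    moreover have "Re (\<integral>x. s ((act u ^^ n) x) \<partial>\<mu>) = (\<integral>x. Re (s ((act u ^^ n) x)) \<partial>\<mu>)" for n
      using \<mu>.integrable_continuous[OF comp[OF sc]] by simp
    moreover have "Re (\<integral>x. s x \<partial>m) = (\<integral>x. Re (s x) \<partial>m)"
      using integrable_continuous[OF sc] by simp
    ultimately have "(\<lambda>n. \<integral>x. Re (s ((act u ^^ n) x)) \<partial>\<mu>) \<longlonglongrightarrow> (\<integral>x. Re (s x) \<partial>m)" by simp
    moreover have "r / 4 > 0" using r by simp
    ultimately obtain N where N: "\<And>n. n \<ge> N \<Longrightarrow>
        norm ((\<integral>x. Re (s ((act u ^^ n) x)) \<partial>\<mu>) - (\<integral>x. Re (s x) \<partial>m)) < r / 4"
      unfolding LIMSEQ_iff by blast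
    have "norm ((\<integral>x. f ((act u ^^ n) x) \<partial>\<mu>) - (\<integral>x. f x \<partial>m)) < r" if n: "n \<ge> N" for n
    proof -
      have "norm ((\<integral>x. f ((act u ^^ n) x) \<partial>\<mu>) - (\<integral>x. Re (s ((act u ^^ n) x)) \<partial>\<mu>)) \<le> r / 4"
        using s(2) by (intro \<mu>.integral_diff_norm_le \<mu>.integrable_continuous comp[OF f] comp[OF Rc])
          (simp add: less_imp_le)
      moreover have "norm ((\<integral>x. f x \<partial>m) - (\<integral>x. Re (s x) \<partial>m)) \<le> r / 4"
        using s(2) by (intro integral_diff_norm_le integrable_continuous f Rc) (simp add: less_imp_le)
      ultimately show ?thesis using N[OF n] unfolding real_norm_def by linarith
    qed
    then show "\<exists>N. \<forall>n\<ge>N. norm ((\<integral>x. f ((act u ^^ n) x) \<partial>\<mu>) - (\<integral>x. f x \<partial>m)) < r" by blast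
  qed
qed

end

end

section \<open>From the Lie group and its torus factor to the abstract nilsystem\<close>

lemma locally_euclidean_connected_nbhd:
  fixes x :: "'g::topological_space" and V0 :: "'e::euclidean_space set"
  assumes U0: "open U0" "x \<in> U0" "open V0" "U0 homeomorphic V0" and W: "open W" "x \<in> W"
  shows "\<exists>V. open V \<and> connected V \<and> x \<in> V \<and> V \<subseteq> W"
proof -
  obtain f g where fg: "homeomorphism U0 V0 f g" using U0(4) by (auto simp: homeomorphic_def)
  have f: "f ` U0 = V0" "continuous_on V0 g" "g ` V0 = U0" "\<And>y. y \<in> U0 \<Longrightarrow> g (f y) = y"
    "\<And>y. y \<in> V0 \<Longrightarrow> f (g y) = y" "continuous_on U0 f"
    using fg by (auto simp: homeomorphism_def)
  have "open (V0 \<inter> g -` W)"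
    using f(2) W(1) U0(3) continuous_on_open_vimage by (metis Int_commute)
  moreover have "f x \<in> V0 \<inter> g -` W" using f U0(2) W(2) by auto
  ultimately obtain r where r: "r > 0" "ball (f x) r \<subseteq> V0 \<inter> g -` W"
    using open_contains_ball by blast
  \<comment> \<open>A ball in the chart is connected, and its preimage is open because the chart
    domain is.\<close>
  define V where "V = U0 \<inter> f -` ball (f x) r"
  have "open V" unfolding V_def
    using f(6) U0(1) continuous_on_open_vimage by (metis Int_commute open_ball)
  moreover have V: "V = g ` ball (f x) r"
    unfolding V_def using r(2) f by (auto simp: image_iff) (metis IntD1 subsetD mem_ball)+
  then have "connected V"
    using connected_continuous_image[OF continuous_on_subset[OF f(2)], of "ball (f x) r"] r(2) by auto
  moreover have "x \<in> V" using U0(2) r(1) by (simp add: V_def)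
  moreover have "V \<subseteq> W" unfolding V using r(2) by auto
  ultimately show ?thesis by blast
qed

theorem theorem1p3:
  fixes G :: "('g::t2_space) monoid"
    and E :: "'e::euclidean_space itself"
    and \<Gamma> :: "'g set"
    and q :: "'g \<Rightarrow> 'x::t2_space"
    and q1 :: "'g \<Rightarrow> 'y::topological_space"
    and \<pi> :: "'x \<Rightarrow> 'y"
    and u :: 'g
    and T :: "'x \<Rightarrow> 'x"
    and m :: "'x measure" and m1 :: "'y measure" and \<mu> :: "'x measure"
    and f :: "'x \<Rightarrow> real"
  assumes lie: "lie_group G E"
    and conn: "connected (UNIV :: 'g set)"
    and two_step: "lower_central G 2 = {\<one>\<^bsub>G\<^esub>}"
    and sub: "subgroup \<Gamma> G"
    and discrete: "\<forall>\<gamma>\<in>\<Gamma>. \<exists>U. open U \<and> U \<inter> \<Gamma> = {\<gamma>}"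
    and X: "coset_quotient_map G \<Gamma> q"
    and cocompact: "compact (UNIV :: 'x set)"
    and X1: "coset_quotient_map G (lower_central G 1 <#>\<^bsub>G\<^esub> \<Gamma>) q1"
    and proj: "\<forall>g. \<pi> (q g) = q1 g"
    and haar: "haar_on_quotient G q m"
    and haar1: "haar_on_quotient G q1 m1"
    and T_def: "\<forall>g. T (q g) = q (u \<otimes>\<^bsub>G\<^esub> g)"
    and trans: "top_transitive T"
    and mu_sets: "sets \<mu> = sets borel" and mu_prob: "prob_space \<mu>"
    and mu_proj: "distr \<mu> borel \<pi> = m1"
    and f_cont: "continuous_on UNIV f"
  shows "(\<lambda>n. \<integral>x. f ((T ^^ n) x) \<partial>\<mu>) \<longlonglongrightarrow> (\<integral>x. f x \<partial>m)"
proof -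
  have tg: "group G" "carrier G = UNIV"
    "continuous_on UNIV (\<lambda>p::'g \<times> 'g. fst p \<otimes>\<^bsub>G\<^esub> snd p)" "continuous_on UNIV (\<lambda>x. inv\<^bsub>G\<^esub> x)"
    using lie unfolding lie_group_def topological_group_def by blast+
  interpret N: nilmanifold G \<Gamma> q m
    by (intro nilmanifold.intro nilmanifold_axioms.intro tg two_step sub X cocompact haar)
  have T: "T = N.act u"
  proof
    fix x
    obtain g where "x = q g" by (rule N.q_surj)
    then show "T x = N.act u x" using T_def by simp
  qed
  interpret N: nilsystem G \<Gamma> q m u
  proof unfold_locales
    show "connected (UNIV :: 'g set)" by (rule conn)
    show "top_transitive (N.act u)" using trans T by simp
    fix W :: "'g set" assume W: "open W" "\<one>\<^bsub>G\<^esub> \<in> W"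
    obtain U and V :: "'e set" where "open U" "\<one>\<^bsub>G\<^esub> \<in> U" "open V" "U homeomorphic V"
      using lie unfolding lie_group_def by blast
    then show "\<exists>V. open V \<and> connected V \<and> \<one>\<^bsub>G\<^esub> \<in> V \<and> V \<subseteq> W"
      using locally_euclidean_connected_nbhd W by blast
  qed
  have mu: "compact_prob_space \<mu>"
    by (intro compact_prob_space.intro cocompact mu_sets mu_prob)
  have q1: "surj q1" "\<And>S. open S \<longleftrightarrow> open (q1 -` S)"
    "\<And>g h. q1 g = q1 h \<longleftrightarrow> inv\<^bsub>G\<^esub> g \<otimes>\<^bsub>G\<^esub> h \<in> lower_central G 1 <#>\<^bsub>G\<^esub> \<Gamma>"
    using X1 unfolding coset_quotient_map_def by blast+
  define rep where "rep y = (SOME g. q1 g = y)" for y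
  have rep: "q1 (rep y) = y" for y
    unfolding rep_def by (rule someI_ex) (metis q1(1) surjD)
  have lift1: "continuous_on UNIV F" if "continuous_on UNIV (\<lambda>g. F (q1 g))"
    for F :: "'y \<Rightarrow> 'c::topological_space"
  proof -
    have "open (F -` B)" if B: "open B" for B
      using open_vimage[OF B \<open>continuous_on UNIV (\<lambda>g. F (q1 g))\<close>] q1(2)[of "F -` B"]
      by (simp add: vimage_comp o_def)
    then show ?thesis by (simp add: continuous_on_open_vimage)
  qed
  have q1_cont: "continuous_on UNIV q1"
    by (simp add: continuous_on_open_vimage q1(2)[symmetric])
  have \<pi>_cont: "continuous_on UNIV \<pi>"
    by (rule N.continuous_quotient_lift) (simp add: proj q1_cont)
  define L where "L = left_transl G q1"
  have L: "L a (q1 g) = q1 (a \<otimes>\<^bsub>G\<^esub> g)" for a g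
  proof -
    have "inv\<^bsub>G\<^esub> (rep (q1 g)) \<otimes>\<^bsub>G\<^esub> g \<in> lower_central G 1 <#>\<^bsub>G\<^esub> \<Gamma>" using rep q1(3) by metis
    then have "q1 (a \<otimes>\<^bsub>G\<^esub> rep (q1 g)) = q1 (a \<otimes>\<^bsub>G\<^esub> g)" unfolding q1(3) N.cancel_left .
    then show ?thesis by (simp add: L_def left_transl_def rep_def)
  qed
  have L_cont: "continuous_on UNIV (L a)" for a
  proof (rule lift1)
    have "continuous_on UNIV (\<lambda>g. a \<otimes>\<^bsub>G\<^esub> g)"
      by (intro N.continuous_mult continuous_intros)
    then show "continuous_on UNIV (\<lambda>g. L a (q1 g))"
      unfolding L by (rule continuous_on_compose2[OF q1_cont]) auto
  qed
  have m1: "sets m1 = sets borel" "distr m1 borel (L a) = m1" for a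
    using haar1 tg(2) unfolding haar_on_quotient_def L_def by auto
  \<comment> \<open>A \<open>G1\<close>-invariant \<open>h\<close> factors through \<pi>, so its
    integral depends only on the projected measure \<open>m1\<close>, which is invariant under
    translations of the torus.\<close>
  have mu_inv: "(\<integral>x. h (N.act a x) \<partial>\<mu>) = (\<integral>x. h x \<partial>\<mu>)"
    if h: "ccont h" and inv: "\<And>z x. z \<in> N.G1 \<Longrightarrow> h (N.act z x) = h x" for h a
  proof -
    define F where "F y = h (q (rep y))" for y
    have F: "F (q1 g) = h (q g)" for g
    proof -
      let ?r = "rep (q1 g)"
      have "inv\<^bsub>G\<^esub> ?r \<otimes>\<^bsub>G\<^esub> g \<in> lower_central G 1 <#>\<^bsub>G\<^esub> \<Gamma>" using rep q1(3) by metis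
      then obtain z \<gamma> where z: "z \<in> N.G1" "\<gamma> \<in> \<Gamma>" "inv\<^bsub>G\<^esub> ?r \<otimes>\<^bsub>G\<^esub> g = z \<otimes>\<^bsub>G\<^esub> \<gamma>"
        unfolding set_mult_def by blast
      have "g = ?r \<otimes>\<^bsub>G\<^esub> (inv\<^bsub>G\<^esub> ?r \<otimes>\<^bsub>G\<^esub> g)" by (rule N.inv_cancel(2)[symmetric])
      \<comment> \<open>Two representatives of one point of the torus differ by z \<gamma>; moving
        the central \<open>z\<close> to the left leaves \<gamma>, which \<open>q\<close> does not
        see, and \<open>z\<close>, which \<open>h\<close> does not see.\<close>
      also have "\<dots> = (z \<otimes>\<^bsub>G\<^esub> ?r) \<otimes>\<^bsub>G\<^esub> \<gamma>"
        unfolding z(3) using N.G1_central[OF z(1), of ?r] by (simp add: N.m_assoc[symmetric])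
      finally have "inv\<^bsub>G\<^esub> (z \<otimes>\<^bsub>G\<^esub> ?r) \<otimes>\<^bsub>G\<^esub> g = \<gamma>"
        using N.inv_cancel(1) by metis
      then have "q (z \<otimes>\<^bsub>G\<^esub> ?r) = q g" using z(2) by (simp add: N.q_eq_iff)
      then have "h (q g) = h (N.act z (q ?r))" by simp
      then have "h (q g) = h (q ?r)" unfolding inv[OF z(1)] .
      then show ?thesis by (simp add: F_def)
    qed
    have Fc: "continuous_on UNIV F"
      by (rule lift1) (use h in \<open>simp add: F continuous_on_compose2[OF _ N.q_cont]\<close>)
    have F\<pi>: "F (\<pi> x) = h x" and L\<pi>: "\<pi> (N.act a x) = L a (\<pi> x)" for x
    proof -
      obtain g where g: "x = q g" by (rule N.q_surj)
      show "F (\<pi> x) = h x" using proj F g by simp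
      show "\<pi> (N.act a x) = L a (\<pi> x)" using proj L g by simp
    qed
    have \<pi>_meas: "\<pi> \<in> measurable \<mu> borel"
      by (rule compact_prob_space.measurable_continuous[OF mu \<pi>_cont])
    have L_meas: "L a \<in> measurable m1 borel"
      using borel_measurable_continuous_onI[OF L_cont] measurable_cong_sets[OF m1(1) refl] by blast
    have F_meas: "F \<in> borel_measurable borel" by (rule borel_measurable_continuous_onI[OF Fc])
    have FL_meas: "(\<lambda>y. F (L a y)) \<in> borel_measurable borel"
      by (rule borel_measurable_continuous_onI[OF continuous_on_compose2[OF Fc L_cont]]) auto
    have "(\<integral>x. h (N.act a x) \<partial>\<mu>) = (\<integral>x. F (L a (\<pi> x)) \<partial>\<mu>)"
      by (simp add: F\<pi>[symmetric] L\<pi>)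
    also have "\<dots> = (\<integral>y. F (L a y) \<partial>distr \<mu> borel \<pi>)"
      by (rule integral_distr[OF \<pi>_meas FL_meas, symmetric])
    also have "\<dots> = (\<integral>y. F (L a y) \<partial>m1)" by (simp add: mu_proj)
    also have "\<dots> = (\<integral>y. F y \<partial>distr m1 borel (L a))"
      by (rule integral_distr[OF L_meas F_meas, symmetric])
    also have "\<dots> = (\<integral>y. F y \<partial>distr \<mu> borel \<pi>)" by (simp add: m1 mu_proj)
    also have "\<dots> = (\<integral>x. F (\<pi> x) \<partial>\<mu>)" by (rule integral_distr[OF \<pi>_meas F_meas])
    also have "\<dots> = (\<integral>x. h x \<partial>\<mu>)" by (simp add: F\<pi>)
    finally show ?thesis .
  qed
  show ?thesis
    unfolding T by (rule N.nilsystem_weak_limit[OF mu mu_inv f_cont])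
qed

end
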